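(* Let $X$ be a rearrangement invariant space on $(-1,1)$ satisfying $0<\underline{\alpha}_X\le \overline{\alpha}_X<1$. Then $[T,X]$ (with norm $\|f\|_{[T,X]}:=\sup\{\|T(h)\|_X: h\in L^0,\ |h|\le|f|\text{ a.e.}\}$) is the largest Banach function space containing $X$ to which $T_X\colon X\to X$ has a continuous, linear, $X$-valued extension: namely, $X\subseteq[T,X]$ continuously, $T$ maps $[T,X]$ continuously into $X$, and every Banach function space $Z$ with $X\subseteq Z\subseteq L^1$ such that $T$ maps $Z$ continuously and linearly into $X$ satisfies $Z\subseteq[T,X]$ continuously.
   Context: We work on $(-1,1)$ with Lebesgue measure; $L^0$ is the space of complex measurable functions. A Banach function space (B.f.s.) is a Banach space $Z\subseteq L^0$ with the ideal property and the Fatou property. A rearrangement invariant (r.i.) space is a B.f.s. $X$ with $g\in X$, $\|g\|_X\le\|f\|_X$ whenever $f\in X$ and $g^*\le f^*$ ($f^*$ the decreasing rearrangement). For $t>0$ let $E_t f(s)=f(st)$ if $|st|\le1$, $0$ otherwise; the Boyd indices are $\underline{\alpha}_X=\sup_{0<t<1}\frac{\log\|E_{1/t}\|_{X\to X}}{\log t}$ and $\overline{\alpha}_X=\inf_{1<t<\infty}\frac{\log\|E_{1/t}\|_{X\to X}}{\log t}$. The finite Hilbert transform of $f\in L^1(-1,1)$ is $(Tf)(t)=\lim_{\varepsilon\to0^+}\frac1\pi\big(\int_{-1}^{t-\varepsilon}+\int_{t+\varepsilon}^1\big)\frac{f(x)}{x-t}\,dx$ (exists a.e.); for such $X$ it maps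 $X$ boundedly into $X$, denoted $T_X$. Define $[T,X]:=\{f\in L^1: T(h)\in X \text{ for all } h\in L^0 \text{ with } |h|\le|f| \text{ a.e.}\}$; it is a Banach function space under $\|\cdot\|_{[T,X]}$. *)

theory Defs
  imports "HOL-Analysis.Analysis"
begin

abbreviation M1 :: "real measure" where
  "M1 \<equiv> lebesgue_on {-1<..<1::real}"

definition L0 :: "(real \<Rightarrow> complex) set" where
  "L0 = borel_measurable M1"

definition L1 :: "(real \<Rightarrow> complex) set" where
  "L1 = {f. integrable M1 f}"

text \<open>A Banach function space is given by its (extended) norm rho; the space is
  the set of measurable functions of finite norm.\<close>

definition bfs_space :: "((real \<Rightarrow> complex) \<Rightarrow> ennreal) \<Rightarrow> (real \<Rightarrow> complex) set" where
  "bfs_space \<rho> = {f \<in> L0. \<rho> f < \<infinity>}"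

definition bfs :: "((real \<Rightarrow> complex) \<Rightarrow> ennreal) \<Rightarrow> bool" where
  "bfs \<rho> \<longleftrightarrow>
     (\<forall>f\<in>L0. \<rho> f = 0 \<longleftrightarrow> (AE x in M1. f x = 0)) \<and>
     (\<forall>f\<in>L0. \<forall>g\<in>L0. \<rho> (\<lambda>x. f x + g x) \<le> \<rho> f + \<rho> g) \<and>
     (\<forall>f\<in>L0. \<forall>c. \<rho> (\<lambda>x. c * f x) = ennreal (cmod c) * \<rho> f) \<and>
     \<comment> \<open>ideal property\<close>
     (\<forall>f\<in>L0. \<forall>g\<in>L0. (AE x in M1. cmod (g x) \<le> cmod (f x)) \<longrightarrow> \<rho> g \<le> \<rho> f) \<and>
     \<comment> \<open>Fatou property\<close>
     (\<forall>F f. (\<forall>n. F n \<in> L0) \<longrightarrow> f \<in> L0 \<longrightarrow>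
        (AE x in M1. incseq (\<lambda>n. cmod (F n x)) \<and> (\<lambda>n. cmod (F n x)) \<longlonglongrightarrow> cmod (f x)) \<longrightarrow>
        (\<lambda>n. \<rho> (F n)) \<longlonglongrightarrow> \<rho> f) \<and>
     \<comment> \<open>completeness\<close>
     (\<forall>F. (\<forall>n. F n \<in> bfs_space \<rho>) \<longrightarrow>
        (\<forall>e>0. \<exists>N. \<forall>m\<ge>N. \<forall>n\<ge>N. \<rho> (\<lambda>x. F m x - F n x) < ennreal e) \<longrightarrow>
        (\<exists>f\<in>bfs_space \<rho>. (\<lambda>n. \<rho> (\<lambda>x. F n x - f x)) \<longlonglongrightarrow> 0))"

definition distr_fun :: "(real \<Rightarrow> complex) \<Rightarrow> real \<Rightarrow> ennreal" where
  "distr_fun f s = emeasure M1 {x \<in> space M1. s < cmod (f x)}"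

definition rearr :: "(real \<Rightarrow> complex) \<Rightarrow> real \<Rightarrow> ennreal" where
  "rearr f t = Inf {ennreal s | s. 0 \<le> s \<and> distr_fun f s \<le> ennreal t}"

definition ri_space :: "((real \<Rightarrow> complex) \<Rightarrow> ennreal) \<Rightarrow> bool" where
  "ri_space \<rho> \<longleftrightarrow> bfs \<rho> \<and>
     (\<forall>f\<in>bfs_space \<rho>. \<forall>g\<in>L0. (\<forall>t>0. rearr g t \<le> rearr f t) \<longrightarrow>
        g \<in> bfs_space \<rho> \<and> \<rho> g \<le> \<rho> f)"

definition dil :: "real \<Rightarrow> (real \<Rightarrow> complex) \<Rightarrow> real \<Rightarrow> complex" where
  "dil t f s = (if \<bar>s * t\<bar> \<le> 1 then f (s * t) else 0)"

definition dil_norm :: "((real \<Rightarrow> complex) \<Rightarrow> ennreal) \<Rightarrow> real \<Rightarrow> ennreal" where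
  "dil_norm \<rho> t = Sup {\<rho> (dil t f) | f. f \<in> bfs_space \<rho> \<and> \<rho> f \<le> 1}"

definition boyd_lower :: "((real \<Rightarrow> complex) \<Rightarrow> ennreal) \<Rightarrow> real" where
  "boyd_lower \<rho> = Sup {ln (enn2real (dil_norm \<rho> (1 / t))) / ln t | t. 0 < t \<and> t < 1}"

definition boyd_upper :: "((real \<Rightarrow> complex) \<Rightarrow> ennreal) \<Rightarrow> real" where
  "boyd_upper \<rho> = Inf {ln (enn2real (dil_norm \<rho> (1 / t))) / ln t | t. 1 < t}"

definition hilbert :: "(real \<Rightarrow> complex) \<Rightarrow> real \<Rightarrow> complex" where
  "hilbert f t = Lim (at_right 0)
     (\<lambda>\<epsilon>::real. complex_of_real (1 / pi) *
        (LINT x : {x. -1 < x \<and> x < 1 \<and> \<epsilon> < \<bar>x - t\<bar>} | lebesgue. f x / complex_of_real (x - t)))"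

definition TX :: "((real \<Rightarrow> complex) \<Rightarrow> ennreal) \<Rightarrow> (real \<Rightarrow> complex) set" where
  "TX \<rho> = {f \<in> L1. \<forall>h\<in>L0. (AE x in M1. cmod (h x) \<le> cmod (f x)) \<longrightarrow> hilbert h \<in> bfs_space \<rho>}"

definition TX_norm :: "((real \<Rightarrow> complex) \<Rightarrow> ennreal) \<Rightarrow> (real \<Rightarrow> complex) \<Rightarrow> ennreal" where
  "TX_norm \<rho> f = (if f \<in> TX \<rho>
      then Sup {\<rho> (hilbert h) | h. h \<in> L0 \<and> (AE x in M1. cmod (h x) \<le> cmod (f x))}
      else \<infinity>)"

end

theory Submission
  imports Defs "HOL-Computational_Algebra.Polynomial"
begin

text \<open>That \<open>[T,X]\<close> is optimal is soft: a space mapped into \<open>X\<close> by \<open>T\<close> has the ideal property, so it controls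
  \<open>T h\<close> for all \<open>h\<close> dominated by one of its elements. The work lies in three other places.

  Boundedness of \<open>T\<close> on \<open>X\<close>: Loomis' computation of the distribution function of \<open>\<Sum> c\<^sub>i / (a\<^sub>i - x)\<close> gives, after
  discretisation, the weak (1,1) bound for the conjugate Poisson integrals at a fixed height, and a covering argument
  passes to their maximal function. The latter satisfies a good-lambda inequality relative to the Poisson maximal
  function. Iterated along the scales \<open>q^k t\<close>, it bounds the decreasing rearrangement of \<open>T f\<close> by a double series of
  dilates of that of \<open>f\<close>, whose norms decay geometrically because of the Boyd indices.

  Existence of \<open>T f\<close> a.e. for \<open>f\<close> in \<open>L\<^sup>1\<close>: the maximal bound, together with approximation by functions that are
  locally constant off a null set.

  \<open>[T,X]\<close> is a Banach function space: evaluating \<open>T\<close> of the restriction of \<open>|f|\<close> to one half of the interval on the other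
  half shows that the norm dominates the \<open>L\<^sup>1\<close> norm, which yields definiteness, the Fatou property and completeness;
  a gliding hump argument shows that the norm is finite.\<close>

text \<open>The only information on X is the size of its dilation norms, so boundedness has to come
  from control of rearrangements. Each Boyd index pays for one series: \<open>boyd_lower\<close> > 0
  provides a dilation by some q > 1 of norm below 1, which sums the scales q^k t of the iterated
  good-lambda inequality; \<open>boyd_upper\<close> < 1 provides B > 1 such that dilation by 1/B has
  norm below B, which sums the scales t/B^j that bound the maximal function. Conjugate Poisson
  kernels stand in for truncated kernels because they vary smoothly: moving the point or the height
  costs a multiple of the Poisson kernel, so one maximal function absorbs every error term.
  Truncations return at the end, by comparison at equal height. Loomis' computation is purely
  algebraic and supplies the first weak type bound, from which all the others follow by covering
  arguments. The transform is a \<open>Lim\<close>, hence meaningful only almost everywhere;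
  identities between transforms are used only under \<rho>, which does not see null sets. The large
  numerical constants are chosen with room to spare.\<close>

section \<open>Covering and kernels\<close>

text \<open>Vitali's covering lemma selects disjoint balls whose fivefold enlargements still cover
  G; summing the local estimates over them gives the global one. The measure \<nu> will be a
  multiple of |f|, then ten times Lebesgue measure on a level set, then \<delta> times Lebesgue
  measure.\<close>

lemma covering_bound:
  fixes \<nu> :: "real measure" and G E :: "real set" and B :: real
  assumes \<nu>: "sets \<nu> = sets lebesgue" and G: "G \<in> sets lebesgue" and E: "E \<in> sets lebesgue"
    and r: "\<And>x. x \<in> G \<Longrightarrow> \<exists>r>0. r \<le> B + \<bar>x\<bar> \<and> cball x r \<subseteq> E \<and>
              emeasure lebesgue (G \<inter> cball x (5 * r)) \<le> emeasure \<nu> (cball x r)"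
  shows "emeasure lebesgue G \<le> emeasure \<nu> E"
proof -
  \<comment> \<open>Vitali's lemma needs a common bound on the radii, and radii up to B + |x| are
    allowed. So G is first cut to a bounded set, and the cut is removed by continuity from
    below.\<close>
  have bd: "emeasure lebesgue (G \<inter> cball 0 (real n)) \<le> emeasure \<nu> E" for n
  proof -
    let ?K = "G \<inter> cball 0 (real n)"
    obtain r where r: "\<And>x. x \<in> ?K \<Longrightarrow> 0 < r x \<and> r x \<le> B + \<bar>x\<bar> \<and> cball x (r x) \<subseteq> E \<and>
              emeasure lebesgue (G \<inter> cball x (5 * r x)) \<le> emeasure \<nu> (cball x (r x))"
      using r bchoice[of ?K "\<lambda>x r. 0 < r \<and> r \<le> B + \<bar>x\<bar> \<and> cball x r \<subseteq> E \<and>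
              emeasure lebesgue (G \<inter> cball x (5 * r)) \<le> emeasure \<nu> (cball x r)"] by blast
    have r': "0 < r x \<and> r x \<le> B + real n" if "x \<in> ?K" for x
      using r[OF that] that by (auto simp: dist_norm)
    have cov: "?K \<subseteq> (\<Union>i\<in>?K. cball i (r i))"
      using r' by force
    obtain C where C: "countable C" "C \<subseteq> ?K"
      and disj: "pairwise (\<lambda>i j. disjnt (cball i (r i)) (cball j (r j))) C"
      and sub: "?K \<subseteq> (\<Union>i\<in>C. cball i (5 * r i))"
      by (rule Vitali_covering_lemma_cballs[where a="\<lambda>i. i", OF cov r']) (blast intro: that)+
    have meas: "cball i (r i) \<in> sets \<nu>" for i
      by (simp add: \<nu>)
    have "emeasure lebesgue ?K \<le> emeasure lebesgue (\<Union>i\<in>C. G \<inter> cball i (5 * r i))"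
      using sub C(1) G by (intro emeasure_mono sets.countable_UN') auto
    also have "\<dots> \<le> (\<integral>\<^sup>+i. emeasure lebesgue (G \<inter> cball i (5 * r i)) \<partial>count_space C)"
    proof (cases "C = {}")
      case False
      \<comment> \<open>Countable subadditivity wants a sequence: the balls are enumerated along
        \<open>to_nat_on C\<close>, with empty sets at the remaining indices.\<close>
      define A where "A n = (if n \<in> to_nat_on C ` C then
          G \<inter> cball (from_nat_into C n) (5 * r (from_nat_into C n)) else {})" for n
      have eq: "(\<Union>i\<in>C. G \<inter> cball i (5 * r i)) = (\<Union>n. A n)"
        using C(1) by (auto simp: A_def)
      have "emeasure lebesgue (\<Union>n. A n) \<le> (\<Sum>n. emeasure lebesgue (A n))"
        using G by (intro emeasure_subadditive_countably) (auto simp: A_def)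
      also have "\<dots> = (\<integral>\<^sup>+n. emeasure lebesgue (A n) \<partial>count_space UNIV)"
        by (simp add: nn_integral_count_space_nat)
      also have "\<dots> = (\<integral>\<^sup>+n. emeasure lebesgue (A n) * indicator (to_nat_on C ` C) n \<partial>count_space UNIV)"
        by (intro nn_integral_cong) (auto simp: A_def split: split_indicator)
      also have "\<dots> = (\<integral>\<^sup>+n. emeasure lebesgue (A n) \<partial>count_space (to_nat_on C ` C))"
        by (simp add: nn_integral_count_space_indicator)
      also have "\<dots> = (\<integral>\<^sup>+i. emeasure lebesgue (A (to_nat_on C i)) \<partial>count_space C)"
        using inj_on_to_nat_on[OF C(1)]
        by (intro nn_integral_bij_count_space[symmetric]) (simp add: inj_on_imp_bij_betw)
      also have "\<dots> = (\<integral>\<^sup>+i. emeasure lebesgue (G \<inter> cball i (5 * r i)) \<partial>count_space C)"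
        using C(1) by (intro nn_integral_cong) (auto simp: A_def)
      finally show ?thesis by (simp only: eq)
    qed auto
    also have "\<dots> \<le> (\<integral>\<^sup>+i. emeasure \<nu> (cball i (r i)) \<partial>count_space C)"
      using r C(2) by (intro nn_integral_mono) (simp add: subset_iff)
    also have "\<dots> = emeasure \<nu> (\<Union>i\<in>C. cball i (r i))"
      using disj by (intro emeasure_UN_countable[symmetric] meas C(1))
        (auto simp: disjoint_family_on_def pairwise_def disjnt_def)
    also have "\<dots> \<le> emeasure \<nu> E"
    proof (intro emeasure_mono UN_least)
      show "cball i (r i) \<subseteq> E" if "i \<in> C" for i using r[of i] C(2) that by blast
    qed (use E in \<open>simp add: \<nu>\<close>)
    finally show ?thesis .
  qed
  have "(\<Union>n. G \<inter> cball 0 (real n)) = G"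
    by (auto simp: dist_norm real_arch_simple)
  moreover have "(SUP n. emeasure lebesgue (G \<inter> cball 0 (real n))) = emeasure lebesgue (\<Union>n. G \<inter> cball 0 (real n))"
    using G by (intro SUP_emeasure_incseq) (auto simp: incseq_def)
  ultimately have "emeasure lebesgue G = (SUP n. emeasure lebesgue (G \<inter> cball 0 (real n)))"
    by simp
  also have "\<dots> \<le> emeasure \<nu> E"
    by (intro SUP_least bd)
  finally show ?thesis .
qed

text \<open>The kernel is evaluated at u - x, the orientation of the finite Hilbert transform, so
  that \<open>kconv (hk h)\<close> is its truncation up to the factor 1/\<pi>.\<close>

definition kconv :: "(real \<Rightarrow> real) \<Rightarrow> (real \<Rightarrow> 'a::{banach,second_countable_topology}) \<Rightarrow> real \<Rightarrow> 'a" where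
  "kconv k f x = (LINT u|lebesgue. k (u - x) *\<^sub>R f u)"

text \<open>Up to the factor \<open>1/\<pi>\<close>: the Poisson, conjugate Poisson and truncated Hilbert kernels at height \<open>h\<close>.\<close>

definition pk :: "real \<Rightarrow> real \<Rightarrow> real" where "pk h s = h / (s\<^sup>2 + h\<^sup>2)"
definition qk :: "real \<Rightarrow> real \<Rightarrow> real" where "qk h s = s / (s\<^sup>2 + h\<^sup>2)"
definition hk :: "real \<Rightarrow> real \<Rightarrow> real" where "hk h s = (if h < \<bar>s\<bar> then 1 / s else 0)"

lemma measurable_kernel_shift:
  fixes k :: "real \<Rightarrow> real"
  assumes "k \<in> borel_measurable borel"
  shows "(\<lambda>u. k (u - x)) \<in> borel_measurable lebesgue"
proof -
  have "(\<lambda>u. k (u - x)) \<in> borel_measurable lborel"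
    using assms by measurable
  then show ?thesis by (rule measurable_completion)
qed

lemma integrable_kernel:
  fixes f :: "real \<Rightarrow> 'a::{banach,second_countable_topology}"
  assumes "k \<in> borel_measurable borel" "\<And>s. \<bar>k s\<bar> \<le> C" "integrable lebesgue f"
  shows "integrable lebesgue (\<lambda>u. k (u - x) *\<^sub>R f u)"
proof (rule Bochner_Integration.integrable_bound)
  show "integrable lebesgue (\<lambda>u. C *\<^sub>R f u)" using assms(3) by simp
  show "(\<lambda>u. k (u - x) *\<^sub>R f u) \<in> borel_measurable lebesgue"
    using measurable_kernel_shift[OF assms(1)] assms(3) by (intro borel_measurable_scaleR) auto
  show "AE u in lebesgue. norm (k (u - x) *\<^sub>R f u) \<le> norm (C *\<^sub>R f u)"
    using order_trans[OF assms(2) abs_ge_self] by (auto intro!: mult_right_mono)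
qed

text \<open>The finite set D is there for the jumps of \<open>hk h\<close> at h and -h. A translate
  of D is a null set, so dominated convergence still applies.\<close>

lemma isCont_kconv:
  fixes f :: "real \<Rightarrow> 'a::{banach,second_countable_topology}"
  assumes k: "k \<in> borel_measurable borel" "\<And>s. \<bar>k s\<bar> \<le> C" and f: "integrable lebesgue f"
    and D: "finite D" "\<And>s. s \<notin> D \<Longrightarrow> isCont k s"
  shows "isCont (kconv k f) x"
  unfolding continuous_at_sequentially
proof (intro allI impI)
  fix X :: "nat \<Rightarrow> real" assume X: "X \<longlonglongrightarrow> x"
  show "(kconv k f \<circ> X) \<longlonglongrightarrow> kconv k f x"
    unfolding kconv_def o_def
  proof (rule integral_dominated_convergence[where w="\<lambda>u. C * norm (f u)"])
    show "(\<lambda>u. k (u - x) *\<^sub>R f u) \<in> borel_measurable lebesgue"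
      using integrable_kernel[OF k f, of x] by auto
    show "(\<lambda>u. k (u - X i) *\<^sub>R f u) \<in> borel_measurable lebesgue" for i
      using integrable_kernel[OF k f, of "X i"] by auto
    show "integrable lebesgue (\<lambda>u. C * norm (f u))" using f by simp
    show "AE u in lebesgue. norm (k (u - X i) *\<^sub>R f u) \<le> C * norm (f u)" for i
      using k(2) by (auto intro!: mult_right_mono)
    have "AE u in lebesgue. u \<notin> (\<lambda>s. s + x) ` D"
      using D(1) by (intro AE_not_in) (auto simp: negligible_iff_null_sets[symmetric] intro!: negligible_finite)
    then show "AE u in lebesgue. (\<lambda>i. k (u - X i) *\<^sub>R f u) \<longlonglongrightarrow> k (u - x) *\<^sub>R f u"
    proof eventually_elim
      case (elim u)
      then have "u - x \<notin> D" by (metis diff_add_cancel image_eqI)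
      then have "isCont k (u - x)" by (rule D(2))
      then have "(\<lambda>i. k (u - X i)) \<longlonglongrightarrow> k (u - x)"
        by (rule isCont_tendsto_compose) (intro tendsto_intros X)
      then show ?case by (intro tendsto_intros)
    qed
  qed
qed

lemma norm_kconv_le:
  fixes f :: "real \<Rightarrow> 'a::{banach,second_countable_topology}"
  assumes k: "k \<in> borel_measurable borel" "\<And>s. \<bar>k s\<bar> \<le> C" and f: "integrable lebesgue f"
  shows "norm (kconv k f x) \<le> C * (LINT u|lebesgue. norm (f u))"
proof -
  have "norm (kconv k f x) \<le> (LINT u|lebesgue. norm (k (u - x) *\<^sub>R f u))"
    unfolding kconv_def by (rule integral_norm_bound)
  also have "\<dots> \<le> (LINT u|lebesgue. C * norm (f u))"
    using integrable_norm[OF integrable_kernel[OF k f, of x]] f k(2)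
    by (intro integral_mono) (auto intro!: mult_right_mono)
  finally show ?thesis by simp
qed

text \<open>The common form of all kernel comparisons below. Kernels, base points and the centre y
  of the majorant are independent, and the inequality is asked only where f does not vanish, so that
  far parts of a function can be compared away from the singularity.\<close>

lemma kconv_diff_le:
  fixes f :: "real \<Rightarrow> 'a::{banach,second_countable_topology}"
  assumes k: "k \<in> borel_measurable borel" "\<And>s. \<bar>k s\<bar> \<le> C"
    and k': "k' \<in> borel_measurable borel" "\<And>s. \<bar>k' s\<bar> \<le> C'"
    and m: "m \<in> borel_measurable borel" "\<And>s. \<bar>m s\<bar> \<le> C''"
    and f: "integrable lebesgue f"
    and le: "\<And>u. f u \<noteq> 0 \<Longrightarrow> \<bar>k (u - x) - k' (u - x')\<bar> \<le> c * m (u - y)"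
  shows "norm (kconv k f x - kconv k' f x') \<le> c * kconv m (\<lambda>u. norm (f u)) y"
proof -
  note i = integrable_kernel[OF k f] integrable_kernel[OF k' f] 
  have im: "integrable lebesgue (\<lambda>u. m (u - y) *\<^sub>R norm (f u))"
    using f by (intro integrable_kernel[OF m]) auto
  have "kconv k f x - kconv k' f x' = (LINT u|lebesgue. k (u - x) *\<^sub>R f u - k' (u - x') *\<^sub>R f u)"
    unfolding kconv_def using i by simp
  also have "norm \<dots> \<le> (LINT u|lebesgue. norm (k (u - x) *\<^sub>R f u - k' (u - x') *\<^sub>R f u))"
    by (rule integral_norm_bound)
  also have "\<dots> \<le> (LINT u|lebesgue. c * (m (u - y) *\<^sub>R norm (f u)))"
  proof (intro integral_mono)
    show "integrable lebesgue (\<lambda>u. norm (k (u - x) *\<^sub>R f u - k' (u - x') *\<^sub>R f u))"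
      using i by simp
    show "integrable lebesgue (\<lambda>u. c * (m (u - y) *\<^sub>R norm (f u)))" using im by simp
    show "norm (k (u - x) *\<^sub>R f u - k' (u - x') *\<^sub>R f u) \<le> c * (m (u - y) *\<^sub>R norm (f u))" for u
      using mult_right_mono[OF le[of u], of "norm (f u)"]
      by (cases "f u = 0") (auto simp flip: scaleR_diff_left)
  qed
  also have "\<dots> = c * kconv m (\<lambda>u. norm (f u)) y"
    unfolding kconv_def by simp
  finally show ?thesis .
qed

section \<open>The three kernels: bounds, measurability and continuity\<close>

lemma kernel_bounds:
  assumes "0 < h"
  shows "\<bar>pk h s\<bar> \<le> 1 / h" "\<bar>qk h s\<bar> \<le> 1 / h" "\<bar>hk h s\<bar> \<le> 1 / h" "0 < pk h s"
proof -
  have p: "0 < s\<^sup>2 + h\<^sup>2" using assms by (simp add: add_nonneg_pos)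
  then show "0 < pk h s" using assms by (simp add: pk_def)
  then show "\<bar>pk h s\<bar> \<le> 1 / h"
    using p assms by (simp add: pk_def field_simps power2_eq_square)
  have "\<bar>s\<bar> * h \<le> s\<^sup>2 + h\<^sup>2"
  proof -
    have "0 \<le> (\<bar>s\<bar> - h)\<^sup>2" by simp
    moreover have "0 \<le> \<bar>s\<bar> * h" using assms by simp
    ultimately show ?thesis by (simp add: power2_diff)
  qed
  then show "\<bar>qk h s\<bar> \<le> 1 / h"
    using p assms by (simp add: qk_def field_simps abs_of_pos)
  show "\<bar>hk h s\<bar> \<le> 1 / h"
    using assms by (auto simp: hk_def frac_le)
qed

lemma kernel_measurable [measurable]:
  "pk h \<in> borel_measurable borel" "qk h \<in> borel_measurable borel" "hk h \<in> borel_measurable borel"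
  unfolding pk_def[abs_def] qk_def[abs_def] hk_def[abs_def] by measurable

lemma isCont_kernels:
  assumes "0 < h"
  shows "isCont (pk h) s" "isCont (qk h) s" "s \<notin> {h, -h} \<Longrightarrow> isCont (hk h) s"
proof -
  have p: "s\<^sup>2 + h\<^sup>2 \<noteq> 0" using assms by (simp add: add_nonneg_eq_0_iff)
  show "isCont (pk h) s" unfolding pk_def[abs_def] using p by (intro continuous_intros) auto
  show "isCont (qk h) s" unfolding qk_def[abs_def] using p by (intro continuous_intros) auto
  assume s: "s \<notin> {h, -h}"
  show "isCont (hk h) s"
  proof (cases "h < \<bar>s\<bar>")
    case True
    have "isCont (\<lambda>s. 1 / s) s" using True assms by (intro continuous_intros) auto
    moreover have "\<forall>\<^sub>F t in nhds s. hk h t = 1 / t"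
    proof -
      have "open {t::real. h < \<bar>t\<bar>}" by (intro open_Collect_less continuous_intros)
      then have "\<forall>\<^sub>F t in nhds s. t \<in> {t. h < \<bar>t\<bar>}" using True by (intro eventually_nhds_in_open) auto
      then show ?thesis by eventually_elim (auto simp: hk_def)
    qed
    ultimately show ?thesis by (simp add: isCont_cong)
  next
    case False
    with s have "\<bar>s\<bar> < h" by auto
    have "isCont (\<lambda>s. 0::real) s" by simp
    moreover have "\<forall>\<^sub>F t in nhds s. hk h t = 0"
    proof -
      have "open {t::real. \<bar>t\<bar> < h}" by (intro open_Collect_less continuous_intros)
      then have "\<forall>\<^sub>F t in nhds s. t \<in> {t. \<bar>t\<bar> < h}" using \<open>\<bar>s\<bar> < h\<close> by (intro eventually_nhds_in_open) auto
      then show ?thesis by eventually_elim (auto simp: hk_def)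
    qed
    ultimately show ?thesis by (simp add: isCont_cong)
  qed
qed

lemma isCont_kconv_kernels:
  fixes f :: "real \<Rightarrow> 'a::{banach,second_countable_topology}"
  assumes "0 < h" "integrable lebesgue f"
  shows "isCont (kconv (pk h) f) x" "isCont (kconv (qk h) f) x" "isCont (kconv (hk h) f) x"
proof -
  show "isCont (kconv (pk h) f) x" "isCont (kconv (qk h) f) x"
    using kernel_bounds[OF assms(1)] isCont_kernels(1,2)[OF assms(1)] assms(2)
    by (auto intro!: isCont_kconv[where D="{}" and C="1/h"])
  show "isCont (kconv (hk h) f) x"
    using kernel_bounds[OF assms(1)] isCont_kernels(3)[OF assms(1)] assms(2)
    by (intro isCont_kconv[where D="{h,-h}" and C="1/h"]) auto
qed

text \<open>Superlevel sets of the Poisson and conjugate Poisson maximal functions are encoded by an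
  existential over the height: no supremum has to be finite, and openness, hence measurability, is
  that of a union.\<close>

definition Mset :: "(real \<Rightarrow> complex) \<Rightarrow> real \<Rightarrow> real set" where
  "Mset f b = {x. \<exists>h>0. kconv (pk h) (\<lambda>u. norm (f u)) x > b}"

definition Hset :: "(real \<Rightarrow> complex) \<Rightarrow> real \<Rightarrow> real set" where
  "Hset f a = {x. \<exists>h>0. norm (kconv (qk h) f x) > a}"

lemma open_Mset: assumes "integrable lebesgue f" shows "open (Mset f b)"
proof -
  have "Mset f b = (\<Union>h\<in>{0<..}. {x. b < kconv (pk h) (\<lambda>u. norm (f u)) x})"
    by (auto simp: Mset_def)
  also have "open \<dots>"
    using assms by (intro open_UN ballI open_Collect_less continuous_at_imp_continuous_on isCont_kconv_kernels continuous_const)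
       auto
  finally show ?thesis .
qed

lemma open_Hset: assumes "integrable lebesgue f" shows "open (Hset f b)"
proof -
  have "Hset f b = (\<Union>h\<in>{0<..}. {x. b < norm (kconv (qk h) f x)})"
    by (auto simp: Hset_def)
  also have "open \<dots>"
    using assms by (intro open_UN ballI open_Collect_less continuous_on_norm continuous_at_imp_continuous_on isCont_kconv_kernels continuous_const)
       auto
  finally show ?thesis .
qed

lemma sets_Mset_Hset:
  assumes "integrable lebesgue f"
  shows "Mset f b \<in> sets lebesgue" "Hset f b \<in> sets lebesgue"
  using open_Mset[OF assms] open_Hset[OF assms] by auto

text \<open>Majorises the Poisson kernel by weighted indicators of the balls of radius 2^k h, so
  that bounds for averages over balls carry over to Poisson averages.\<close>

lemma pk_le_dyadic:
  assumes "0 < h" shows "\<exists>k::nat. \<bar>s\<bar> \<le> 2 ^ k * h \<and> pk h s \<le> 4 / (4 ^ k * h)"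
proof -
  obtain n :: nat where "\<bar>s\<bar> / h < 2 ^ n" using real_arch_pow[of 2 "\<bar>s\<bar> / h"] by auto
  then have ex: "\<exists>n::nat. \<bar>s\<bar> \<le> 2 ^ n * h" using assms by (auto simp: field_simps intro!: exI[of _ n])
  \<comment> \<open>For the least such k > 0, s lies outside the ball of radius 2^(k-1) h, where the
    kernel is at most h divided by 4^(k-1) h^2. The weight 4 covers k = 0 as well.\<close>
  define k where "k = (LEAST n. \<bar>s\<bar> \<le> 2 ^ n * h)"
  have k: "\<bar>s\<bar> \<le> 2 ^ k * h" unfolding k_def by (rule LeastI_ex[OF ex])
  show ?thesis
  proof (cases k)
    case 0
    have "pk h s \<le> 1 / h" using kernel_bounds(1)[OF assms, of s] by auto
    also have "\<dots> \<le> 4 / h" using assms by (simp add: divide_right_mono)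
    finally show ?thesis using k 0 by (intro exI[of _ k]) auto
  next
    case (Suc j)
    then have "\<not> \<bar>s\<bar> \<le> 2 ^ j * h" using not_less_Least[of j "\<lambda>n. \<bar>s\<bar> \<le> 2 ^ n * h"] by (simp add: k_def)
    then have "(2 ^ j * h)\<^sup>2 \<le> \<bar>s\<bar>\<^sup>2" using assms by (intro power_mono) auto
    then have *: "4 ^ j * h\<^sup>2 \<le> s\<^sup>2" 
      using power_mult[of "2::real" 2 j] by (simp add: power_mult_distrib power_mult[symmetric] mult.commute)
    have "pk h s \<le> h / (4 ^ j * h\<^sup>2)"
      unfolding pk_def using * assms by (intro divide_left_mono) (auto simp: add_nonneg_pos intro: add_increasing2 mult_pos_pos)
    also have "\<dots> = 4 / (4 ^ k * h)" using assms Suc by (simp add: field_simps power2_eq_square)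
    finally show ?thesis using k by auto
  qed
qed

text \<open>By \<open>pk_le_dyadic\<close> the ball of radius 2^k h contributes at most 4/(4^k h)
  times 2 2^k h b, that is 8 b/2^k; the sum over k is 16 b.\<close>

lemma kconv_pk_le:
  fixes f :: "real \<Rightarrow> real"
  assumes f: "integrable lebesgue f" "\<And>u. 0 \<le> f u" and h: "0 < h"
    and b: "\<And>r. 0 < r \<Longrightarrow> (LINT u:cball x r|lebesgue. f u) \<le> 2 * r * b"
  shows "kconv (pk h) f x \<le> 16 * b"
proof -
  have [measurable]: "f \<in> borel_measurable lebesgue" using f(1) by auto
  have b0: "0 \<le> b"
  proof -
    have "0 \<le> (LINT u:cball x 1|lebesgue. f u)"
      using f(2) by (auto simp: set_lebesgue_integral_def)
    also have "\<dots> \<le> 2 * b" using b[of 1] by simp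
    finally show ?thesis by simp
  qed
  have ik: "integrable lebesgue (\<lambda>u. pk h (u - x) *\<^sub>R f u)"
    using kernel_bounds(1)[OF h] by (intro integrable_kernel[OF _ _ f(1)]) auto
  have "ennreal (kconv (pk h) f x) = (\<integral>\<^sup>+u. ennreal (pk h (u - x) * f u) \<partial>lebesgue)"
    unfolding kconv_def using ik f(2) kernel_bounds(4)[OF h]
    by (subst nn_integral_eq_integral) (auto intro!: mult_nonneg_nonneg simp: less_imp_le)
  also have "\<dots> \<le> (\<integral>\<^sup>+u. (\<Sum>k::nat. ennreal (4 / (4 ^ k * h)) * ennreal (indicator (cball x (2 ^ k * h)) u * f u)) \<partial>lebesgue)"
  proof (intro nn_integral_mono)
    fix u
    obtain k :: nat where k: "\<bar>u - x\<bar> \<le> 2 ^ k * h" "pk h (u - x) \<le> 4 / (4 ^ k * h)"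
      using pk_le_dyadic[OF h] by blast
    have u: "u \<in> cball x (2 ^ k * h)" using k(1) by (auto simp: dist_norm)
    have "ennreal (pk h (u - x) * f u) \<le> ennreal (4 / (4 ^ k * h)) * ennreal (f u)"
      using k(2) f(2)[of u] h by (subst ennreal_mult[symmetric]) (auto intro!: ennreal_leI mult_right_mono simp del: times_divide_eq_left)
    also have "\<dots> = ennreal (4 / (4 ^ k * h)) * ennreal (indicator (cball x (2 ^ k * h)) u * f u)"
      using u by simp
    also have "\<dots> \<le> (\<Sum>k. ennreal (4 / (4 ^ k * h)) * ennreal (indicator (cball x (2 ^ k * h)) u * f u))"
      using sum_le_suminf[of "\<lambda>k. ennreal (4 / (4 ^ k * h)) * ennreal (indicator (cball x (2 ^ k * h)) u * f u)" "{k}"]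
      by simp
    finally show "ennreal (pk h (u - x) * f u) \<le> \<dots>" .
  qed
  also have "\<dots> = (\<Sum>k::nat. \<integral>\<^sup>+u. ennreal (4 / (4 ^ k * h)) * ennreal (indicator (cball x (2 ^ k * h)) u * f u) \<partial>lebesgue)"
    by (intro nn_integral_suminf measurable_compose[OF _ measurable_ennreal] borel_measurable_times_ennreal
          borel_measurable_const borel_measurable_times borel_measurable_indicator) auto
  also have "\<dots> \<le> (\<Sum>k::nat. ennreal (8 * b * (1/2) ^ k))"
  proof (intro suminf_le)
    fix k :: nat
    have "set_integrable lebesgue (cball x (2 ^ k * h)) f"
      using f(1) integrable_mult_indicator[of "cball x (2 ^ k * h)" lebesgue f] by (simp add: set_integrable_def)
    then have "(\<integral>\<^sup>+u. ennreal (indicator (cball x (2 ^ k * h)) u * f u) \<partial>lebesgue)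
        = ennreal (LINT u:cball x (2 ^ k * h)|lebesgue. f u)"
      unfolding set_lebesgue_integral_def set_integrable_def
      by (subst nn_integral_eq_integral) (auto simp: f(2))
    then have "(\<integral>\<^sup>+u. ennreal (4 / (4 ^ k * h)) * ennreal (indicator (cball x (2 ^ k * h)) u * f u) \<partial>lebesgue)
       = ennreal (4 / (4 ^ k * h)) * ennreal (LINT u:cball x (2 ^ k * h)|lebesgue. f u)"
      by (subst nn_integral_cmult)
        (auto intro!: measurable_compose[OF _ measurable_ennreal] borel_measurable_times borel_measurable_indicator)
    also have "\<dots> \<le> ennreal (4 / (4 ^ k * h)) * ennreal (2 * (2 ^ k * h) * b)"
      using h by (intro mult_left_mono ennreal_leI b) auto
    also have "\<dots> = ennreal (4 / (4 ^ k * h) * (2 * (2 ^ k * h) * b))"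
      using h b0 by (intro ennreal_mult[symmetric]) auto
    also have "4 / (4 ^ k * h) * (2 * (2 ^ k * h) * b) = 8 * b * (1/2) ^ k"
    proof -
      have "(4::real) ^ k = 2 ^ k * 2 ^ k" by (simp flip: power_mult_distrib)
      then show ?thesis using h by (simp add: field_simps)
    qed
    finally show "(\<integral>\<^sup>+u. ennreal (4 / (4 ^ k * h)) * ennreal (indicator (cball x (2 ^ k * h)) u * f u) \<partial>lebesgue)
        \<le> ennreal (8 * b * (1/2) ^ k)" .
  qed auto
  also have "\<dots> = ennreal (16 * b)"
  proof -
    have "(\<lambda>k. 8 * b * (1/2) ^ k) sums (8 * b * (1 / (1 - 1/2)))"
      by (intro sums_mult geometric_sums) auto
    then show ?thesis using b0 by (intro suminf_ennreal_eq) auto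
  qed
  finally show ?thesis using b0 by (simp add: ennreal_le_iff)
qed

text \<open>By contraposition of \<open>kconv_pk_le\<close>, a large Poisson average forces a ball
  around x on which |f| has average above b/16. The covering lemma turns this into a weak (1,1)
  bound with constant 5 * 16 = 80.\<close>

lemma emeasure_Mset_le:
  assumes f: "integrable lebesgue f" and b: "0 < b"
  shows "emeasure lebesgue (Mset f b) \<le> ennreal (80 / b * (LINT u|lebesgue. norm (f u)))"
proof -
  let ?\<nu> = "density lebesgue (\<lambda>u. ennreal (80 / b * norm (f u)))"
  have [measurable]: "f \<in> borel_measurable lebesgue" using f by auto
  have \<nu>: "emeasure ?\<nu> A = ennreal (80 / b * (LINT u:A|lebesgue. norm (f u)))" if A: "A \<in> sets lebesgue" for A
  proof -
    have si: "set_integrable lebesgue A (\<lambda>u. norm (f u))"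
      using f A integrable_mult_indicator[of A lebesgue "\<lambda>u. norm (f u)"] by (simp add: set_integrable_def)
    have "emeasure ?\<nu> A = (\<integral>\<^sup>+u. ennreal (80 / b * (indicator A u *\<^sub>R norm (f u))) \<partial>lebesgue)"
      using A b by (subst emeasure_density) (auto intro!: nn_integral_cong split: split_indicator)
    also have "\<dots> = ennreal (LINT u|lebesgue. 80 / b * (indicator A u *\<^sub>R norm (f u)))"
      using si b by (intro nn_integral_eq_integral) (auto simp: set_integrable_def intro!: integrable_divide integrable_mult_right)
    finally show ?thesis by (simp add: set_lebesgue_integral_def)
  qed
  have "emeasure lebesgue (Mset f b) \<le> emeasure ?\<nu> UNIV"
  \<comment> \<open>If 2 r b/16 is below the integral of |f| over the ball, then r is at most 8/b
    times the whole integral.\<close>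
  proof (rule covering_bound[where B="8 / b * (LINT u|lebesgue. norm (f u))"])
    show "Mset f b \<in> sets lebesgue" using open_Mset[OF f] by simp
    fix x assume "x \<in> Mset f b"
    then obtain h where h: "0 < h" "kconv (pk h) (\<lambda>u. norm (f u)) x > b" by (auto simp: Mset_def)
    then obtain r where r: "0 < r" "(LINT u:cball x r|lebesgue. norm (f u)) > 2 * r * (b / 16)"
      using kconv_pk_le[of "\<lambda>u. norm (f u)" h x "b / 16"] f by force
    have "(LINT u:cball x r|lebesgue. norm (f u)) \<le> (LINT u|lebesgue. norm (f u))"
      unfolding set_lebesgue_integral_def using f
      by (intro integral_mono integrable_mult_indicator) (auto split: split_indicator)
    with r have "r * b \<le> 8 * (LINT u|lebesgue. norm (f u))" by (simp add: mult.commute)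
    then have rB: "r \<le> 8 / b * (LINT u|lebesgue. norm (f u))" using b by (simp add: pos_le_divide_eq)
    have "emeasure lebesgue (Mset f b \<inter> cball x (5 * r)) \<le> emeasure lebesgue (cball x (5 * r))"
      by (intro emeasure_mono) auto
    also have "\<dots> = ennreal (10 * r)" using r by (simp add: cball_eq_atLeastAtMost)
    also have "\<dots> \<le> emeasure ?\<nu> (cball x r)"
    proof -
      have "10 * r = 80 / b * (2 * r * (b / 16))" using b by simp
      also have "\<dots> \<le> 80 / b * (LINT u:cball x r|lebesgue. norm (f u))"
        using r b by (intro mult_left_mono) auto
      finally show ?thesis by (subst \<nu>) (auto intro!: ennreal_leI)
    qed
    finally show "\<exists>r>0. r \<le> 8 / b * (LINT u|lebesgue. norm (f u)) + \<bar>x\<bar> \<and> cball x r \<subseteq> UNIV \<and>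
       emeasure lebesgue (Mset f b \<inter> cball x (5 * r)) \<le> emeasure ?\<nu> (cball x r)"
      using r rB by (intro exI[of _ r]) auto
  qed auto
  also have "\<dots> = ennreal (80 / b * (LINT u|lebesgue. norm (f u)))"
    by (subst \<nu>) (auto simp: set_lebesgue_integral_def)
  finally show ?thesis .
qed

section \<open>Loomis' lemma\<close>

text \<open>The two leading coefficients in Vieta's formulas. In Loomis' lemma the second one turns
  an identity of polynomials into the sum of their roots.\<close>

lemma coeff_prod_linear:
  fixes f :: "'b \<Rightarrow> 'a::comm_ring_1"
  assumes "finite A"
  shows "degree (\<Prod>a\<in>A. [:- f a, 1:]) \<le> card A"
    "coeff (\<Prod>a\<in>A. [:- f a, 1:]) (card A) = 1"
    "A \<noteq> {} \<Longrightarrow> coeff (\<Prod>a\<in>A. [:- f a, 1:]) (card A - 1) = - (\<Sum>a\<in>A. f a)"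
proof -
  have "degree (\<Prod>a\<in>A. [:- f a, 1:]) \<le> card A \<and> coeff (\<Prod>a\<in>A. [:- f a, 1:]) (card A) = 1
    \<and> (A \<noteq> {} \<longrightarrow> coeff (\<Prod>a\<in>A. [:- f a, 1:]) (card A - 1) = - (\<Sum>a\<in>A. f a))"
    using assms
  proof (induction A)
    case (insert x A)
    let ?p = "\<Prod>a\<in>A. [:- f a, 1:]"
    have deg: "degree ([:- f x, 1:] * ?p) \<le> Suc (card A)"
      using insert degree_mult_le[of "[:- f x, 1:]" ?p] by (auto simp: le_Suc_eq split: if_splits intro: order_trans)
    have c: "coeff ([:- f x, 1:] * ?p) (Suc k) = - f x * coeff ?p (Suc k) + coeff ?p k" for k
      by (simp add: mult_pCons_left)
    have "coeff ([:- f x, 1:] * ?p) (card A) = - (f x + (\<Sum>a\<in>A. f a))"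
    proof (cases "A = {}")
      case False
      then obtain m where m: "card A = Suc m" using insert by (cases "card A") auto
      then show ?thesis using insert False by (simp add: c)
    qed (simp add: mult_pCons_left)
    then show ?case
      using insert deg c[of "card A"] by (simp add: coeff_eq_0)
  qed auto
  then show "degree (\<Prod>a\<in>A. [:- f a, 1:]) \<le> card A"
    "coeff (\<Prod>a\<in>A. [:- f a, 1:]) (card A) = 1"
    "A \<noteq> {} \<Longrightarrow> coeff (\<Prod>a\<in>A. [:- f a, 1:]) (card A - 1) = - (\<Sum>a\<in>A. f a)" by auto
qed

text \<open>Just left of the pole a the sum is large, just right of the preceding pole it is very
  negative, and far to the left of all poles it falls below l. The intermediate value theorem gives
  a root with no pole between it and a.\<close>

lemma loomis_root:
  fixes A :: "real set"
  assumes A: "finite A" and c: "\<And>a. a \<in> A \<Longrightarrow> 0 < c a" and l: "0 < l" and a: "a \<in> A"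
  shows "\<exists>r<a. (\<forall>b\<in>A. b < a \<longrightarrow> b < r) \<and> (\<Sum>b\<in>A. c b / (b - r)) = l"
proof (cases "{b\<in>A. b < a} = {}")
  case True
  \<comment> \<open>Multiplying by a - x removes the pole at a, so that the intermediate value
    theorem applies on a closed interval.\<close>
  define k where "k x = l * (a - x) - c a - (a - x) * (\<Sum>b\<in>A-{a}. c b / (b - x))" for x
  \<comment> \<open>At x0 every denominator is at least a - x0, and the weights add up to l (a -
    x0); so the sum is at most l there.\<close>
  define x0 where "x0 = a - (\<Sum>b\<in>A. c b) / l"
  have min: "a \<le> b" if "b \<in> A" for b using True that by (auto simp: not_less)
  have "0 < (\<Sum>b\<in>A. c b)" using A c a by (intro sum_pos) auto
  then have x0: "x0 < a" "(a - x0) * l = (\<Sum>b\<in>A. c b)" using l by (auto simp: x0_def)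
  have eq: "k x = (a - x) * (l - (\<Sum>b\<in>A. c b / (b - x)))" if "x < a" for x
    using that by (simp add: k_def sum.remove[OF A a] field_simps)
  have "(\<Sum>b\<in>A. c b / (b - x0)) \<le> (\<Sum>b\<in>A. c b / (a - x0))"
  proof (intro sum_mono divide_left_mono)
    fix b assume b: "b \<in> A"
    have "x0 < b" using x0(1) min[OF b] by linarith
    then show "a - x0 \<le> b - x0" "0 \<le> c b" "0 < (b - x0) * (a - x0)"
      using x0(1) min[OF b] c[OF b] by auto
  qed
  also have "\<dots> = l" using x0 by (simp add: sum_divide_distrib[symmetric] field_simps)
  finally have k0: "0 \<le> k x0" using x0 by (simp add: eq)
  have ka: "k a < 0" using c[OF a] by (simp add: k_def)
  have "continuous_on {x0..a} k"
    unfolding k_def using min by (intro continuous_intros) force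
  then obtain r where r: "x0 \<le> r" "r \<le> a" "k r = 0"
    using IVT2'[of k a 0 x0] k0 ka x0 by auto
  then have "r < a" using ka by (cases "r = a") auto
  then show ?thesis using r True eq[of r] by auto
next
  case False
  define p where "p = Max {b\<in>A. b < a}"
  have "p \<in> {b\<in>A. b < a}" unfolding p_def using A False by (intro Max_in) auto
  then have p: "p \<in> A" "p < a" by auto
  have le: "b \<le> p" if "b \<in> A" "b < a" for b
    unfolding p_def using A that by (intro Max_ge) auto
  \<comment> \<open>The poles at both ends are cleared; the surviving sum has its poles outside the
    closed interval from p to a.\<close>
  define k where "k x = l * (x - p) * (a - x) - c a * (x - p) + c p * (a - x) - (x - p) * (a - x) * (\<Sum>b\<in>A-{a}-{p}. c b / (b - x))" for x
  have eq: "k x = (x - p) * (a - x) * (l - (\<Sum>b\<in>A. c b / (b - x)))" if "p < x" "x < a" for x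
  proof -
    have s: "(\<Sum>b\<in>A. c b / (b - x)) = c a / (a - x) + (c p / (p - x) + (\<Sum>b\<in>A-{a}-{p}. c b / (b - x)))"
      using A a p sum.remove[of A a "\<lambda>b. c b / (b - x)"] sum.remove[of "A - {a}" p "\<lambda>b. c b / (b - x)"] by auto
    have "(x - p) * (c p / (p - x)) = - c p" using that by (simp add: field_simps)
    moreover have "(a - x) * (c a / (a - x)) = c a" using that by simp
    ultimately show ?thesis unfolding s k_def by algebra
  qed
  have kp: "0 < k p" using c[OF p(1)] p by (simp add: k_def)
  have ka: "k a < 0" using c[OF a] p by (simp add: k_def)
  have "continuous_on {p..a} k"
    unfolding k_def using le by (intro continuous_intros) force
  then obtain r where r: "p \<le> r" "r \<le> a" "k r = 0"
    using IVT2'[of k a 0 p] kp ka p by auto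
  then have "p < r" "r < a" using ka kp by (auto simp: less_le)
  then show ?thesis using r le eq[of r] by force
qed

text \<open>Apart from the poles, the set lies in the intervals from each root r a to its pole a.
  Their total length is the sum of the poles minus the sum of the roots, which Vieta's formulas
  evaluate as the total weight over l.\<close>

lemma loomis_pos:
  fixes A :: "real set"
  assumes A: "finite A" and c: "\<And>a. a \<in> A \<Longrightarrow> 0 < c a" and l: "0 < l"
  shows "emeasure lebesgue {x. (\<Sum>a\<in>A. c a / (a - x)) > l} \<le> ennreal ((\<Sum>a\<in>A. c a) / l)"
proof (cases "A = {}")
  case True
  then show ?thesis using l by simp
next
  case False
  let ?g = "\<lambda>x. \<Sum>a\<in>A. c a / (a - x)"
  obtain r where r: "\<And>a. a \<in> A \<Longrightarrow> r a < a" "\<And>a b. a \<in> A \<Longrightarrow> b \<in> A \<Longrightarrow> b < a \<Longrightarrow> b < r a" "\<And>a. a \<in> A \<Longrightarrow> ?g (r a) = l"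
    using bchoice[of A "\<lambda>a r. r < a \<and> (\<forall>b\<in>A. b < a \<longrightarrow> b < r) \<and> ?g r = l"] loomis_root[OF A c l] by fast
  have inj: "inj_on r A"
  proof (rule inj_onI)
    fix a b assume "a \<in> A" "b \<in> A" "r a = r b"
    then show "a = b" using r(1)[of a] r(1)[of b] r(2)[of a b] r(2)[of b a] by (cases a b rule: linorder_cases) auto
  qed
  have notin: "r a \<noteq> b" if "a \<in> A" "b \<in> A" for a b
    using that r(1)[of a] r(2)[of a b] by (cases "b < a") auto
  define n where "n = card A"
  let ?P = "\<lambda>B. \<Prod>a\<in>B. [:- a, 1:]"
  \<comment> \<open>Q is 1 - g/l with denominators cleared, g being the sum in question. It is monic
    of degree n and vanishes at every r a.\<close>
  define Q where "Q = ?P A + (\<Sum>a\<in>A. smult (c a / l) (?P (A - {a})))"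
  define S where "S = (\<Prod>a\<in>A. [:- r a, 1:])"
  have dn: "degree (?P (A - {a})) \<le> n - 1" if "a \<in> A" for a
    using coeff_prod_linear(1)[of "A - {a}" "\<lambda>a. a"] A that by (simp add: n_def)
  have n0: "0 < n" using A False by (simp add: n_def card_gt_0_iff)
  have cn1: "coeff (?P (A - {a})) (n - 1) = 1" if "a \<in> A" for a
    using coeff_prod_linear(2)[of "A - {a}" "\<lambda>a. a"] A that by (simp add: n_def)
  have dQ: "degree (Q - S) \<le> n"
    unfolding Q_def S_def n_def
    using A dn coeff_prod_linear(1)[of A "\<lambda>a. a"] coeff_prod_linear(1)[of A r]
    by (intro degree_diff_le degree_add_le degree_sum_le degree_smult_le[THEN order_trans])
      (auto simp: n_def intro: order_trans[OF dn[unfolded n_def]])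
  have "coeff (\<Sum>a\<in>A. smult (c a / l) (?P (A - {a}))) n = 0"
    unfolding coeff_sum using le_less_trans[OF dn, of _ n] n0 by (intro sum.neutral) (auto intro!: coeff_eq_0)
  then have cQ: "coeff (Q - S) n = 0"
    unfolding Q_def S_def using coeff_prod_linear(2)[of A "\<lambda>a. a"] coeff_prod_linear(2)[of A r] A by (simp add: n_def)
  have root: "poly (Q - S) (r a) = 0" if a: "a \<in> A" for a
  proof -
    let ?x = "r a"
    have ne: "?x - b \<noteq> 0" if "b \<in> A" for b using notin[OF a that] by simp
    have "poly Q ?x = (\<Prod>b\<in>A. ?x - b) + (\<Sum>b\<in>A. c b / l * (\<Prod>j\<in>A-{b}. ?x - j))"
      by (simp add: Q_def poly_sum poly_prod)
    also have "(\<Sum>b\<in>A. c b / l * (\<Prod>j\<in>A-{b}. ?x - j)) = (\<Sum>b\<in>A. - (\<Prod>j\<in>A. ?x - j) / l * (c b / (b - ?x)))"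
    proof (intro sum.cong refl)
      fix b assume b: "b \<in> A"
      have "(\<Prod>j\<in>A. ?x - j) = (?x - b) * (\<Prod>j\<in>A-{b}. ?x - j)" by (rule prod.remove[OF A b])
      moreover have "(?x - b) * (c b / (b - ?x)) = - c b" using ne[OF b] by (simp add: field_simps)
      ultimately show "c b / l * (\<Prod>j\<in>A-{b}. ?x - j) = - (\<Prod>j\<in>A. ?x - j) / l * (c b / (b - ?x))"
        using l by (simp add: divide_inverse) algebra
    qed
    also have "\<dots> = - (\<Prod>j\<in>A. ?x - j) / l * ?g ?x"
      by (simp only: sum_distrib_left)
    also have "\<dots> = - (\<Prod>j\<in>A. ?x - j)"
      using r(3)[OF a] l by simp
    finally have "poly Q ?x = 0" by simp
    moreover have "poly S ?x = 0" using A a by (auto simp: S_def poly_prod)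
    ultimately show ?thesis by simp
  qed
  \<comment> \<open>Both polynomials are monic of degree n, so a nonzero difference would have
    degree below n and yet vanish at n distinct points.\<close>
  have "Q - S = 0"
  proof (rule ccontr)
    assume nz: "Q - S \<noteq> 0"
    then have "degree (Q - S) \<noteq> n" using cQ by (metis leading_coeff_0_iff)
    then have "degree (Q - S) < n" using dQ by simp
    moreover have "card (r ` A) \<le> card {x. poly (Q - S) x = 0}"
      using root poly_roots_finite[OF nz] by (intro card_mono) auto
    moreover have "card (r ` A) = n" using inj by (simp add: card_image n_def)
    moreover have "card {x. poly (Q - S) x = 0} \<le> degree (Q - S)" using nz by (rule card_poly_roots_bound)
    ultimately show False by simp
  qed
  then have "coeff Q (n - 1) = coeff S (n - 1)" by simp
  moreover have "coeff Q (n - 1) = - (\<Sum>a\<in>A. a) + (\<Sum>a\<in>A. c a / l)"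
    using coeff_prod_linear(3)[OF A False, of "\<lambda>a. a"] cn1 by (simp add: Q_def coeff_sum n_def)
  moreover have "coeff S (n - 1) = - (\<Sum>a\<in>A. r a)"
    using coeff_prod_linear(3)[OF A False, of r] by (simp add: S_def n_def)
  ultimately have sum: "(\<Sum>a\<in>A. a - r a) = (\<Sum>a\<in>A. c a) / l"
    by (simp add: sum_subtractf sum_divide_distrib)
  have sub: "{x. ?g x > l} \<subseteq> A \<union> (\<Union>a\<in>A. {r a<..<a})"
  proof (rule subsetI, rule ccontr)
    fix x assume gx: "x \<in> {x. ?g x > l}" and x: "x \<notin> A \<union> (\<Union>a\<in>A. {r a<..<a})"
    show False
    proof (cases "{b\<in>A. x < b} = {}")
      case True
      then have "?g x \<le> 0" using x c by (intro sum_nonpos divide_nonneg_nonpos) (auto simp: less_imp_le not_less)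
      then show False using gx l by simp
    next
      case ne: False
      \<comment> \<open>The next pole to the right of x. There is no pole between x and r a, and
        each term increases there, so the value at x is at most l.\<close>
      define a where "a = Min {b\<in>A. x < b}"
      have "a \<in> {b\<in>A. x < b}" unfolding a_def using A ne by (intro Min_in) auto
      then have a: "a \<in> A" "x < a" by auto
      have ge: "a \<le> b" if "b \<in> A" "x < b" for b
        unfolding a_def using A that by (intro Min_le) auto
      have "x \<le> r a" using x a by force
      have "?g x \<le> ?g (r a)"
      proof (intro sum_mono)
        fix b assume b: "b \<in> A"
        show "c b / (b - x) \<le> c b / (b - r a)"
        proof (cases "x < b")
          case True
          then have "r a < b" using ge[OF b True] r(1)[OF a(1)] by simp
          then show ?thesis using \<open>x \<le> r a\<close> c[OF b] by (intro divide_left_mono mult_pos_pos) auto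
        next
          case False
          then have "b < x" using x b by (cases "b = x") auto
          then show ?thesis using \<open>x \<le> r a\<close> c[OF b] by (intro divide_left_mono mult_neg_neg) auto
        qed
      qed
      then show False using gx r(3)[OF a(1)] by simp
    qed
  qed
  have Am: "A \<in> sets lebesgue" using finite_imp_closed[OF A] by auto
  have "emeasure lebesgue {x. ?g x > l} \<le> emeasure lebesgue (A \<union> (\<Union>a\<in>A. {r a<..<a}))"
    using sub Am A by (intro emeasure_mono sets.Un sets.finite_UN) auto
  also have "\<dots> \<le> emeasure lebesgue A + emeasure lebesgue (\<Union>a\<in>A. {r a<..<a})"
    using Am A by (intro emeasure_subadditive) auto
  also have "emeasure lebesgue A = 0"
    using A negligible_finite[of A] by (simp add: negligible_iff_emeasure0 Am)
  also have "emeasure lebesgue (\<Union>a\<in>A. {r a<..<a}) \<le> (\<Sum>a\<in>A. emeasure lebesgue {r a<..<a})"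
    using A by (intro emeasure_subadditive_finite) auto
  also have "\<dots> = (\<Sum>a\<in>A. ennreal (a - r a))"
    using r(1) by (intro sum.cong refl) (simp add: less_imp_le)
  also have "\<dots> = ennreal ((\<Sum>a\<in>A. c a) / l)"
    using r(1) by (subst sum_ennreal) (auto simp: less_imp_le sum)
  finally show ?thesis by simp
qed

text \<open>Cells of a discretisation may carry no mass, so zero weights have to be allowed; they
  are discarded before \<open>loomis_pos\<close> is applied.\<close>

lemma loomis:
  fixes a :: "'i \<Rightarrow> real"
  assumes I: "finite I" "inj_on a I" and c: "\<And>i. i \<in> I \<Longrightarrow> 0 \<le> c i" and l: "0 < l"
  shows "emeasure lebesgue {x. (\<Sum>i\<in>I. c i / (a i - x)) > l} \<le> ennreal ((\<Sum>i\<in>I. c i) / l)"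
proof -
  define J where "J = {i\<in>I. c i \<noteq> 0}"
  have J: "finite J" "inj_on a J" using I by (auto simp: J_def inj_on_def)
  let ?c = "\<lambda>x. c (inv_into J a x)"
  have *: "(\<Sum>i\<in>I. c i / (a i - x)) = (\<Sum>b\<in>a ` J. ?c b / (b - x))" for x
  proof -
    have "(\<Sum>i\<in>I. c i / (a i - x)) = (\<Sum>i\<in>J. c i / (a i - x))"
      using I by (intro sum.mono_neutral_right) (auto simp: J_def)
    also have "\<dots> = (\<Sum>b\<in>a ` J. ?c b / (b - x))"
      using J by (simp add: sum.reindex)
    finally show ?thesis .
  qed
  have "emeasure lebesgue {x. (\<Sum>b\<in>a ` J. ?c b / (b - x)) > l} \<le> ennreal ((\<Sum>b\<in>a ` J. ?c b) / l)"
    using J l c by (intro loomis_pos) (auto simp: J_def less_le)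
  also have "(\<Sum>b\<in>a ` J. ?c b) = (\<Sum>i\<in>J. c i)" using J by (simp add: sum.reindex)
  also have "\<dots> = (\<Sum>i\<in>I. c i)"
    using I by (intro sum.mono_neutral_left) (auto simp: J_def)
  finally show ?thesis by (simp only: *)
qed

lemma loomis_abs:
  fixes a :: "'i \<Rightarrow> real"
  assumes I: "finite I" "inj_on a I" and c: "\<And>i. i \<in> I \<Longrightarrow> 0 \<le> c i" and l: "0 < l"
  shows "emeasure lebesgue {x. \<bar>\<Sum>i\<in>I. c i / (a i - x)\<bar> > l} \<le> ennreal (2 * (\<Sum>i\<in>I. c i) / l)"
proof -
  let ?U = "{x. (\<Sum>i\<in>I. c i / (a i - x)) > l}"
  \<comment> \<open>The set where the sum is below -l is the mirror image of \<open>?V\<close>,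
    which belongs to the reflected poles; reflection preserves measure.\<close>
  let ?V = "{x. (\<Sum>i\<in>I. c i / (- a i - x)) > l}"
  have [simp]: "?U \<in> sets lebesgue" "?V \<in> sets lebesgue"
  proof -
    have "?U \<in> sets borel" "?V \<in> sets borel" by measurable
    then show "?U \<in> sets lebesgue" "?V \<in> sets lebesgue" by auto
  qed
  have V: "emeasure lebesgue ?V \<le> ennreal ((\<Sum>i\<in>I. c i) / l)"
    by (rule loomis) (use I c l in \<open>auto simp: inj_on_def\<close>)
  have U: "emeasure lebesgue ?U \<le> ennreal ((\<Sum>i\<in>I. c i) / l)"
    by (rule loomis) (use I c l in auto)
  have im: "emeasure lebesgue ((\<lambda>x. -1 *\<^sub>R x + 0) ` ?V) = emeasure lebesgue ?V"
    by (subst emeasure_lebesgue_affine) auto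
  have ims: "(\<lambda>x. -1 *\<^sub>R x + 0) ` ?V \<in> sets lebesgue"
  proof -
    have "(\<lambda>x. -1 *\<^sub>R x + 0) ` ?V = {x. (\<Sum>i\<in>I. c i / (- a i - (- x))) > l}"
    proof (intro set_eqI iffI)
      fix x assume "x \<in> {x. (\<Sum>i\<in>I. c i / (- a i - (- x))) > l}"
      then show "x \<in> (\<lambda>x. -1 *\<^sub>R x + 0) ` ?V" by (intro image_eqI[of _ _ "- x"]) auto
    qed (auto simp: minus_diff_commute)
    also have "\<dots> \<in> sets borel" by measurable
    finally show ?thesis by auto
  qed
  have flip: "c i / (x - a i) = - (c i / (a i - x))" for i x
    by (metis minus_diff_eq divide_minus_right)
  have "{x. \<bar>\<Sum>i\<in>I. c i / (a i - x)\<bar> > l} \<subseteq> ?U \<union> (\<lambda>x. -1 *\<^sub>R x + 0) ` ?V"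
  proof
    fix x assume x: "x \<in> {x. \<bar>\<Sum>i\<in>I. c i / (a i - x)\<bar> > l}"
    have "(\<Sum>i\<in>I. c i / (- a i - (- x))) = - (\<Sum>i\<in>I. c i / (a i - x))"
      by (simp add: flip sum_negf)
    with x show "x \<in> ?U \<union> (\<lambda>x. -1 *\<^sub>R x + 0) ` ?V"
      by (auto simp: abs_if image_iff split: if_splits intro!: exI[of _ "- x"])
  qed
  then have "emeasure lebesgue {x. \<bar>\<Sum>i\<in>I. c i / (a i - x)\<bar> > l} \<le> emeasure lebesgue (?U \<union> (\<lambda>x. -1 *\<^sub>R x + 0) ` ?V)"
    using ims by (intro emeasure_mono) auto
  also have "\<dots> \<le> emeasure lebesgue ?U + emeasure lebesgue ((\<lambda>x. -1 *\<^sub>R x + 0) ` ?V)"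
    using ims by (intro emeasure_subadditive) auto
  also have "\<dots> \<le> ennreal ((\<Sum>i\<in>I. c i) / l) + ennreal ((\<Sum>i\<in>I. c i) / l)"
    using V U unfolding im by (intro add_mono)
  also have "\<dots> = ennreal (2 * (\<Sum>i\<in>I. c i) / l)"
    using c l by (subst ennreal_plus[symmetric]) (auto intro!: divide_nonneg_pos sum_nonneg)
  finally show ?thesis .
qed

section \<open>The weak type bound at a fixed height\<close>

text \<open>Moving mass by at most h replaces the conjugate Poisson kernel by the bare kernel 1/s'
  at the cost of Poisson kernels, if s' stays away from 0. The 9 stems from |s| + h \<le> |s'| + 2 h
  \<le> 9 |s'|.\<close>

lemma qk_discrete:
  assumes h: "0 < h" and d: "\<bar>s - s'\<bar> \<le> h" "h / 4 \<le> \<bar>s'\<bar>"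
  shows "\<bar>qk h s - 1 / s'\<bar> \<le> 9 * pk h s"
proof -
  have p: "0 < s\<^sup>2 + h\<^sup>2" using h by (simp add: add_nonneg_pos)
  have s': "s' \<noteq> 0" using d h by auto
  have "qk h s - 1 / s' = (s * s' - s\<^sup>2 - h\<^sup>2) / ((s\<^sup>2 + h\<^sup>2) * s')"
    using p s' h by (simp add: qk_def diff_frac_eq diff_diff_eq)
  then have "\<bar>qk h s - 1 / s'\<bar> = \<bar>s * s' - s\<^sup>2 - h\<^sup>2\<bar> / ((s\<^sup>2 + h\<^sup>2) * \<bar>s'\<bar>)"
    using p by (simp add: abs_mult)
  also have "\<dots> \<le> 9 * h * \<bar>s'\<bar> / ((s\<^sup>2 + h\<^sup>2) * \<bar>s'\<bar>)"
  proof (intro divide_right_mono)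
    have "s * s' - s\<^sup>2 - h\<^sup>2 = s * (s' - s) - h\<^sup>2"
      by (simp add: algebra_simps power2_eq_square)
    then have "\<bar>s * s' - s\<^sup>2 - h\<^sup>2\<bar> \<le> \<bar>s * (s' - s)\<bar> + h\<^sup>2"
      using abs_triangle_ineq4[of "s * (s' - s)" "h\<^sup>2"] by simp
    also have "\<dots> \<le> \<bar>s\<bar> * h + h\<^sup>2" using d by (auto simp: abs_mult intro!: mult_left_mono)
    also have "\<dots> = h * (\<bar>s\<bar> + h)" by (simp add: algebra_simps power2_eq_square)
    also have "\<dots> \<le> h * (9 * \<bar>s'\<bar>)" using d h by (intro mult_left_mono) auto
    finally show "\<bar>s * s' - s\<^sup>2 - h\<^sup>2\<bar> \<le> 9 * h * \<bar>s'\<bar>" by simp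
  qed (use p in auto)
  also have "\<dots> = 9 * pk h s" using s' by (simp add: pk_def)
  finally show ?thesis .
qed

text \<open>Points of two grids of step h, offset by h/2, are at least h/2 apart, so x cannot be
  closer than h/4 to both grids. This provides the separation that \<open>qk_discrete\<close> asks
  for.\<close>

lemma grid_far:
  fixes x h :: real
  assumes h: "0 < h"
  shows "(\<forall>i::int. h / 4 \<le> \<bar>(of_int i) * h - x\<bar>) \<or> (\<forall>i::int. h / 4 \<le> \<bar>(of_int i + 1/2) * h - x\<bar>)"
proof (rule ccontr)
  assume "\<not> ?thesis"
  then obtain i j :: int where "\<bar>(of_int i) * h - x\<bar> < h / 4" "\<bar>(of_int j + 1/2) * h - x\<bar> < h / 4"
    by (auto simp: not_le)
  then have "\<bar>((of_int j + 1/2) * h - x) - (of_int i * h - x)\<bar> < h / 2" by linarith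
  also have "((of_int j + 1/2) * h - x) - (of_int i * h - x) = (of_int (j - i) + 1/2) * h"
    by (simp add: algebra_simps)
  finally have "\<bar>of_int (j - i) + 1/2\<bar> * h < 1/2 * h" using h by (simp add: abs_mult)
  then have "\<bar>of_int (j - i) + 1/2 :: real\<bar> < 1/2" using h by (simp only: mult_less_cancel_right)
  then have "of_int (j - i) < (0::real) \<and> (-1::real) < of_int (j - i)"
    unfolding abs_less_iff by linarith
  then have "j - i < 0 \<and> -1 < j - i" by linarith
  then show False by linarith
qed

text \<open>The mass of each cell of length h is put at one point of the cell, which gives a sum for
  Loomis' lemma. Where Poisson averages are at most l/18, the error is at most 9 l/18 = l/2. The
  constant is 18 * 80 for the maximal function plus 4 for each of the two grids.\<close>

lemma emeasure_qk_pos_le: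
  fixes f :: "real \<Rightarrow> real"
  assumes f: "integrable lebesgue f" "\<And>u. 0 \<le> f u" and supp: "\<And>u. u \<notin> {-1<..<1} \<Longrightarrow> f u = 0"
    and h: "0 < h" and l: "0 < l"
  shows "emeasure lebesgue {x. \<bar>kconv (qk h) f x\<bar> > l} \<le> ennreal (1448 / l * (LINT u|lebesgue. f u))"
proof -
  let ?F = "LINT u|lebesgue. f u"
  have F0: "0 \<le> ?F" using f(2) by simp
  \<comment> \<open>N h \<ge> 1 makes the 2 N cells cover (-1,1), outside which f vanishes.\<close>
  obtain N :: nat where "1 / h \<le> real N" using real_arch_simple by blast
  then have N: "1 \<le> real N * h" using h by (simp add: field_simps)
  define I where "I = {- int N..<int N}"
  have I: "finite I" by (simp add: I_def)
  define cell where "cell i = {real_of_int i * h..<(real_of_int i + 1) * h}" for i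
  define c where "c i = (LINT u:cell i|lebesgue. f u)" for i
  have si: "set_integrable lebesgue (cell i) f" for i
    using f(1) integrable_mult_indicator[of "cell i" lebesgue f] by (simp add: set_integrable_def cell_def)
  have c0: "0 \<le> c i" for i unfolding c_def set_lebesgue_integral_def using f(2) by (intro integral_nonneg_AE) auto
  have cell: "u \<in> cell i \<longleftrightarrow> i = \<lfloor>u / h\<rfloor>" for u i
    using h by (simp add: cell_def floor_eq_iff eq_commute[of i] pos_le_divide_eq pos_divide_less_eq)
  have inI: "\<lfloor>u / h\<rfloor> \<in> I" if "f u \<noteq> 0" for u
  proof -
    have u: "-1 < u" "u < 1" using supp[of u] that by auto
    then have "u / h < real N" "- real N \<le> u / h" using N h
      by (simp_all add: pos_divide_less_eq pos_le_divide_eq) 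
    then show ?thesis by (auto simp: I_def floor_less_iff le_floor_iff)
  qed
  have disj: "disjoint_family_on cell I"
    by (auto simp: disjoint_family_on_def cell)
  have sumI: "(\<Sum>i\<in>I. indicator (cell i) u * g i) = g \<lfloor>u / h\<rfloor>" if "f u \<noteq> 0" for u and g :: "int \<Rightarrow> real"
    using inI[OF that] I by (subst sum.remove[where x="\<lfloor>u / h\<rfloor>"]) (auto simp: cell indicator_def intro!: sum.neutral)
  have sum_c: "(\<Sum>i\<in>I. c i) = ?F"
  proof -
    have "(\<Sum>i\<in>I. c i) = (LINT u|lebesgue. (\<Sum>i\<in>I. indicator (cell i) u *\<^sub>R f u))"
      unfolding c_def set_lebesgue_integral_def using si
      by (intro Bochner_Integration.integral_sum[symmetric]) (auto simp: set_integrable_def)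
    also have "\<dots> = ?F"
    proof (intro Bochner_Integration.integral_cong refl)
      fix u show "(\<Sum>i\<in>I. indicator (cell i) u *\<^sub>R f u) = f u"
        using sumI[of u "\<lambda>_. f u"] by (cases "f u = 0") auto
    qed
    finally show ?thesis .
  qed
  define g where "g \<theta> x = (\<Sum>i\<in>I. c i / ((real_of_int i + \<theta>) * h - x))" for \<theta> x
  have key: "\<bar>kconv (qk h) f x - g \<theta> x\<bar> \<le> 9 * kconv (pk h) f x"
    if \<theta>: "0 \<le> \<theta>" "\<theta> \<le> 1" and far: "\<And>i::int. h / 4 \<le> \<bar>(of_int i + \<theta>) * h - x\<bar>" for \<theta> x
  proof -
    \<comment> \<open>The discretised sum is itself a convolution, taken at the point 0 with a step
      kernel in which x is a parameter; so \<open>kconv_diff_le\<close> applies.\<close>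
    define k where "k u = (\<Sum>i\<in>I. indicator (cell i) u * (1 / ((real_of_int i + \<theta>) * h - x)))" for u
    have km: "k \<in> borel_measurable borel" unfolding k_def[abs_def] cell_def by measurable
    have kb: "\<bar>k u\<bar> \<le> (\<Sum>i\<in>I. \<bar>1 / ((real_of_int i + \<theta>) * h - x)\<bar>)" for u
      unfolding k_def by (rule order_trans[OF sum_abs]) (auto intro!: sum_mono simp: indicator_def)
    have "kconv k f 0 = g \<theta> x"
    proof -
      have "kconv k f 0 = (LINT u|lebesgue. (\<Sum>i\<in>I. (indicator (cell i) u *\<^sub>R f u) * (1 / ((real_of_int i + \<theta>) * h - x))))"
        unfolding kconv_def by (intro Bochner_Integration.integral_cong refl)
          (auto simp: k_def sum_distrib_right intro!: sum.cong)
      also have "\<dots> = (\<Sum>i\<in>I. (LINT u|lebesgue. (indicator (cell i) u *\<^sub>R f u) * (1 / ((real_of_int i + \<theta>) * h - x))))"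
        using si by (intro Bochner_Integration.integral_sum integrable_mult_left) (auto simp: set_integrable_def)
      also have "\<dots> = g \<theta> x"
        using si by (auto simp: g_def c_def set_lebesgue_integral_def set_integrable_def intro!: sum.cong)
      finally show ?thesis .
    qed
    moreover have "norm (kconv (qk h) f x - kconv k f 0) \<le> 9 * kconv (pk h) (\<lambda>u. norm (f u)) x"
    proof (rule kconv_diff_le[OF kernel_measurable(2) kernel_bounds(2)[OF h] km kb kernel_measurable(1) kernel_bounds(1)[OF h] f(1)])
      fix u assume u: "f u \<noteq> 0"
      let ?i = "\<lfloor>u / h\<rfloor>"
      have ku: "k (u - 0) = 1 / ((real_of_int ?i + \<theta>) * h - x)"
        using sumI[OF u, of "\<lambda>i. 1 / ((real_of_int i + \<theta>) * h - x)"] by (simp add: k_def)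
      have "u \<in> cell ?i" by (simp add: cell)
      then have b: "real_of_int ?i * h \<le> u" "u < real_of_int ?i * h + h"
        by (auto simp: cell_def distrib_right)
      have "0 \<le> \<theta> * h" "\<theta> * h \<le> h" using \<theta> h by (auto simp: mult_left_le_one_le)
      then have "\<bar>u - ((real_of_int ?i + \<theta>) * h)\<bar> \<le> h" using b unfolding distrib_right by linarith
      then have "\<bar>(u - x) - ((real_of_int ?i + \<theta>) * h - x)\<bar> \<le> h" by simp
      from qk_discrete[OF h this far] show "\<bar>qk h (u - x) - k (u - 0)\<bar> \<le> 9 * pk h (u - x)"
        by (simp only: ku)
    qed
    ultimately show ?thesis using f(2) by simp
  qed
  define fc where "fc = (\<lambda>u. complex_of_real (f u))"
  have fc: "integrable lebesgue fc" "\<And>u. norm (fc u) = f u" using f by (auto simp: fc_def)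
  define GS where "GS \<theta> = {x. \<bar>g \<theta> x\<bar> > l / 2}" for \<theta>
  have Gm[simp]: "GS \<theta> \<in> sets lebesgue" for \<theta>
  proof -
    have "GS \<theta> \<in> sets borel" unfolding GS_def g_def by measurable
    then show ?thesis by auto
  qed
  have G: "emeasure lebesgue (GS \<theta>) \<le> ennreal (4 * ?F / l)" for \<theta>
  proof -
    have "inj_on (\<lambda>i. (real_of_int i + \<theta>) * h) I" using h by (auto simp: inj_on_def)
    from loomis_abs[OF I this, of c "l/2"] c0 l show ?thesis by (simp add: GS_def g_def sum_c)
  qed
  have "{x. \<bar>kconv (qk h) f x\<bar> > l} \<subseteq> Mset fc (l / 18) \<union> (GS 0 \<union> GS (1/2))"
  proof
    fix x assume x: "x \<in> {x. \<bar>kconv (qk h) f x\<bar> > l}"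
    obtain \<theta> where t: "\<theta> \<in> {0, 1/2}" "\<And>i::int. h / 4 \<le> \<bar>(of_int i + \<theta>) * h - x\<bar>"
      using grid_far[OF h, of x] that[of 0] that[of "1/2"] by auto
    have k: "\<bar>kconv (qk h) f x - g \<theta> x\<bar> \<le> 9 * kconv (pk h) f x"
      by (rule key) (use t in auto)
    show "x \<in> Mset fc (l / 18) \<union> (GS 0 \<union> GS (1/2))"
    proof (cases "\<bar>g \<theta> x\<bar> > l / 2")
      case False
      then have "kconv (pk h) f x > l / 18" using k x by (auto simp: abs_if split: if_splits)
      then have "x \<in> Mset fc (l / 18)" using h by (auto simp: Mset_def fc(2))
      then show ?thesis by simp
    next
      case True
      then have "x \<in> GS \<theta>" by (simp add: GS_def)
      then show ?thesis using t(1) by blast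
    qed
  qed
  then have "emeasure lebesgue {x. \<bar>kconv (qk h) f x\<bar> > l} \<le> emeasure lebesgue (Mset fc (l / 18) \<union> (GS 0 \<union> GS (1/2)))"
    by (intro emeasure_mono sets.Un Gm sets_Mset_Hset fc)
  also have "\<dots> \<le> emeasure lebesgue (Mset fc (l / 18)) + emeasure lebesgue (GS 0 \<union> GS (1/2))"
    by (intro emeasure_subadditive sets.Un Gm sets_Mset_Hset fc)
  also have "\<dots> \<le> emeasure lebesgue (Mset fc (l / 18)) + (emeasure lebesgue (GS 0) + emeasure lebesgue (GS (1/2)))"
    by (intro add_left_mono emeasure_subadditive Gm)
  also have "\<dots> \<le> ennreal (80 / (l / 18) * ?F) + (ennreal (4 * ?F / l) + ennreal (4 * ?F / l))"
    using emeasure_Mset_le[OF fc(1), of "l / 18"] l by (intro add_mono G) (auto simp: fc(2))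
  also have "\<dots> = ennreal (1448 / l * ?F)"
    using F0 l by (simp flip: ennreal_plus)
  finally show ?thesis .
qed

text \<open>Positive and negative parts of the real and imaginary parts, each at level l/4, give 4 *
  4 * 1448 = 23168.\<close>

lemma emeasure_qk_le:
  fixes f :: "real \<Rightarrow> complex"
  assumes f: "integrable lebesgue f" and supp: "\<And>u. u \<notin> {-1<..<1} \<Longrightarrow> f u = 0"
    and h: "0 < h" and l: "0 < l"
  shows "emeasure lebesgue {x. norm (kconv (qk h) f x) > l} \<le> ennreal (23168 / l * (LINT u|lebesgue. norm (f u)))"
proof -
  let ?F = "LINT u|lebesgue. norm (f u)"
  have F0: "0 \<le> ?F" by simp
  define p where "p j = (\<lambda>u. max 0 (if j = 0 then Re (f u) else if j = 1 then - Re (f u)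
      else if j = (2::nat) then Im (f u) else - Im (f u)))" for j
  have ip: "integrable lebesgue (p j)" for j
    using f by (cases "j = 0"; cases "j = 1"; cases "j = 2") (auto simp: p_def intro!: integrable_max)
  have p: "0 \<le> p j u" "p j u \<le> norm (f u)" "u \<notin> {-1<..<1} \<Longrightarrow> p j u = 0" for j u
    using abs_Re_le_cmod[of "f u"] abs_Im_le_cmod[of "f u"] supp[of u] by (auto simp: p_def)
  have dec: "f u = complex_of_real (p 0 u) - of_real (p 1 u) + \<i> * (of_real (p 2 u) - of_real (p 3 u))" for u
    by (auto simp: p_def complex_eq_iff max_def)
  have ik: "integrable lebesgue (\<lambda>u. qk h (u - x) *\<^sub>R p j u)" for j x
    by (rule integrable_kernel[OF kernel_measurable(2) kernel_bounds(2)[OF h] ip])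
  have kc: "kconv (qk h) f x = of_real (kconv (qk h) (p 0) x) - of_real (kconv (qk h) (p 1) x)
      + \<i> * (of_real (kconv (qk h) (p 2) x) - of_real (kconv (qk h) (p 3) x))" for x
  proof -
    define w where "w j u = complex_of_real (qk h (u - x) *\<^sub>R p j u)" for j u
    have i2: "integrable lebesgue (w j)" for j
      unfolding w_def using ik by (rule integrable_of_real)
    have e: "(LINT u|lebesgue. w j u) = of_real (kconv (qk h) (p j) x)" for j
      unfolding w_def kconv_def by (rule integral_complex_of_real)
    have "kconv (qk h) f x = (LINT u|lebesgue. w 0 u - w 1 u + \<i> * (w 2 u - w 3 u))"
      unfolding kconv_def w_def
      by (intro Bochner_Integration.integral_cong refl) (subst dec, simp add: scaleR_conv_of_real algebra_simps)
    also have "\<dots> = of_real (kconv (qk h) (p 0) x) - of_real (kconv (qk h) (p 1) x)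
      + \<i> * (of_real (kconv (qk h) (p 2) x) - of_real (kconv (qk h) (p 3) x))"
      using i2 by (simp add: e)
    finally show ?thesis .
  qed
  let ?S = "\<lambda>j. {x. \<bar>kconv (qk h) (p j) x\<bar> > l / 4}"
  have Sm: "?S j \<in> sets lebesgue" for j
  proof -
    have "open (?S j)"
      using h ip[of j] by (intro open_Collect_less continuous_on_const continuous_on_rabs continuous_at_imp_continuous_on)
        (auto intro: isCont_kconv_kernels)
    then show ?thesis by auto
  qed
  have "{x. norm (kconv (qk h) f x) > l} \<subseteq> (\<Union>j\<in>{..<4}. ?S j)"
  proof
    fix x assume "x \<in> {x. norm (kconv (qk h) f x) > l}"
    moreover have "norm (kconv (qk h) f x) \<le> \<bar>kconv (qk h) (p 0) x\<bar> + \<bar>kconv (qk h) (p 1) x\<bar>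
      + (\<bar>kconv (qk h) (p 2) x\<bar> + \<bar>kconv (qk h) (p 3) x\<bar>)"
      unfolding kc by (intro norm_triangle_mono norm_triangle_le_diff)
        (auto simp: norm_mult intro: norm_triangle_le_diff)
    ultimately have "\<exists>j\<in>{0,1,2,3::nat}. \<bar>kconv (qk h) (p j) x\<bar> > l / 4" by auto
    then show "x \<in> (\<Union>j\<in>{..<4}. ?S j)" by force
  qed
  then have "emeasure lebesgue {x. norm (kconv (qk h) f x) > l} \<le> emeasure lebesgue (\<Union>j\<in>{..<4}. ?S j)"
    using Sm by (intro emeasure_mono) auto
  also have "\<dots> \<le> (\<Sum>j\<in>{..<4}. emeasure lebesgue (?S j))"
    using Sm by (intro emeasure_subadditive_finite) auto
  also have "\<dots> \<le> (\<Sum>j\<in>{..<4::nat}. ennreal (1448 / (l / 4) * ?F))"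
  proof (intro sum_mono)
    fix j :: nat
    have "emeasure lebesgue (?S j) \<le> ennreal (1448 / (l / 4) * (LINT u|lebesgue. p j u))"
      using p l by (intro emeasure_qk_pos_le ip h) auto
    also have "\<dots> \<le> ennreal (1448 / (l / 4) * ?F)"
      using p ip f l by (intro ennreal_leI mult_left_mono integral_mono) auto
    finally show "emeasure lebesgue (?S j) \<le> ennreal (1448 / (l / 4) * ?F)" .
  qed
  also have "\<dots> = ennreal (23168 / l * ?F)"
    using l F0 by (subst sum_ennreal) auto
  finally show ?thesis .
qed

section \<open>The maximal Hilbert transform\<close>

lemma kconv_add:
  fixes f g :: "real \<Rightarrow> 'a::{banach,second_countable_topology}"
  assumes "k \<in> borel_measurable borel" "\<And>s. \<bar>k s\<bar> \<le> C" "integrable lebesgue f" "integrable lebesgue g"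
  shows "kconv k (\<lambda>u. f u + g u) x = kconv k f x + kconv k g x"
  using integrable_kernel[OF assms(1,2,3)] integrable_kernel[OF assms(1,2,4)]
  by (simp add: kconv_def scaleR_add_right)

lemma kconv_diff:
  fixes f g :: "real \<Rightarrow> 'a::{banach,second_countable_topology}"
  assumes "k \<in> borel_measurable borel" "\<And>s. \<bar>k s\<bar> \<le> C" "integrable lebesgue f" "integrable lebesgue g"
  shows "kconv k (\<lambda>u. f u - g u) x = kconv k f x - kconv k g x"
  using integrable_kernel[OF assms(1,2,3)] integrable_kernel[OF assms(1,2,4)]
  by (simp add: kconv_def scaleR_diff_right)

lemma integrable_cutoff:
  fixes f :: "real \<Rightarrow> complex"
  assumes "integrable lebesgue f" "A \<in> sets lebesgue"
  shows "integrable lebesgue (\<lambda>u. indicator A u *\<^sub>R f u)"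
  using integrable_mult_indicator[OF assms(2,1)] .

lemma kconv_mono:
  fixes f g :: "real \<Rightarrow> real"
  assumes "integrable lebesgue f" "integrable lebesgue g" "\<And>u. f u \<le> g u" "0 < h"
  shows "kconv (pk h) f x \<le> kconv (pk h) g x"
  unfolding kconv_def
  using integrable_kernel[OF kernel_measurable(1) kernel_bounds(1)[OF assms(4)] assms(1)]
    integrable_kernel[OF kernel_measurable(1) kernel_bounds(1)[OF assms(4)] assms(2)]
    kernel_bounds(4)[OF assms(4)] assms(3)
  by (intro integral_mono) (auto intro!: mult_left_mono less_imp_le)

text \<open>On the ball of radius R the Poisson kernel at height d is at least d/(R^2 + d^2), so a
  Poisson average bounds the mass near x.\<close>

lemma near_le:
  fixes f :: "real \<Rightarrow> complex"
  assumes f: "integrable lebesgue f" and d: "0 < d"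
  shows "(LINT u|lebesgue. norm (indicator (cball x R) u *\<^sub>R f u)) \<le> (R\<^sup>2 + d\<^sup>2) / d * kconv (pk d) (\<lambda>u. norm (f u)) x"
proof -
  have ik: "integrable lebesgue (\<lambda>u. pk d (u - x) *\<^sub>R norm (f u))"
    using f by (intro integrable_kernel[OF kernel_measurable(1) kernel_bounds(1)[OF d]]) auto
  have "(LINT u|lebesgue. norm (indicator (cball x R) u *\<^sub>R f u))
     \<le> (LINT u|lebesgue. (R\<^sup>2 + d\<^sup>2) / d * (pk d (u - x) *\<^sub>R norm (f u)))"
  proof (intro integral_mono)
    show "integrable lebesgue (\<lambda>u. norm (indicator (cball x R) u *\<^sub>R f u))"
      using integrable_cutoff[OF f] by (intro integrable_norm) auto
    show "integrable lebesgue (\<lambda>u. (R\<^sup>2 + d\<^sup>2) / d * (pk d (u - x) *\<^sub>R norm (f u)))"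
      using ik by simp
    fix u
    show "norm (indicator (cball x R) u *\<^sub>R f u) \<le> (R\<^sup>2 + d\<^sup>2) / d * (pk d (u - x) *\<^sub>R norm (f u))"
    proof (cases "u \<in> cball x R")
      case True
      then have "\<bar>u - x\<bar> \<le> R" by (auto simp: dist_norm)
      then have "\<bar>u - x\<bar>\<^sup>2 \<le> R\<^sup>2" by (intro power_mono) auto
      then have le: "(u - x)\<^sup>2 + d\<^sup>2 \<le> R\<^sup>2 + d\<^sup>2" by simp
      have pos: "0 < (u - x)\<^sup>2 + d\<^sup>2" using d by (simp add: add_nonneg_pos)
      have "1 \<le> (R\<^sup>2 + d\<^sup>2) / ((u - x)\<^sup>2 + d\<^sup>2)" using le pos by simp
      also have "\<dots> = (R\<^sup>2 + d\<^sup>2) / d * pk d (u - x)" using d by (simp add: pk_def)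
      finally have "1 * norm (f u) \<le> (R\<^sup>2 + d\<^sup>2) / d * pk d (u - x) * norm (f u)"
        by (intro mult_right_mono) auto
      then show ?thesis using True by (simp add: mult.assoc)
    next
      case False
      then show ?thesis using d kernel_bounds(4)[OF d, of "u - x"] by (simp add: less_imp_le)
    qed
  qed
  then show ?thesis by (simp add: kconv_def)
qed

text \<open>A shift by at most the height is harmless: a regularity estimate for the conjugate
  kernel, and a Harnack inequality for the Poisson kernel.\<close>

lemma qk_shift_le:
  assumes h: "0 < h" and d: "\<bar>s - s'\<bar> \<le> h"
  shows "\<bar>qk h s' - qk h s\<bar> \<le> 2 * pk h s" "pk h s' \<le> 3 * pk h s"
proof -
  have p: "0 < s\<^sup>2 + h\<^sup>2" "0 < s'\<^sup>2 + h\<^sup>2" using h by (auto simp: add_nonneg_pos)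
  have amgm: "2 * (\<bar>s'\<bar> * h) \<le> s'\<^sup>2 + h\<^sup>2"
    using sum_squares_bound[of "\<bar>s'\<bar>" h] by simp
  have s: "\<bar>s\<bar> \<le> \<bar>s'\<bar> + h" using d by linarith
  have "qk h s' - qk h s = (s' - s) * (h\<^sup>2 - s * s') / ((s'\<^sup>2 + h\<^sup>2) * (s\<^sup>2 + h\<^sup>2))"
  proof -
    have ne: "s\<^sup>2 + h\<^sup>2 \<noteq> 0" "s'\<^sup>2 + h\<^sup>2 \<noteq> 0" using p by linarith+
    have "s' * (s\<^sup>2 + h\<^sup>2) - s * (s'\<^sup>2 + h\<^sup>2) = (s' - s) * (h\<^sup>2 - s * s')"
      by (simp add: power2_eq_square algebra_simps)
    then show ?thesis unfolding qk_def diff_frac_eq[OF ne(2) ne(1)] by (simp only:)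
  qed
  then have "\<bar>qk h s' - qk h s\<bar> = \<bar>s' - s\<bar> * \<bar>h\<^sup>2 - s * s'\<bar> / ((s'\<^sup>2 + h\<^sup>2) * (s\<^sup>2 + h\<^sup>2))"
    using p by (simp add: abs_mult)
  also have "\<dots> \<le> h * (2 * (s'\<^sup>2 + h\<^sup>2)) / ((s'\<^sup>2 + h\<^sup>2) * (s\<^sup>2 + h\<^sup>2))"
  proof (intro divide_right_mono mult_mono)
    have "\<bar>h\<^sup>2 - s * s'\<bar> \<le> h\<^sup>2 + \<bar>s\<bar> * \<bar>s'\<bar>"
      using abs_triangle_ineq4[of "h\<^sup>2" "s * s'"] by (simp add: abs_mult)
    also have "\<dots> \<le> h\<^sup>2 + (\<bar>s'\<bar> + h) * \<bar>s'\<bar>" using s by (intro add_left_mono mult_right_mono) auto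
    also have "\<dots> = h\<^sup>2 + s'\<^sup>2 + \<bar>s'\<bar> * h" by (simp add: algebra_simps power2_eq_square)
    also have "\<dots> \<le> 2 * (s'\<^sup>2 + h\<^sup>2)" using amgm p(2) by (simp add: algebra_simps)
    finally show "\<bar>h\<^sup>2 - s * s'\<bar> \<le> 2 * (s'\<^sup>2 + h\<^sup>2)" .
  qed (use p d h in \<open>auto simp: abs_minus_commute\<close>)
  also have "\<dots> = 2 * pk h s"
    unfolding pk_def using mult_divide_mult_cancel_left[of "s'\<^sup>2 + h\<^sup>2" "2 * h" "s\<^sup>2 + h\<^sup>2"] p(2)
    by (simp only: mult_ac times_divide_eq_right)
  finally show "\<bar>qk h s' - qk h s\<bar> \<le> 2 * pk h s" .
  have "s\<^sup>2 = \<bar>s\<bar>\<^sup>2" by simp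
  also have "\<dots> \<le> (\<bar>s'\<bar> + h)\<^sup>2" using s by (intro power_mono) auto
  also have "\<dots> \<le> 2 * s'\<^sup>2 + 2 * h\<^sup>2" using amgm by (simp add: power2_sum)
  finally have "s\<^sup>2 + h\<^sup>2 \<le> 3 * (s'\<^sup>2 + h\<^sup>2)"
    using zero_le_power2[of s'] zero_le_power2[of h] by argo
  then have "h / (3 * (s'\<^sup>2 + h\<^sup>2)) \<le> h / (s\<^sup>2 + h\<^sup>2)"
    using p h by (intro divide_left_mono) auto
  then have "3 * (h / (3 * (s'\<^sup>2 + h\<^sup>2))) \<le> 3 * (h / (s\<^sup>2 + h\<^sup>2))" by (rule mult_left_mono) simp
  moreover have "3 * (h / (3 * X)) = h / X" for X :: real by simp
  ultimately show "pk h s' \<le> 3 * pk h s" by (simp only: pk_def)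
qed

text \<open>Lowering the height matters only near the singularity: once |s| is at least h, the
  Poisson kernel at the larger height absorbs the change.\<close>

lemma qk_scale_le:
  assumes "0 < e" "e \<le> h" "h \<le> \<bar>s\<bar>"
  shows "\<bar>qk e s - qk h s\<bar> \<le> pk h s"
proof -
  have p: "0 < s\<^sup>2 + h\<^sup>2" "0 < s\<^sup>2 + e\<^sup>2" using assms by (auto simp: add_nonneg_pos)
  have eh: "e\<^sup>2 \<le> h\<^sup>2" using assms by (intro power_mono) auto
  have "qk e s - qk h s = s * (h\<^sup>2 - e\<^sup>2) / ((s\<^sup>2 + e\<^sup>2) * (s\<^sup>2 + h\<^sup>2))"
  proof -
    have ne: "s\<^sup>2 + e\<^sup>2 \<noteq> 0" "s\<^sup>2 + h\<^sup>2 \<noteq> 0" using p by linarith+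
    have "s * (s\<^sup>2 + h\<^sup>2) - s * (s\<^sup>2 + e\<^sup>2) = s * (h\<^sup>2 - e\<^sup>2)"
      by (simp add: algebra_simps)
    then show ?thesis unfolding qk_def diff_frac_eq[OF ne] by (simp only:)
  qed
  then have "\<bar>qk e s - qk h s\<bar> = \<bar>s\<bar> * (h\<^sup>2 - e\<^sup>2) / ((s\<^sup>2 + e\<^sup>2) * (s\<^sup>2 + h\<^sup>2))"
    using p eh by (simp add: abs_mult)
  also have "\<dots> \<le> h * (s\<^sup>2 + e\<^sup>2) / ((s\<^sup>2 + e\<^sup>2) * (s\<^sup>2 + h\<^sup>2))"
  proof (intro divide_right_mono)
    have "\<bar>s\<bar> * (h\<^sup>2 - e\<^sup>2) \<le> \<bar>s\<bar> * h\<^sup>2" by (intro mult_left_mono) auto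
    also have "\<dots> = h * (h * \<bar>s\<bar>)" by (simp add: power2_eq_square)
    also have "\<dots> \<le> h * (\<bar>s\<bar> * \<bar>s\<bar>)" using assms by (intro mult_left_mono mult_right_mono) auto
    also have "\<dots> \<le> h * (s\<^sup>2 + e\<^sup>2)" using assms by (intro mult_left_mono) (auto simp: power2_eq_square)
    finally show "\<bar>s\<bar> * (h\<^sup>2 - e\<^sup>2) \<le> h * (s\<^sup>2 + e\<^sup>2)" .
  qed (use p in auto)
  also have "\<dots> = pk h s"
    using mult_divide_mult_cancel_left[of "s\<^sup>2 + e\<^sup>2" h "s\<^sup>2 + h\<^sup>2"] p(2) unfolding pk_def
    by (metis less_irrefl mult.commute)
  finally show ?thesis .
qed

text \<open>Here v = u - x with u far from x; height h at a point y near x is compared with height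
  h' at a point p of distance d. Since h' = sqrt (h^2 + d^2) is at least d, an error of order d/(v^2
  + h'^2) is a multiple of \<open>pk h' v\<close> even when h is much smaller than d.\<close>

lemma qk_far_le:
  assumes h: "0 < h" and d: "0 < d" and v: "10 * d \<le> \<bar>v\<bar>" and s: "\<bar>v - s\<bar> \<le> 5/2 * d" and s': "\<bar>v - s'\<bar> \<le> d"
    and h': "0 < h'" "h'\<^sup>2 = h\<^sup>2 + d\<^sup>2"
  shows "\<bar>qk h s - qk h' s'\<bar> \<le> 24 * pk h' v"
proof -
  have p: "0 < s\<^sup>2 + h\<^sup>2" "0 < s'\<^sup>2 + h'\<^sup>2" "0 < v\<^sup>2 + h\<^sup>2" "0 < v\<^sup>2 + h'\<^sup>2" using h h'(1) by (auto simp: add_nonneg_pos)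
  have dh: "d \<le> h'"
    by (rule power2_le_imp_le) (use h' in auto)
  have a1: "\<bar>s\<bar> \<le> 5/4 * \<bar>v\<bar>" "3/4 * \<bar>v\<bar> \<le> \<bar>s\<bar>" "\<bar>s'\<bar> \<le> 11/10 * \<bar>v\<bar>" "9/10 * \<bar>v\<bar> \<le> \<bar>s'\<bar>" "\<bar>s' - s\<bar> \<le> 7/2 * d"
    using v s s' by linarith+
  have sq: "9/16 * v\<^sup>2 \<le> s\<^sup>2" "81/100 * v\<^sup>2 \<le> s'\<^sup>2"
  proof -
    have "(3/4 * \<bar>v\<bar>)\<^sup>2 \<le> \<bar>s\<bar>\<^sup>2" "(9/10 * \<bar>v\<bar>)\<^sup>2 \<le> \<bar>s'\<bar>\<^sup>2"
      using a1 by (intro power_mono; simp)+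
    then show "9/16 * v\<^sup>2 \<le> s\<^sup>2" "81/100 * v\<^sup>2 \<le> s'\<^sup>2"
      by (simp_all add: power_mult_distrib power_divide)
  qed
  \<comment> \<open>With h'^2 = h^2 + d^2 the numerator has the factor s' - s, of order d, up to the
    term s d^2; because |v| \<ge> 10 d, that term is at most of order d v^2.\<close>
  have num: "\<bar>s * (s'\<^sup>2 + h'\<^sup>2) - s' * (s\<^sup>2 + h\<^sup>2)\<bar> \<le> 6 * d * (v\<^sup>2 + h\<^sup>2)"
  proof -
    have "s * (s'\<^sup>2 + h'\<^sup>2) - s' * (s\<^sup>2 + h\<^sup>2) = (s' - s) * (s * s' - h\<^sup>2) + s * d\<^sup>2"
      unfolding h' by (simp add: algebra_simps power2_eq_square)
    also have "\<bar>\<dots>\<bar> \<le> \<bar>s' - s\<bar> * (\<bar>s\<bar> * \<bar>s'\<bar> + h\<^sup>2) + \<bar>s\<bar> * d\<^sup>2"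
    proof -
      have "\<bar>s * s' - h\<^sup>2\<bar> \<le> \<bar>s\<bar> * \<bar>s'\<bar> + h\<^sup>2"
        using abs_triangle_ineq4[of "s * s'" "h\<^sup>2"] by (simp add: abs_mult)
      then have "\<bar>(s' - s) * (s * s' - h\<^sup>2)\<bar> \<le> \<bar>s' - s\<bar> * (\<bar>s\<bar> * \<bar>s'\<bar> + h\<^sup>2)"
        unfolding abs_mult by (intro mult_left_mono) auto
      moreover have "\<bar>s * d\<^sup>2\<bar> = \<bar>s\<bar> * d\<^sup>2" by (simp add: abs_mult)
      ultimately show ?thesis
        using abs_triangle_ineq[of "(s' - s) * (s * s' - h\<^sup>2)" "s * d\<^sup>2"] by linarith
    qed
    also have "\<dots> \<le> 7/2 * d * (5/4 * \<bar>v\<bar> * (11/10 * \<bar>v\<bar>) + h\<^sup>2) + 5/4 * \<bar>v\<bar> * d\<^sup>2"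
      using a1 d by (intro add_mono mult_mono) auto
    also have "5/4 * \<bar>v\<bar> * d\<^sup>2 \<le> 1/8 * v\<^sup>2 * d"
    proof -
      have "5/4 * \<bar>v\<bar> * d\<^sup>2 = 1/8 * \<bar>v\<bar> * (10 * d) * d" by (simp add: power2_eq_square)
      also have "\<dots> \<le> 1/8 * \<bar>v\<bar> * \<bar>v\<bar> * d" using v d by (intro mult_right_mono mult_left_mono) auto
      finally show ?thesis by (simp add: power2_eq_square)
    qed
    also have "7/2 * d * (5/4 * \<bar>v\<bar> * (11/10 * \<bar>v\<bar>) + h\<^sup>2) + 1/8 * v\<^sup>2 * d = d * (v\<^sup>2 * (7/2 * (11/8) + 1/8) + 7/2 * h\<^sup>2)"
      by (simp add: algebra_simps power2_eq_square)
    also have "\<dots> \<le> d * (v\<^sup>2 * 6 + 6 * h\<^sup>2)" using d by (intro mult_left_mono add_mono mult_right_mono) auto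
    finally show ?thesis by (simp add: algebra_simps)
  qed
  have "\<bar>qk h s - qk h' s'\<bar> = \<bar>s * (s'\<^sup>2 + h'\<^sup>2) - s' * (s\<^sup>2 + h\<^sup>2)\<bar> / ((s\<^sup>2 + h\<^sup>2) * (s'\<^sup>2 + h'\<^sup>2))"
  proof -
    have ne: "s\<^sup>2 + h\<^sup>2 \<noteq> 0" "s'\<^sup>2 + h'\<^sup>2 \<noteq> 0" using p by linarith+
    show ?thesis unfolding qk_def diff_frac_eq[OF ne] using p by (simp add: abs_mult)
  qed
  also have "\<dots> \<le> 6 * d * (v\<^sup>2 + h\<^sup>2) / ((s\<^sup>2 + h\<^sup>2) * (s'\<^sup>2 + h'\<^sup>2))"
    using num p by (intro divide_right_mono) auto
  also have "\<dots> \<le> 6 * d * (v\<^sup>2 + h\<^sup>2) / (((v\<^sup>2 + h\<^sup>2) / 2) * ((v\<^sup>2 + h'\<^sup>2) / 2))"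
  proof (intro divide_left_mono mult_mono mult_pos_pos)
    show "(v\<^sup>2 + h\<^sup>2) / 2 \<le> s\<^sup>2 + h\<^sup>2"
      using sq(1) zero_le_power2[of v] zero_le_power2[of h] by argo
    show "(v\<^sup>2 + h'\<^sup>2) / 2 \<le> s'\<^sup>2 + h'\<^sup>2"
      using sq(2) zero_le_power2[of v] zero_le_power2[of h'] by argo
  qed (use p d in auto)
  also have "\<dots> = 24 * (d / (v\<^sup>2 + h'\<^sup>2))"
  proof -
    have "6 * d * X / ((X / 2) * (Y / 2)) = 24 * (d / Y)" if "0 < X" for X Y :: real
      using that by simp
    from this[OF p(3)] show ?thesis .
  qed
  also have "\<dots> \<le> 24 * pk h' v"
    unfolding pk_def using dh p by (intro mult_left_mono divide_right_mono) auto
  finally show ?thesis .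
qed

section \<open>From a fixed height to all heights, and the good-lambda inequality\<close>

lemma norm_combination_le:
  fixes a b c d e :: "'a::real_normed_vector"
  shows "norm (a - b - c + d - e) \<le> norm a + norm b + norm c + norm d + norm e"
proof -
  have "norm (a - b - c + d - e) \<le> norm (a - b - c + d) + norm e" by (rule norm_triangle_ineq4)
  moreover have "norm (a - b - c + d) \<le> norm (a - b - c) + norm d" by (rule norm_triangle_ineq)
  moreover have "norm (a - b - c) \<le> norm (a - b) + norm c" by (rule norm_triangle_ineq4)
  moreover have "norm (a - b) \<le> norm a + norm b" by (rule norm_triangle_ineq4)
  ultimately show ?thesis by linarith
qed

lemma open_norm_kconv:
  fixes f :: "real \<Rightarrow> complex"
  assumes "integrable lebesgue f" "0 < h"
  shows "open {x. norm (kconv (qk h) f x) > l}"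
  by (intro open_Collect_less continuous_on_norm continuous_at_imp_continuous_on ballI isCont_kconv_kernels(2)
      continuous_on_const assms)

lemma emeasure_density_cmult_indicator:
  assumes "W \<in> sets M" "S \<in> sets M"
  shows "emeasure (density M (\<lambda>u. c * indicator W u)) S = c * emeasure M (W \<inter> S)"
proof -
  have "emeasure (density M (\<lambda>u. c * indicator W u)) S = (\<integral>\<^sup>+u. c * indicator W u * indicator S u \<partial>M)"
    using assms by (intro emeasure_density borel_measurable_times_ennreal borel_measurable_indicator) auto
  also have "\<dots> = (\<integral>\<^sup>+u. c * indicator (W \<inter> S) u \<partial>M)"
    by (intro nn_integral_cong) (simp add: indicator_inter_arith mult.assoc)
  finally show ?thesis using assms by (simp add: nn_integral_cmult_indicator)
qed

text \<open>If at a height h \<ge> \<delta> the value at x exceeds l while Poisson averages are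
  small, then at height \<delta> it exceeds l/2 on at least half of the ball of radius h. The
  covering lemma thus compares all heights from \<delta> on with the single height \<delta>, with a
  bound independent of \<delta>.\<close>

lemma emeasure_Hset_le:
  fixes f :: "real \<Rightarrow> complex"
  assumes f: "integrable lebesgue f" and supp: "\<And>u. u \<notin> {-1<..<1} \<Longrightarrow> f u = 0" and l: "0 < l"
  shows "emeasure lebesgue (Hset f l) \<le> ennreal (10 ^ 8 / l * (LINT u|lebesgue. norm (f u)))"
proof -
  let ?F = "LINT u|lebesgue. norm (f u)"
  let ?M = "Mset f (l / 10 ^ 6)"
  have F0: "0 \<le> ?F" by simp
  define G where "G \<delta> = {x. \<exists>h\<ge>\<delta>. norm (kconv (qk h) f x) > l} - ?M" for \<delta>
  have Gm: "G \<delta> \<in> sets lebesgue" if "0 < \<delta>" for \<delta>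
  proof -
    have "{x. \<exists>h\<ge>\<delta>. norm (kconv (qk h) f x) > l} = (\<Union>h\<in>{\<delta>..}. {x. norm (kconv (qk h) f x) > l})" by auto
    also have "open \<dots>" using that f by (intro open_UN ballI open_norm_kconv) auto
    finally show ?thesis unfolding G_def by (intro sets.Diff sets_Mset_Hset f) auto
  qed
  have Gle: "emeasure lebesgue (G \<delta>) \<le> ennreal (463360 / l * ?F)" if \<delta>: "0 < \<delta>" for \<delta>
  proof -
    let ?W = "{x. norm (kconv (qk \<delta>) f x) > l / 2}"
    let ?\<nu> = "density lebesgue (\<lambda>u. 10 * indicator ?W u)"
    have Wm: "?W \<in> sets lebesgue" using open_norm_kconv[OF f \<delta>, of "l / 2"] by simp
    have \<nu>: "emeasure ?\<nu> S = 10 * emeasure lebesgue (?W \<inter> S)" if "S \<in> sets lebesgue" for S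
      by (rule emeasure_density_cmult_indicator[OF Wm that])
    have "emeasure lebesgue (G \<delta>) \<le> emeasure ?\<nu> UNIV"
    proof (rule covering_bound[where B="?F / l"])
      fix x assume x: "x \<in> G \<delta>"
      then obtain h where h: "\<delta> \<le> h" and gt: "norm (kconv (qk h) f x) > l" by (auto simp: G_def)
      have h0: "0 < h" using h \<delta> by simp
      have P: "kconv (pk h) (\<lambda>u. norm (f u)) x \<le> l / 10 ^ 6"
        using x h0 by (force simp: G_def Mset_def not_less)
      \<comment> \<open>Near and far part. The near part has mass at most 5 h l/10^6, so by the
        fixed-height bound its transform exceeds l/4 on a set of measure at most 23168 * 4 * 5/10^6
        times h, which is below h.\<close>
      let ?f1 = "\<lambda>u. indicator (cball x (2 * h)) u *\<^sub>R f u"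
      let ?f2 = "\<lambda>u. f u - ?f1 u"
      have f1: "integrable lebesgue ?f1" by (rule integrable_cutoff[OF f]) auto
      have f2: "integrable lebesgue ?f2" using f f1 by simp
      have F1: "(LINT u|lebesgue. norm (?f1 u)) \<le> 5 * h * (l / 10 ^ 6)"
      proof -
        have "(LINT u|lebesgue. norm (?f1 u)) \<le> ((2 * h)\<^sup>2 + h\<^sup>2) / h * kconv (pk h) (\<lambda>u. norm (f u)) x"
          by (rule near_le[OF f h0])
        also have "((2 * h)\<^sup>2 + h\<^sup>2) / h = 5 * h" using h0 by (simp add: power2_eq_square field_simps)
        also have "5 * h * kconv (pk h) (\<lambda>u. norm (f u)) x \<le> 5 * h * (l / 10 ^ 6)"
          using P h0 by (intro mult_left_mono) auto
        finally show ?thesis .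
      qed
      define B where "B = {y. norm (kconv (qk \<delta>) ?f1 y) > l / 4}"
      have Bm: "B \<in> sets lebesgue" unfolding B_def using open_norm_kconv[OF f1 \<delta>, of "l / 4"] by simp
      have Ble: "emeasure lebesgue B \<le> ennreal h"
      proof -
        have "emeasure lebesgue B \<le> ennreal (23168 / (l / 4) * (LINT u|lebesgue. norm (?f1 u)))"
          unfolding B_def using supp l by (intro emeasure_qk_le f1 \<delta>) auto
        also have "\<dots> \<le> ennreal (23168 / (l / 4) * (5 * h * (l / 10 ^ 6)))"
          using F1 l by (intro ennreal_leI mult_left_mono) auto
        also have "\<dots> \<le> ennreal h" using l h0 by (intro ennreal_leI) simp
        finally show ?thesis .
      qed
      \<comment> \<open>Off B the value is carried from x to y at height h, then for the far part
        from height h down to \<delta>. The losses are (2 + 3 + 5) l/10^6 and l/4, together less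
        than l/2.\<close>
      have sub: "cball x h \<subseteq> (?W \<inter> cball x h) \<union> B"
      proof
        fix y assume y: "y \<in> cball x h"
        then have xy: "\<bar>x - y\<bar> \<le> h" by (simp add: dist_norm)
        show "y \<in> (?W \<inter> cball x h) \<union> B"
        proof (cases "y \<in> B")
          case False
          then have b1: "norm (kconv (qk \<delta>) ?f1 y) \<le> l / 4" by (simp add: B_def)
          have b2: "norm (kconv (qk h) f y - kconv (qk h) f x) \<le> 2 * kconv (pk h) (\<lambda>u. norm (f u)) x"
            using xy by (intro kconv_diff_le[OF kernel_measurable(2) kernel_bounds(2)[OF h0] kernel_measurable(2) kernel_bounds(2)[OF h0]
               kernel_measurable(1) kernel_bounds(1)[OF h0] f] qk_shift_le h0) auto
          have b3: "norm (kconv (qk \<delta>) ?f2 y - kconv (qk h) ?f2 y) \<le> 3 * kconv (pk h) (\<lambda>u. norm (?f2 u)) x"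
          proof (rule kconv_diff_le[OF kernel_measurable(2) kernel_bounds(2)[OF \<delta>] kernel_measurable(2) kernel_bounds(2)[OF h0]
               kernel_measurable(1) kernel_bounds(1)[OF h0] f2])
            fix u assume "?f2 u \<noteq> 0"
            then have "u \<notin> cball x (2 * h)" by (auto simp: indicator_def split: if_splits)
            then have "2 * h < \<bar>u - x\<bar>" by (auto simp: dist_norm)
            then have "h \<le> \<bar>u - y\<bar>" using xy by linarith
            then have "\<bar>qk \<delta> (u - y) - qk h (u - y)\<bar> \<le> pk h (u - y)" by (rule qk_scale_le[OF \<delta> h])
            also have "\<dots> \<le> 3 * pk h (u - x)" using xy by (intro qk_shift_le(2)[OF h0]) auto
            finally show "\<bar>qk \<delta> (u - y) - qk h (u - y)\<bar> \<le> 3 * pk h (u - x)" .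
          qed
          have b4: "kconv (pk h) (\<lambda>u. norm (?f2 u)) x \<le> kconv (pk h) (\<lambda>u. norm (f u)) x"
            using f f2 by (intro kconv_mono h0) (auto split: split_indicator)
          have b5: "norm (kconv (qk h) ?f1 y) \<le> 5 * (l / 10 ^ 6)"
          proof -
            have "norm (kconv (qk h) ?f1 y) \<le> 1 / h * (LINT u|lebesgue. norm (?f1 u))"
              by (rule norm_kconv_le[OF kernel_measurable(2) kernel_bounds(2)[OF h0] f1])
            also have "\<dots> \<le> 1 / h * (5 * h * (l / 10 ^ 6))" using F1 h0 by (intro mult_left_mono) auto
            finally show ?thesis using h0 by simp
          qed
          have e1: "kconv (qk \<delta>) f y = kconv (qk \<delta>) ?f2 y + kconv (qk \<delta>) ?f1 y"
            using kconv_add[OF kernel_measurable(2) kernel_bounds(2)[OF \<delta>] f2 f1, of y] by simp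
          have e2: "kconv (qk h) f y = kconv (qk h) ?f2 y + kconv (qk h) ?f1 y"
            using kconv_add[OF kernel_measurable(2) kernel_bounds(2)[OF h0] f2 f1, of y] by simp
          have "kconv (qk h) f x = kconv (qk \<delta>) f y - kconv (qk \<delta>) ?f1 y - (kconv (qk \<delta>) ?f2 y - kconv (qk h) ?f2 y)
              + kconv (qk h) ?f1 y - (kconv (qk h) f y - kconv (qk h) f x)"
            unfolding e1 e2 by simp
          then have "norm (kconv (qk h) f x) \<le> norm (kconv (qk \<delta>) f y) + norm (kconv (qk \<delta>) ?f1 y)
              + norm (kconv (qk \<delta>) ?f2 y - kconv (qk h) ?f2 y) + norm (kconv (qk h) ?f1 y) + norm (kconv (qk h) f y - kconv (qk h) f x)"
            by (rule ord_eq_le_trans[OF arg_cong[where f=norm] norm_combination_le])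
          then have "l / 2 < norm (kconv (qk \<delta>) f y)"
            using b1 b2 b3 b4 b5 P gt l by simp
          then show ?thesis using y by simp
        qed simp
      qed
      have "ennreal (2 * h) = emeasure lebesgue (cball x h)" using h0 by (simp add: cball_eq_atLeastAtMost)
      also have "\<dots> \<le> emeasure lebesgue ((?W \<inter> cball x h) \<union> B)"
        using sub Wm Bm by (intro emeasure_mono sets.Un sets.Int) auto
      also have "\<dots> \<le> emeasure lebesgue (?W \<inter> cball x h) + emeasure lebesgue B"
        using Wm Bm by (intro emeasure_subadditive sets.Int) auto
      also have "\<dots> \<le> emeasure lebesgue (?W \<inter> cball x h) + ennreal h"
        by (intro add_left_mono Ble)
      also have "\<dots> = ennreal h + emeasure lebesgue (?W \<inter> cball x h)" by (rule add.commute)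
      finally have "ennreal (2 * h) \<le> ennreal h + emeasure lebesgue (?W \<inter> cball x h)" .
      moreover have "ennreal (2 * h) = ennreal h + ennreal h" using h0 by (simp flip: ennreal_plus)
      ultimately have "ennreal h + ennreal h \<le> ennreal h + emeasure lebesgue (?W \<inter> cball x h)" by (simp only:)
      \<comment> \<open>Of the length 2 h of the ball at most h is lost to B. The fivefold ball has
        length 10 h, whence the factor 10 in the density.\<close>
      then have Wh: "ennreal h \<le> emeasure lebesgue (?W \<inter> cball x h)"
        unfolding ennreal_add_left_cancel_le by simp
      have "emeasure lebesgue (G \<delta> \<inter> cball x (5 * h)) \<le> emeasure lebesgue (cball x (5 * h))"
        by (intro emeasure_mono) auto
      also have "\<dots> = 10 * ennreal h"
        using h0 by (simp add: cball_eq_atLeastAtMost ennreal_mult)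
      also have "\<dots> \<le> emeasure ?\<nu> (cball x h)"
        using Wh by (subst \<nu>) (auto intro!: mult_left_mono)
      finally have *: "emeasure lebesgue (G \<delta> \<inter> cball x (5 * h)) \<le> emeasure ?\<nu> (cball x h)" .
      have "l < 1 / h * ?F"
        using gt norm_kconv_le[OF kernel_measurable(2) kernel_bounds(2)[OF h0] f, of x] by linarith
      then have "h \<le> ?F / l" using h0 l by (simp add: field_simps)
      then show "\<exists>r>0. r \<le> ?F / l + \<bar>x\<bar> \<and> cball x r \<subseteq> UNIV \<and>
           emeasure lebesgue (G \<delta> \<inter> cball x (5 * r)) \<le> emeasure ?\<nu> (cball x r)"
        using h0 * by (intro exI[of _ h]) auto
    qed (use Gm[OF \<delta>] in auto)
    also have "\<dots> = 10 * emeasure lebesgue ?W" by (subst \<nu>) simp_all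
    also have "\<dots> \<le> 10 * ennreal (23168 / (l / 2) * ?F)"
      using l by (intro mult_left_mono emeasure_qk_le f supp \<delta>) auto
    also have "\<dots> = ennreal (463360 / l * ?F)"
      using F0 l by (subst ennreal_numeral[symmetric], subst ennreal_mult[symmetric]) (auto simp: field_simps)
    finally show ?thesis .
  qed
  have inc: "incseq (\<lambda>n. G (1 / real (Suc n)))"
  proof (rule incseq_SucI)
    fix n
    have "1 / real (Suc (Suc n)) \<le> 1 / real (Suc n)" by (simp add: frac_le)
    then show "G (1 / real (Suc n)) \<le> G (1 / real (Suc (Suc n)))"
      unfolding G_def by (auto intro: order_trans)
  qed
  have sub: "Hset f l \<subseteq> (\<Union>n. G (1 / real (Suc n))) \<union> ?M"
  proof
    fix x assume "x \<in> Hset f l"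
    then obtain h where h: "0 < h" "norm (kconv (qk h) f x) > l" by (auto simp: Hset_def)
    obtain n where "1 / real (Suc n) < h" using h(1) by (metis nat_approx_posE of_nat_Suc)
    then show "x \<in> (\<Union>n. G (1 / real (Suc n))) \<union> ?M"
      using h by (auto simp: G_def intro!: exI[of _ n] exI[of _ h])
  qed
  have GUm: "(\<Union>n. G (1 / real (Suc n))) \<in> sets lebesgue" using Gm by auto
  have "emeasure lebesgue (Hset f l) \<le> emeasure lebesgue ((\<Union>n. G (1 / real (Suc n))) \<union> ?M)"
    by (intro emeasure_mono sub GUm sets.Un sets_Mset_Hset f)
  also have "\<dots> \<le> emeasure lebesgue (\<Union>n. G (1 / real (Suc n))) + emeasure lebesgue ?M"
    by (intro emeasure_subadditive GUm sets_Mset_Hset f)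
  also have "emeasure lebesgue (\<Union>n. G (1 / real (Suc n))) = (SUP n. emeasure lebesgue (G (1 / real (Suc n))))"
    using Gm inc by (intro SUP_emeasure_incseq[symmetric]) auto
  also have "\<dots> \<le> ennreal (463360 / l * ?F)"
    by (intro SUP_least Gle) auto
  also have "ennreal (463360 / l * ?F) + emeasure lebesgue ?M \<le> ennreal (463360 / l * ?F) + ennreal (80 / (l / 10 ^ 6) * ?F)"
    using l by (intro add_left_mono emeasure_Mset_le f) auto
  also have "\<dots> = ennreal (80463360 / l * ?F)"
    using l F0 by (subst ennreal_plus[symmetric]) (auto simp: field_simps)
  also have "\<dots> \<le> ennreal (10 ^ 8 / l * ?F)"
    using l F0 by (intro ennreal_leI mult_right_mono divide_right_mono) auto
  finally show ?thesis by (simp add: add_mono)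
qed

text \<open>A point x is compared with the nearest point p outside E = \<open>Hset f a\<close>,
  where every height gives at most a. Passing to p costs 24 b for the far part and 101 b for the
  near part at p; the rest of the excess K b must come from the part of f within 10 d of x, whose
  mass is at most 101 d b.\<close>

lemma good_lambda:
  assumes \<delta>: "0 < \<delta>"
  obtains K :: real where "0 < K"
    "\<And>f a b. integrable lebesgue f \<Longrightarrow> (\<And>u. u \<notin> {-1<..<1} \<Longrightarrow> f u = 0) \<Longrightarrow> 0 < a \<Longrightarrow> 0 < b \<Longrightarrow>
      emeasure lebesgue (Hset f (a + K * b)) \<le> emeasure lebesgue (Mset f b) + ennreal \<delta> * emeasure lebesgue (Hset f a)"
proof
  \<comment> \<open>125 = 24 + 101 is the loss in passing to p. The remaining 2 10^10/\<delta> makes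
    the weak type bound for the near part, 10^8 101 d/(K - 125), at most \<delta> d.\<close>
  define K where "K = 125 + 2 * 10 ^ 10 / \<delta>"
  show "0 < K" using \<delta> by (simp add: K_def add_pos_pos)
  fix f :: "real \<Rightarrow> complex" and a b :: real
  assume f: "integrable lebesgue f" and supp: "\<And>u. u \<notin> {-1<..<1} \<Longrightarrow> f u = 0" and a: "0 < a" and b: "0 < b"
  let ?E = "Hset f a"
  let ?G = "Hset f (a + K * b) - Mset f b"
  let ?\<nu> = "density lebesgue (\<lambda>_. ennreal \<delta>)"
  have \<nu>: "emeasure ?\<nu> S = ennreal \<delta> * emeasure lebesgue S" if "S \<in> sets lebesgue" for S
    using that by (simp add: emeasure_density nn_integral_cmult_indicator)
  have E: "open ?E" by (rule open_Hset[OF f])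
  \<comment> \<open>Finite measure ensures a point outside E and bounds its distance from x, as the
    covering lemma requires.\<close>
  have Efin: "emeasure lebesgue ?E < \<infinity>"
    
  proof -
    have "emeasure lebesgue ?E \<le> ennreal (10 ^ 8 / a * (LINT u|lebesgue. norm (f u)))"
      by (intro emeasure_Hset_le f supp a)
    also have "\<dots> < \<infinity>" by (simp only: infinity_ennreal_def ennreal_less_top)
    finally show ?thesis .
  qed
  have sub: "Hset f (a + K * b) \<subseteq> ?E"
  proof -
    have "a \<le> a + K * b" using \<open>0 < K\<close> b by simp
    then show ?thesis by (auto simp: Hset_def intro: le_less_trans)
  qed
  have Gm: "?G \<in> sets lebesgue" by (intro sets.Diff sets_Mset_Hset f)
  have "emeasure lebesgue ?G \<le> emeasure ?\<nu> ?E"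
  proof (rule covering_bound[where B="measure lebesgue ?E"])
    fix x assume x: "x \<in> ?G"
    then have xE: "x \<in> ?E" using sub by auto
    have ne: "- ?E \<noteq> {}"
    proof
      assume "- ?E = {}"
      then have "?E = UNIV" by auto
      then show False using Efin by simp
    qed
    have cl: "closed (- ?E)" using E by (simp add: closed_Compl)
    define d where "d = infdist x (- ?E)"
    obtain p where p: "p \<in> - ?E" "d = dist x p"
      using infdist_attains_inf[OF cl ne] unfolding d_def by metis
    have d0: "0 < d" using p xE by (auto simp: zero_less_dist_iff)
    have ball: "ball x d \<subseteq> ?E"
    proof
      fix y assume y: "y \<in> ball x d"
      show "y \<in> ?E"
      proof (rule ccontr)
        assume "y \<notin> ?E"
        then have "d \<le> dist x y" unfolding d_def by (intro infdist_le) auto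
        then show False using y by simp
      qed
    qed
    have dE: "d / 2 \<le> measure lebesgue ?E"
    proof -
      have "measure lebesgue (ball x d) \<le> measure lebesgue ?E"
        using ball Efin E by (intro measure_mono_fmeasurable) (auto simp: fmeasurable_def)
      moreover have "measure lebesgue (ball x d) = 2 * d" using d0 by (simp add: ball_eq_greaterThanLessThan)
      ultimately show ?thesis using d0 by simp
    qed
    have P: "kconv (pk h) (\<lambda>u. norm (f u)) x \<le> b" if "0 < h" for h
      using x that by (force simp: Mset_def not_less)
    let ?f1 = "\<lambda>u. indicator (cball x (10 * d)) u *\<^sub>R f u"
    let ?f2 = "\<lambda>u. f u - ?f1 u"
    have f1: "integrable lebesgue ?f1" by (rule integrable_cutoff[OF f]) auto
    have f2: "integrable lebesgue ?f2" using f f1 by simp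
    have F1: "(LINT u|lebesgue. norm (?f1 u)) \<le> 101 * d * b"
    proof -
      have "(LINT u|lebesgue. norm (?f1 u)) \<le> ((10 * d)\<^sup>2 + d\<^sup>2) / d * kconv (pk d) (\<lambda>u. norm (f u)) x"
        by (rule near_le[OF f d0])
      also have "((10 * d)\<^sup>2 + d\<^sup>2) / d = 101 * d" using d0 by (simp add: power2_eq_square field_simps)
      also have "101 * d * kconv (pk d) (\<lambda>u. norm (f u)) x \<le> 101 * d * b"
        using P[OF d0] d0 by (intro mult_left_mono) auto
      finally show ?thesis .
    qed
    have sub1: "?G \<inter> cball x (5 * (d / 2)) \<subseteq> Hset ?f1 ((K - 125) * b)"
    proof
      fix y assume y: "y \<in> ?G \<inter> cball x (5 * (d / 2))"
      then obtain h where h: "0 < h" "norm (kconv (qk h) f y) > a + K * b" by (auto simp: Hset_def)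
      have xy: "\<bar>x - y\<bar> \<le> 5/2 * d" using y by (simp add: dist_norm)
      \<comment> \<open>The height at p is raised to at least d, both for \<open>qk_far_le\<close>
        and to bound the transform of the near part at p by its mass over d.\<close>
      define h' where "h' = sqrt (h\<^sup>2 + d\<^sup>2)"
      have h': "0 < h'" "h'\<^sup>2 = h\<^sup>2 + d\<^sup>2" using h d0 by (auto simp: h'_def add_nonneg_pos)
      have dh: "d \<le> h'" by (rule power2_le_imp_le) (use h' in auto)
      have q1: "norm (kconv (qk h) ?f2 y - kconv (qk h') ?f2 p) \<le> 24 * kconv (pk h') (\<lambda>u. norm (?f2 u)) x"
      proof (rule kconv_diff_le[OF kernel_measurable(2) kernel_bounds(2)[OF h(1)] kernel_measurable(2) kernel_bounds(2)[OF h'(1)]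
           kernel_measurable(1) kernel_bounds(1)[OF h'(1)] f2])
        fix u assume "?f2 u \<noteq> 0"
        then have "u \<notin> cball x (10 * d)" by (auto simp: indicator_def split: if_splits)
        then have "10 * d \<le> \<bar>u - x\<bar>" by (auto simp: dist_norm)
        then show "\<bar>qk h (u - y) - qk h' (u - p)\<bar> \<le> 24 * pk h' (u - x)"
          using xy p(2) by (intro qk_far_le[OF h(1) d0 _ _ _ h']) (auto simp: dist_norm abs_minus_commute)
      qed
      have q2: "kconv (pk h') (\<lambda>u. norm (?f2 u)) x \<le> b"
      proof -
        have "kconv (pk h') (\<lambda>u. norm (?f2 u)) x \<le> kconv (pk h') (\<lambda>u. norm (f u)) x"
          using f f2 by (intro kconv_mono h') (auto split: split_indicator)
        then show ?thesis using P[OF h'(1)] by simp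
      qed
      have q3: "norm (kconv (qk h') f p) \<le> a" using p(1) h'(1) by (force simp: Hset_def not_less)
      have q4: "norm (kconv (qk h') ?f1 p) \<le> 101 * b"
      proof -
        have "norm (kconv (qk h') ?f1 p) \<le> 1 / h' * (LINT u|lebesgue. norm (?f1 u))"
          by (rule norm_kconv_le[OF kernel_measurable(2) kernel_bounds(2)[OF h'(1)] f1])
        also have "\<dots> \<le> 1 / d * (101 * d * b)"
          using F1 d0 dh by (intro mult_mono divide_left_mono) auto
        finally show ?thesis using d0 by simp
      qed
      have e1: "kconv (qk h) f y = kconv (qk h) ?f2 y + kconv (qk h) ?f1 y"
        using kconv_add[OF kernel_measurable(2) kernel_bounds(2)[OF h(1)] f2 f1, of y] by simp
      have e2: "kconv (qk h') f p = kconv (qk h') ?f2 p + kconv (qk h') ?f1 p"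
        using kconv_add[OF kernel_measurable(2) kernel_bounds(2)[OF h'(1)] f2 f1, of p] by simp
      have "kconv (qk h) f y = kconv (qk h) ?f1 y - 0 - 0 + (kconv (qk h) ?f2 y - kconv (qk h') ?f2 p) - (kconv (qk h') ?f1 p - kconv (qk h') f p)"
        unfolding e1 e2 by simp
      then have "norm (kconv (qk h) f y) \<le> norm (kconv (qk h) ?f1 y) + norm (0::complex) + norm (0::complex)
          + norm (kconv (qk h) ?f2 y - kconv (qk h') ?f2 p) + norm (kconv (qk h') ?f1 p - kconv (qk h') f p)"
        by (rule ord_eq_le_trans[OF arg_cong[where f=norm] norm_combination_le])
      moreover have "norm (kconv (qk h') ?f1 p - kconv (qk h') f p) \<le> norm (kconv (qk h') f p) + norm (kconv (qk h') ?f1 p)"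
        using norm_triangle_ineq4[of "kconv (qk h') ?f1 p" "kconv (qk h') f p"] by simp
      ultimately have "norm (kconv (qk h) f y) \<le> norm (kconv (qk h) ?f1 y) + norm (kconv (qk h) ?f2 y - kconv (qk h') ?f2 p)
          + norm (kconv (qk h') f p) + norm (kconv (qk h') ?f1 p)"
        by simp
      then have "norm (kconv (qk h) ?f1 y) > a + K * b - 24 * b - a - 101 * b"
        using q1 q2 q3 q4 h(2) by linarith
      then show "y \<in> Hset ?f1 ((K - 125) * b)"
        using h(1) by (auto simp: Hset_def algebra_simps)
    qed
    have "emeasure lebesgue (?G \<inter> cball x (5 * (d / 2))) \<le> emeasure lebesgue (Hset ?f1 ((K - 125) * b))"
      by (intro emeasure_mono sub1 sets_Mset_Hset f1)
    also have "\<dots> \<le> ennreal (10 ^ 8 / ((K - 125) * b) * (LINT u|lebesgue. norm (?f1 u)))"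
      using supp b \<delta> by (intro emeasure_Hset_le f1) (auto simp: K_def)
    also have "\<dots> \<le> ennreal (10 ^ 8 / ((K - 125) * b) * (101 * d * b))"
      using F1 b \<delta> by (intro ennreal_leI mult_left_mono) (auto simp: K_def)
    also have "\<dots> \<le> ennreal (\<delta> * d)"
      using b \<delta> d0 by (intro ennreal_leI) (simp add: K_def)
    also have "\<dots> = emeasure ?\<nu> (cball x (d / 2))"
      using d0 \<delta> by (subst \<nu>) (auto simp: cball_eq_atLeastAtMost ennreal_mult)
    finally have *: "emeasure lebesgue (?G \<inter> cball x (5 * (d / 2))) \<le> emeasure ?\<nu> (cball x (d / 2))" .
    have "cball x (d / 2) \<subseteq> ?E" using ball d0 by force
    then show "\<exists>r>0. r \<le> measure lebesgue ?E + \<bar>x\<bar> \<and> cball x r \<subseteq> ?E \<and>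
        emeasure lebesgue (?G \<inter> cball x (5 * r)) \<le> emeasure ?\<nu> (cball x r)"
      using * d0 dE by (intro exI[of _ "d / 2"]) auto
  qed (use Gm E in auto)
  also have "\<dots> = ennreal \<delta> * emeasure lebesgue ?E" using E by (subst \<nu>) auto
  finally have G: "emeasure lebesgue ?G \<le> ennreal \<delta> * emeasure lebesgue ?E" .
  have "emeasure lebesgue (Hset f (a + K * b)) \<le> emeasure lebesgue (Mset f b \<union> ?G)"
    by (intro emeasure_mono sets.Un Gm sets_Mset_Hset f) auto
  also have "\<dots> \<le> emeasure lebesgue (Mset f b) + emeasure lebesgue ?G"
    by (intro emeasure_subadditive Gm sets_Mset_Hset f)
  finally show "emeasure lebesgue (Hset f (a + K * b)) \<le> emeasure lebesgue (Mset f b) + ennreal \<delta> * emeasure lebesgue (Hset f a)"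
    using G by (meson add_left_mono order_trans)
qed

section \<open>Existence almost everywhere\<close>

text \<open>Elements of the spaces are total functions with arbitrary values off (-1,1); extension
  by 0 lets convolutions and coverings take place on the whole line.\<close>

definition ext :: "(real \<Rightarrow> complex) \<Rightarrow> real \<Rightarrow> complex" where
  "ext f u = indicator {-1<..<1} u *\<^sub>R f u"

lemma ext_outside: "u \<notin> {-1<..<1} \<Longrightarrow> ext f u = 0"
  by (simp add: ext_def)

lemma L1_iff: "f \<in> L1 \<longleftrightarrow> integrable lebesgue (ext f)"
  unfolding L1_def ext_def[abs_def] by (simp add: integrable_restrict_space)

lemma L1_integral_ext: "(LINT u|lebesgue. norm (ext f u)) = (LINT u|M1. norm (f u))"
  by (subst integral_restrict_space) (auto simp: ext_def)

lemma ext_linear: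
  "ext (\<lambda>x. f x + g x) = (\<lambda>u. ext f u + ext g u)"
  "ext (\<lambda>x. f x - g x) = (\<lambda>u. ext f u - ext g u)"
  "ext (\<lambda>x. c * f x) = (\<lambda>u. c * ext f u)"
  by (auto simp: ext_def fun_eq_iff algebra_simps)

lemma hilbert_eq_kconv:
  "hilbert f t = Lim (at_right 0) (\<lambda>\<epsilon>. complex_of_real (1 / pi) * kconv (hk \<epsilon>) (ext f) t)"
proof -
  have "(LINT x : {x. -1 < x \<and> x < 1 \<and> \<epsilon> < \<bar>x - t\<bar>} | lebesgue. f x / complex_of_real (x - t)) = kconv (hk \<epsilon>) (ext f) t" for \<epsilon>
    unfolding kconv_def set_lebesgue_integral_def
    by (intro Bochner_Integration.integral_cong refl)
      (auto simp: hk_def ext_def scaleR_conv_of_real divide_inverse indicator_def)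
  then show ?thesis unfolding hilbert_def by simp
qed

text \<open>At equal heights the sharp and the smooth truncation differ by at most a Poisson kernel,
  so the two maximal functions together control all truncated integrals.\<close>

lemma hk_qk_le:
  assumes "0 < h" shows "\<bar>hk h s - qk h s\<bar> \<le> pk h s"
proof -
  have p: "0 < s\<^sup>2 + h\<^sup>2" using assms by (simp add: add_nonneg_pos)
  show ?thesis
  proof (cases "h < \<bar>s\<bar>")
    case True
    then have s: "s \<noteq> 0" using assms by auto
    have "hk h s - qk h s = h\<^sup>2 / (s * (s\<^sup>2 + h\<^sup>2))"
    proof -
      have ne: "s\<^sup>2 + h\<^sup>2 \<noteq> 0" using p by linarith
      have "1 * (s\<^sup>2 + h\<^sup>2) - s * s = h\<^sup>2" by (simp add: power2_eq_square)
      then show ?thesis using True unfolding hk_def qk_def if_P[OF True] diff_frac_eq[OF s ne] by (simp only:)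
    qed
    then have "\<bar>hk h s - qk h s\<bar> = h\<^sup>2 / (\<bar>s\<bar> * (s\<^sup>2 + h\<^sup>2))"
      using p by (simp add: abs_mult)
    also have "\<dots> \<le> h\<^sup>2 / (h * (s\<^sup>2 + h\<^sup>2))"
      using True p assms by (intro divide_left_mono mult_right_mono mult_pos_pos) auto
    also have "\<dots> = pk h s" using assms by (simp add: pk_def power2_eq_square)
    finally show ?thesis .
  next
    case False
    then have "\<bar>hk h s - qk h s\<bar> = \<bar>s\<bar> / (s\<^sup>2 + h\<^sup>2)" using p by (simp add: hk_def qk_def)
    also have "\<dots> \<le> pk h s" unfolding pk_def using False p by (intro divide_right_mono) auto
    finally show ?thesis .
  qed
qed

definition Tset :: "(real \<Rightarrow> complex) \<Rightarrow> real \<Rightarrow> real set" where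
  "Tset f a = {x. \<exists>h>0. norm (kconv (hk h) f x) > a}"

lemma Tset_subset:
  assumes f: "integrable lebesgue f" and l: "a + b \<le> l"
  shows "Tset f l \<subseteq> Hset f a \<union> Mset f b"
proof
  fix x assume "x \<in> Tset f l"
  then obtain h where h: "0 < h" "norm (kconv (hk h) f x) > l" by (auto simp: Tset_def)
  have "norm (kconv (hk h) f x - kconv (qk h) f x) \<le> 1 * kconv (pk h) (\<lambda>u. norm (f u)) x"
    by (rule kconv_diff_le[OF kernel_measurable(3) kernel_bounds(3)[OF h(1)] kernel_measurable(2) kernel_bounds(2)[OF h(1)]
         kernel_measurable(1) kernel_bounds(1)[OF h(1)] f]) (simp add: hk_qk_le[OF h(1)])
  then have "norm (kconv (hk h) f x) \<le> norm (kconv (qk h) f x) + kconv (pk h) (\<lambda>u. norm (f u)) x"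
    using norm_triangle_ineq2[of "kconv (hk h) f x" "kconv (qk h) f x"] by simp
  then have "norm (kconv (qk h) f x) > a \<or> kconv (pk h) (\<lambda>u. norm (f u)) x > b" using h(2) l by linarith
  then show "x \<in> Hset f a \<union> Mset f b" using h(1) by (auto simp: Hset_def Mset_def)
qed

text \<open>A measurable superset obeying the weak type bound is what the Borel-Cantelli argument
  consumes. The constant is 2 10^8 + 160, rounded up.\<close>

lemma Tset_cover:
  assumes f: "integrable lebesgue f" "\<And>u. u \<notin> {-1<..<1} \<Longrightarrow> f u = 0" and l: "0 < l"
  obtains W where "W \<in> sets lebesgue" "Tset f l \<subseteq> W"
    "emeasure lebesgue W \<le> ennreal (10 ^ 9 / l * (LINT u|lebesgue. norm (f u)))"
proof
  let ?W = "Hset f (l / 2) \<union> Mset f (l / 2)"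
  let ?F = "LINT u|lebesgue. norm (f u)"
  have F0: "0 \<le> ?F" by simp
  show "?W \<in> sets lebesgue" by (intro sets.Un sets_Mset_Hset f(1))
  show "Tset f l \<subseteq> ?W" by (rule Tset_subset[OF f(1)]) simp
  have "emeasure lebesgue ?W \<le> emeasure lebesgue (Hset f (l / 2)) + emeasure lebesgue (Mset f (l / 2))"
    by (intro emeasure_subadditive sets_Mset_Hset f(1))
  also have "\<dots> \<le> ennreal (10 ^ 8 / (l / 2) * ?F) + ennreal (80 / (l / 2) * ?F)"
    using emeasure_Hset_le[OF f half_gt_zero[OF l]] emeasure_Mset_le[OF f(1) half_gt_zero[OF l]] by (intro add_mono)
  also have "\<dots> = ennreal (10 ^ 8 / (l / 2) * ?F + 80 / (l / 2) * ?F)"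
    using l by (intro ennreal_plus[symmetric]) auto
  also have "10 ^ 8 / (l / 2) * ?F + 80 / (l / 2) * ?F = 200000160 / l * ?F"
    by (simp only: distrib_right[symmetric] add_divide_distrib[symmetric] divide_divide_eq_right) simp
  also have "ennreal (200000160 / l * ?F) \<le> ennreal (10 ^ 9 / l * ?F)"
    by (intro ennreal_leI mult_right_mono divide_right_mono) (use l F0 in simp_all)
  finally show "emeasure lebesgue ?W \<le> ennreal (10 ^ 9 / l * ?F)" .
qed

section \<open>Approximation in L^1 by functions locally constant off a null set\<close>

definition loc_const :: "(real \<Rightarrow> complex) \<Rightarrow> real \<Rightarrow> bool" where
  "loc_const g x \<longleftrightarrow> (\<exists>\<eta>>0. \<forall>u. \<bar>u - x\<bar> < \<eta> \<longrightarrow> g u = g x)"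

lemma loc_const_add: "loc_const f x \<Longrightarrow> loc_const g x \<Longrightarrow> loc_const (\<lambda>u. f u + g u) x"
  unfolding loc_const_def
proof safe
  fix a b :: real
  assume "0 < a" "0 < b" "\<forall>u. \<bar>u - x\<bar> < a \<longrightarrow> f u = f x" "\<forall>u. \<bar>u - x\<bar> < b \<longrightarrow> g u = g x"
  then show "\<exists>\<eta>>0. \<forall>u. \<bar>u - x\<bar> < \<eta> \<longrightarrow> f u + g u = f x + g x"
    by (intro exI[of _ "min a b"]) (metis min_less_iff_conj)
qed

text \<open>V is a finite union of balls between a compact subset and an open superset of A.
  Finiteness is the point: only finitely many endpoints have to be removed for the indicator to be
  locally constant.\<close>

lemma interval_union_approx:
  assumes A: "A \<in> sets lebesgue" "A \<subseteq> {-1<..<1}" and e: "0 < e"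
  obtains V where "open V" "V \<subseteq> {-1<..<1}" "emeasure lebesgue ((A - V) \<union> (V - A)) < ennreal e"
    "AE x in lebesgue. loc_const (\<lambda>u. indicator V u *\<^sub>R c) x"
proof -
  obtain T where T: "closed T" "T \<subseteq> A" "A - T \<in> lmeasurable" "emeasure lebesgue (A - T) < ennreal (e / 2)"
    using sets_lebesgue_inner_closed[OF A(1), of "e / 2"] e by auto
  obtain U where U: "open U" "A \<subseteq> U" "U - A \<in> lmeasurable" "emeasure lebesgue (U - A) < ennreal (e / 2)"
    using sets_lebesgue_outer_open[OF A(1), of "e / 2"] e by auto
  let ?U = "U \<inter> {-1<..<1}"
  have oU: "open ?U" using U(1) by auto
  have "T \<subseteq> {-1..1}" using T A(2) by (force simp: subset_iff)
  then have "bounded T" by (rule bounded_subset[OF bounded_closed_interval])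
  then have cT: "compact T" using T(1) by (simp add: compact_eq_bounded_closed)
  have TU: "T \<subseteq> ?U" using T(2) U(2) A(2) by auto
  have "\<forall>x\<in>T. \<exists>r>0. ball x r \<subseteq> ?U" using TU oU open_contains_ball by blast
  then obtain r where r: "\<And>x. x \<in> T \<Longrightarrow> 0 < r x \<and> ball x (r x) \<subseteq> ?U"
    using bchoice[of T "\<lambda>x r. 0 < r \<and> ball x r \<subseteq> ?U"] by blast
  obtain F where F: "F \<subseteq> T" "finite F" "T \<subseteq> (\<Union>x\<in>F. ball x (r x))"
  proof (rule compactE_image[OF cT, of T "\<lambda>x. ball x (r x)"])
    show "T \<subseteq> (\<Union>x\<in>T. ball x (r x))" using r by force
  qed auto
  define V where "V = (\<Union>x\<in>F. ball x (r x))"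
  have oV: "open V" unfolding V_def by auto
  have VU: "V \<subseteq> ?U" unfolding V_def using F(1) r by blast
  have "emeasure lebesgue ((A - V) \<union> (V - A)) \<le> emeasure lebesgue ((A - T) \<union> (U - A))"
    using T(3) U(3) F(3) VU by (intro emeasure_mono sets.Un) (auto simp: V_def fmeasurable_def)
  also have "\<dots> \<le> emeasure lebesgue (A - T) + emeasure lebesgue (U - A)"
    using T(3) U(3) by (intro emeasure_subadditive) (auto simp: fmeasurable_def)
  also have "\<dots> < ennreal (e / 2) + ennreal (e / 2)"
    by (intro add_strict_mono T U)
  also have "\<dots> = ennreal e" using e by (simp flip: ennreal_plus)
  finally have *: "emeasure lebesgue ((A - V) \<union> (V - A)) < ennreal e" .
  define D where "D = (\<Union>x\<in>F. {x - r x, x + r x})"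
  have "finite D" unfolding D_def using F(2) by auto
  then have "AE x in lebesgue. x \<notin> D"
    by (intro AE_not_in) (auto simp: negligible_iff_null_sets[symmetric] intro!: negligible_finite)
  then have "AE x in lebesgue. loc_const (\<lambda>u. indicator V u *\<^sub>R c) x"
  proof eventually_elim
    case (elim x)
    show ?case
    proof (cases "x \<in> V")
      case True
      then obtain \<eta> where "0 < \<eta>" "ball x \<eta> \<subseteq> V" using oV open_contains_ball by blast
      then show ?thesis using True unfolding loc_const_def
        by (intro exI[of _ \<eta>]) (auto simp: dist_norm abs_minus_commute subset_iff indicator_def)
    next
      case False
      \<comment> \<open>A point that is neither in V nor an endpoint lies outside the finite union
        of closed balls, which is closed, and so has a neighbourhood missing V.\<close>
      let ?C = "\<Union>y\<in>F. cball y (r y)"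
      have "x \<notin> ?C"
      proof
        assume "x \<in> ?C"
        then obtain y where y: "y \<in> F" "dist y x \<le> r y" by auto
        moreover have "\<not> dist y x < r y" using False y(1) by (auto simp: V_def)
        ultimately have "dist y x = r y" by simp
        then have "x = y - r y \<or> x = y + r y" by (auto simp: dist_norm abs_if split: if_splits)
        then show False using elim y(1) by (auto simp: D_def)
      qed
      moreover have "closed ?C" using F(2) by auto
      ultimately obtain \<eta> where "0 < \<eta>" "ball x \<eta> \<subseteq> - ?C"
        by (metis (no_types) ComplI open_Compl open_contains_ball)
      moreover have "V \<subseteq> ?C" unfolding V_def by (intro UN_mono ball_subset_cball) auto
      ultimately have "0 < \<eta>" "\<And>u. \<bar>u - x\<bar> < \<eta> \<Longrightarrow> u \<notin> V"
        by (auto simp: dist_norm abs_minus_commute subset_iff)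
      then show ?thesis using False unfolding loc_const_def by (intro exI[of _ \<eta>]) auto
    qed
  qed
  then show ?thesis using that[OF oV _ *] VU by auto
qed

text \<open>Local constancy makes truncated integrals stabilise by mere oddness of the kernel. The
  proof is by induction over integrable functions; P carries the quantifier over e because the
  induction steps have to split e.\<close>

lemma L1_step_approx:
  assumes "f \<in> L1" "0 < e"
  shows "\<exists>g. g \<in> L1 \<and> (LINT x|M1. norm (f x - g x)) < e \<and> (AE x in lebesgue. loc_const (ext g) x)"
proof -
  define P where "P f \<longleftrightarrow> (\<forall>e>0. \<exists>g. g \<in> L1 \<and> (LINT x|M1. norm (f x - g x)) < e \<and> (AE x in lebesgue. loc_const (ext g) x))"
    for f :: "real \<Rightarrow> complex"
  have "integrable M1 f" using assms(1) by (simp add: L1_def)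
  then have "P f"
  proof (induction rule: integrable_induct)
    case (base A c)
    show ?case unfolding P_def
    proof (intro allI impI)
      fix e :: real assume e: "0 < e"
      have A: "A \<in> sets lebesgue" "A \<subseteq> {-1<..<1}" using base(1) by (auto simp: sets_restrict_space)
      obtain V where V: "open V" "V \<subseteq> {-1<..<1}" "emeasure lebesgue ((A - V) \<union> (V - A)) < ennreal (e / (norm c + 1))"
        "AE x in lebesgue. loc_const (\<lambda>u. indicator V u *\<^sub>R c) x"
        using interval_union_approx[OF A, of "e / (norm c + 1)"] e by (auto simp: add_nonneg_pos)
      let ?D = "(A - V) \<union> (V - A)"
      have Vm: "V \<in> sets M1" using V by (auto simp: sets_restrict_space_iff)
      have Dm: "?D \<in> sets M1" using Vm base(1) by auto
      have fin: "emeasure M1 S < \<infinity>" if "S \<in> sets M1" for S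
      proof -
        have "emeasure M1 S \<le> emeasure M1 (space M1)" using that by (intro emeasure_space)
        also have "\<dots> < \<infinity>" by (simp add: emeasure_restrict_space)
        finally show ?thesis .
      qed
      have g: "(\<lambda>u. indicator V u *\<^sub>R c) \<in> L1"
        using fin[OF Vm] Vm by (simp add: L1_def)
      have "(LINT x|M1. norm (indicator A x *\<^sub>R c - indicator V x *\<^sub>R c)) = (LINT x|M1. indicator ?D x *\<^sub>R norm c)"
        by (intro Bochner_Integration.integral_cong refl) (auto simp: indicator_def)
      also have "\<dots> = measure M1 (?D \<inter> space M1) * norm c" using Dm fin[OF Dm] by simp
      also have "?D \<inter> space M1 = ?D" using A(2) V(2) by auto
      also have "measure M1 ?D = measure lebesgue ?D"
        using Dm by (intro measure_restrict_space) (auto simp: sets_restrict_space)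
      also have "measure lebesgue ?D * norm c < e"
      proof -
        have "measure lebesgue ?D < e / (norm c + 1)"
          using V(3) by (cases "emeasure lebesgue ?D") (simp_all add: measure_def ennreal_less_iff)
        then have "measure lebesgue ?D * (norm c + 1) < e"
          by (simp add: pos_less_divide_eq add_nonneg_pos)
        moreover have "measure lebesgue ?D * norm c \<le> measure lebesgue ?D * (norm c + 1)"
          by (intro mult_left_mono) auto
        ultimately show ?thesis by linarith
      qed
      finally have "(LINT x|M1. norm (indicator A x *\<^sub>R c - indicator V x *\<^sub>R c)) < e" .
      moreover have "ext (\<lambda>u. indicator V u *\<^sub>R c) = (\<lambda>u. indicator V u *\<^sub>R c)"
        using V(2) by (auto simp: ext_def fun_eq_iff indicator_def)
      ultimately show "\<exists>g. g \<in> L1 \<and> (LINT x|M1. norm (indicator A x *\<^sub>R c - g x)) < e \<and> (AE x in lebesgue. loc_const (ext g) x)"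
        using g V(4) by (intro exI[of _ "\<lambda>u. indicator V u *\<^sub>R c"]) auto
    qed
  next
    case (add f1 f2)
    show ?case unfolding P_def
    proof (intro allI impI)
      fix e :: real assume e: "0 < e"
      obtain g1 where g1: "g1 \<in> L1" "(LINT x|M1. norm (f1 x - g1 x)) < e / 2" "AE x in lebesgue. loc_const (ext g1) x"
        using add(3) half_gt_zero[OF e] unfolding P_def by blast
      obtain g2 where g2: "g2 \<in> L1" "(LINT x|M1. norm (f2 x - g2 x)) < e / 2" "AE x in lebesgue. loc_const (ext g2) x"
        using add(4) half_gt_zero[OF e] unfolding P_def by blast
      have i: "integrable M1 g1" "integrable M1 g2" using g1 g2 by (auto simp: L1_def)
      have "(LINT x|M1. norm (f1 x + f2 x - (g1 x + g2 x))) \<le> (LINT x|M1. norm (f1 x - g1 x) + norm (f2 x - g2 x))"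
        using i add(1,2) by (intro integral_mono) (auto intro!: norm_diff_triangle_ineq)
      also have "\<dots> < e" using i add(1,2) g1(2) g2(2) by simp
      finally have *: "(LINT x|M1. norm (f1 x + f2 x - (g1 x + g2 x))) < e" .
      have "AE x in lebesgue. loc_const (ext (\<lambda>x. g1 x + g2 x)) x"
        using g1(3) g2(3) by eventually_elim (simp add: ext_linear loc_const_add)
      then show "\<exists>g. g \<in> L1 \<and> (LINT x|M1. norm (f1 x + f2 x - g x)) < e \<and> (AE x in lebesgue. loc_const (ext g) x)"
        using * i by (intro exI[of _ "\<lambda>x. g1 x + g2 x"]) (auto simp: L1_def)
    qed
  next
    case (lim f s)
    note conv = lim(2) and bound = lim(3) and Ps = lim(5)
    show ?case unfolding P_def
    proof (intro allI impI)
      fix e :: real assume e: "0 < e"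
      have "(\<lambda>i. LINT x|M1. norm (f x - s i x)) \<longlonglongrightarrow> (LINT x|M1. norm (f x - f x))"
      proof (rule integral_dominated_convergence[where w="\<lambda>x. 3 * norm (f x)"])
        show "AE x in M1. (\<lambda>i. norm (f x - s i x)) \<longlonglongrightarrow> norm (f x - f x)"
          by (intro AE_I2 tendsto_norm tendsto_diff tendsto_const conv)
        show "AE x in M1. norm (norm (f x - s i x)) \<le> 3 * norm (f x)" for i
        proof (rule AE_I2)
          fix x assume "x \<in> space M1"
          then show "norm (norm (f x - s i x)) \<le> 3 * norm (f x)"
            using bound[of x i] norm_triangle_ineq4[of "f x" "s i x"] by simp
        qed
      qed (use lim in auto)
      then have "(\<lambda>i. LINT x|M1. norm (f x - s i x)) \<longlonglongrightarrow> 0" by simp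
      then have "\<forall>\<^sub>F i in sequentially. (LINT x|M1. norm (f x - s i x)) < e / 2"
        using e by (intro order_tendstoD(2)) auto
      then obtain i where i: "(LINT x|M1. norm (f x - s i x)) < e / 2"
        by (auto simp: eventually_sequentially)
      obtain g where g: "g \<in> L1" "(LINT x|M1. norm (s i x - g x)) < e / 2" "AE x in lebesgue. loc_const (ext g) x"
        using Ps[of i] half_gt_zero[OF e] unfolding P_def by blast
      have ig: "integrable M1 g" using g(1) by (simp add: L1_def)
      have "(LINT x|M1. norm (f x - g x)) \<le> (LINT x|M1. norm (f x - s i x) + norm (s i x - g x))"
        using lim ig by (intro integral_mono) (auto intro: norm_triangle_sub order_trans[OF _ norm_triangle_ineq])
      also have "\<dots> < e" using lim ig i g(2) by simp
      finally show "\<exists>g. g \<in> L1 \<and> (LINT x|M1. norm (f x - g x)) < e \<and> (AE x in lebesgue. loc_const (ext g) x)"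
        using g by blast
    qed
  qed
  then show ?thesis using assms(2) unfolding P_def by blast
qed

text \<open>The difference of two truncated kernels is odd and lives where g is constant, so its
  integral vanishes.\<close>

lemma kconv_hk_loc_const:
  fixes g :: "real \<Rightarrow> complex"
  assumes g: "integrable lebesgue g" and c: "\<And>u. \<bar>u - x\<bar> < \<eta> \<Longrightarrow> g u = g x" and a: "0 < a" "a < \<eta>" and b: "0 < b" "b < \<eta>"
  shows "kconv (hk a) g x = kconv (hk b) g x"
proof -
  define k where "k s = hk a s - hk b s" for s
  have odd: "k (- s) = - k s" for s by (simp add: k_def hk_def)
  have km: "k \<in> borel_measurable borel" unfolding k_def[abs_def] by measurable
  have k0: "k s = 0" if "\<not> \<bar>s\<bar> < \<eta>" for s using that a b by (auto simp: k_def hk_def)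
  have i: "integrable lebesgue (\<lambda>u. hk a (u - x) *\<^sub>R g u)" "integrable lebesgue (\<lambda>u. hk b (u - x) *\<^sub>R g u)"
    using integrable_kernel[OF kernel_measurable(3) kernel_bounds(3)[OF a(1)] g]
     integrable_kernel[OF kernel_measurable(3) kernel_bounds(3)[OF b(1)] g] by auto
  have "kconv (hk a) g x - kconv (hk b) g x = (LINT u|lebesgue. k (u - x) *\<^sub>R g u)"
    unfolding kconv_def k_def using i by (simp add: scaleR_diff_left)
  also have "\<dots> = (LINT u|lebesgue. k (u - x) *\<^sub>R g x)"
  proof (intro Bochner_Integration.integral_cong refl)
    fix u show "k (u - x) *\<^sub>R g u = k (u - x) *\<^sub>R g x"
      using c[of u] k0[of "u - x"] by (cases "\<bar>u - x\<bar> < \<eta>") auto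
  qed
  also have "\<dots> = (LINT u|lborel. k (u - x) *\<^sub>R g x)"
    by (intro integral_completion borel_measurable_scaleR borel_measurable_const measurable_compose[OF _ km]) measurable
  also have "\<dots> = 0"
  proof -
    \<comment> \<open>The substitution reflects the line about x and turns the integral into its
      negative.\<close>
    have "(LINT u|lborel. k (u - x) *\<^sub>R g x) = \<bar>-1\<bar> *\<^sub>R (LINT u|lborel. k ((2 * x + (-1) * u) - x) *\<^sub>R g x)"
      by (rule lborel_integral_real_affine) simp
    also have "\<dots> = (LINT u|lborel. - (k (u - x) *\<^sub>R g x))"
    proof -
      have "k ((2 * x + (-1) * u) - x) = - k (u - x)" for u
        using odd[of "u - x"] by (simp add: algebra_simps)
      then show ?thesis by simp
    qed
    also have "\<dots> = - (LINT u|lborel. k (u - x) *\<^sub>R g x)" by (rule integral_minus)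
    finally show ?thesis by simp
  qed
  finally show ?thesis by simp
qed

section \<open>Convergence of the truncated integrals almost everywhere\<close>

lemma convergent_at_right_0:
  fixes F :: "real \<Rightarrow> 'a::complete_space"
  assumes "\<And>e. 0 < e \<Longrightarrow> \<exists>\<eta>>0. \<forall>a b. 0 < a \<longrightarrow> a < \<eta> \<longrightarrow> 0 < b \<longrightarrow> b < \<eta> \<longrightarrow> dist (F a) (F b) < e"
  shows "\<exists>L. (F \<longlongrightarrow> L) (at_right 0)"
proof -
  let ?X = "\<lambda>n. F (1 / real (Suc n))"
  have small: "\<forall>\<^sub>F n in sequentially. 1 / real (Suc n) < \<eta>" if "0 < \<eta>" for \<eta> :: real
    using order_tendstoD(2)[OF LIMSEQ_inverse_real_of_nat that] by (simp add: inverse_eq_divide)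
  have "Cauchy ?X"
  proof (rule metric_CauchyI)
    fix e :: real assume "0 < e"
    then obtain \<eta> where \<eta>: "0 < \<eta>" "\<And>a b. 0 < a \<Longrightarrow> a < \<eta> \<Longrightarrow> 0 < b \<Longrightarrow> b < \<eta> \<Longrightarrow> dist (F a) (F b) < e"
      using assms by blast
    obtain N where "\<And>n. n \<ge> N \<Longrightarrow> 1 / real (Suc n) < \<eta>" using small[OF \<eta>(1)] by (auto simp: eventually_sequentially)
    then show "\<exists>M. \<forall>m\<ge>M. \<forall>n\<ge>M. dist (?X m) (?X n) < e" using \<eta>(2) by (intro exI[of _ N]) auto
  qed
  then obtain L where L: "?X \<longlonglongrightarrow> L" using Cauchy_convergent convergentD by blast
  have "(F \<longlongrightarrow> L) (at_right 0)"
  proof (rule tendstoI)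
    fix e :: real assume "0 < e"
    then obtain \<eta> where \<eta>: "0 < \<eta>" "\<And>a b. 0 < a \<Longrightarrow> a < \<eta> \<Longrightarrow> 0 < b \<Longrightarrow> b < \<eta> \<Longrightarrow> dist (F a) (F b) < e / 2"
      using assms[of "e / 2"] by auto
    have "\<forall>\<^sub>F a in at_right 0. 0 < a \<and> a < \<eta>"
      using \<eta>(1) by (auto simp: eventually_at_right_less eventually_conj_iff eventually_at_right)
    then show "\<forall>\<^sub>F a in at_right 0. dist (F a) L < e"
    proof eventually_elim
      case (elim a)
      have "\<forall>\<^sub>F n in sequentially. dist (F a) (?X n) \<le> e / 2"
        using small[OF \<eta>(1)] by eventually_elim (use elim \<eta>(2) in \<open>auto intro: less_imp_le\<close>)
      moreover have "(\<lambda>n. dist (F a) (?X n)) \<longlonglongrightarrow> dist (F a) L" by (intro tendsto_intros L)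
      ultimately have "dist (F a) L \<le> e / 2"
        by (intro tendsto_upperbound[of _ _ sequentially]) auto
      then show ?case using \<open>0 < e\<close> by simp
    qed
  qed
  then show ?thesis by blast
qed

lemma AE_eventually_notin:
  fixes W :: "nat \<Rightarrow> real set"
  assumes W: "\<And>k. W k \<in> sets lebesgue" "\<And>k. emeasure lebesgue (W k) \<le> ennreal (c * (1/2) ^ k)" and c: "0 \<le> c"
  shows "AE x in lebesgue. \<forall>\<^sub>F k in sequentially. x \<notin> W k"
proof -
  have "AE x in lebesgue. \<forall>\<^sub>F k in sequentially. x \<in> space lebesgue - W k"
  proof (rule borel_cantelli_AE1[OF W(1)])
    show "emeasure lebesgue (W k) < \<infinity>" for k
      by (rule le_less_trans[OF W(2)]) (simp only: infinity_ennreal_def ennreal_less_top)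
    have "measure lebesgue (W k) \<le> c * (1/2) ^ k" for k
      unfolding measure_def using W(2) c by (intro enn2real_leI) auto
    then show "summable (\<lambda>k. measure lebesgue (W k))"
      by (intro summable_comparison_test[OF _ summable_mult[OF summable_geometric[of "1/2::real"], of c]]) auto
  qed
  then show ?thesis by eventually_elim auto
qed

text \<open>Mass 4^-k against level 2^-k: the exceptional sets have measure of order 2^-k, and the
  Borel-Cantelli lemma applies.\<close>

lemma AE_eventually_notin_Tset:
  assumes d: "\<And>k. integrable lebesgue (d k)" "\<And>k u. u \<notin> {-1<..<1} \<Longrightarrow> d k u = 0"
    and small: "\<And>k. (LINT u|lebesgue. norm (d k u)) \<le> (1/4) ^ k"
  shows "AE x in lebesgue. \<forall>\<^sub>F k in sequentially. x \<notin> Tset (d k) ((1/2) ^ k)"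
proof -
  have "\<exists>W. W \<in> sets lebesgue \<and> Tset (d k) ((1/2) ^ k) \<subseteq> W \<and> emeasure lebesgue W \<le> ennreal (10 ^ 9 * (1/2) ^ k)" for k
  proof -
    obtain W where W: "W \<in> sets lebesgue" "Tset (d k) ((1/2) ^ k) \<subseteq> W"
      "emeasure lebesgue W \<le> ennreal (10 ^ 9 / (1/2) ^ k * (LINT u|lebesgue. norm (d k u)))"
      by (rule Tset_cover[OF d(1), of k "(1/2) ^ k"]) (simp_all add: d(2))
    note W(3)
    also have "ennreal (10 ^ 9 / (1/2) ^ k * (LINT u|lebesgue. norm (d k u))) \<le> ennreal (10 ^ 9 / (1/2) ^ k * (1/4) ^ k)"
      using small[of k] by (intro ennreal_leI mult_left_mono) auto
    also have "10 ^ 9 / (1/2) ^ k * (1/4) ^ k = (10 ^ 9 * (1/2) ^ k :: real)"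
    proof -
      have "(1/4::real) ^ k = (1/2) ^ k * (1/2) ^ k" by (simp flip: power_mult_distrib)
      then show ?thesis by simp
    qed
    finally show ?thesis using W(1,2) by blast
  qed
  then obtain W where W: "\<And>k. W k \<in> sets lebesgue" "\<And>k. Tset (d k) ((1/2) ^ k) \<subseteq> W k"
    "\<And>k. emeasure lebesgue (W k) \<le> ennreal (10 ^ 9 * (1/2) ^ k)"
    by metis
  have "AE x in lebesgue. \<forall>\<^sub>F k in sequentially. x \<notin> W k"
    by (rule AE_eventually_notin[OF W(1,3)]) simp
  then show ?thesis
  proof eventually_elim
    case (elim x)
    then show ?case by eventually_elim (use W(2) in blast)
  qed
qed

text \<open>Almost every x is eventually outside the exceptional sets, so all truncations of the
  error \<open>d k\<close> at x are at most 2^-k, while those of \<open>g k\<close> stabilise near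
  height 0. Hence the truncations of f are Cauchy, and the \<open>Lim\<close> in
  \<open>hilbert\<close> is a genuine limit.\<close>

lemma hilbert_tendsto:
  assumes f: "f \<in> L1"
  shows "AE x in lebesgue. ((\<lambda>\<epsilon>. complex_of_real (1 / pi) * kconv (hk \<epsilon>) (ext f) x) \<longlongrightarrow> hilbert f x) (at_right 0)"
proof -
  have "\<forall>k::nat. \<exists>g. g \<in> L1 \<and> (LINT x|M1. norm (f x - g x)) < (1/4) ^ k \<and> (AE x in lebesgue. loc_const (ext g) x)"
    by (intro allI L1_step_approx[OF f]) auto
  then obtain g where g: "\<And>k::nat. g k \<in> L1" "\<And>k. (LINT x|M1. norm (f x - g k x)) < (1/4) ^ k"
    "\<And>k. AE x in lebesgue. loc_const (ext (g k)) x"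
    by metis
  define d where "d k = ext (\<lambda>x. f x - g k x)" for k
  have dk: "d k = (\<lambda>u. ext f u - ext (g k) u)" for k by (simp add: d_def ext_linear)
  have fi: "integrable lebesgue (ext f)" and gi: "integrable lebesgue (ext (g k))" for k
    using f g(1) by (auto simp: L1_iff)
  have di: "integrable lebesgue (d k)" for k unfolding dk using fi gi by simp
  have dn: "(LINT u|lebesgue. norm (d k u)) < (1/4) ^ k" for k
    using g(2)[of k] by (simp add: d_def L1_integral_ext)
  have "AE x in lebesgue. \<forall>\<^sub>F k in sequentially. x \<notin> Tset (d k) ((1/2) ^ k)"
    by (rule AE_eventually_notin_Tset[OF di _ less_imp_le[OF dn]]) (simp add: d_def ext_outside)
  moreover have "AE x in lebesgue. \<forall>k. loc_const (ext (g k)) x"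
    using g(3) by (simp add: AE_all_countable)
  ultimately show ?thesis
  proof eventually_elim
    case (elim x)
    let ?F = "\<lambda>\<epsilon>. complex_of_real (1 / pi) * kconv (hk \<epsilon>) (ext f) x"
    have "\<exists>L. (?F \<longlongrightarrow> L) (at_right 0)"
    proof (rule convergent_at_right_0)
      fix e :: real assume e: "0 < e"
      have "\<forall>\<^sub>F k in sequentially. (1/2::real) ^ k < e / 2"
        using order_tendstoD(2)[OF LIMSEQ_power_zero[of "1/2::real"], of "e / 2"] e by simp
      then have "\<forall>\<^sub>F k in sequentially. (1/2::real) ^ k < e / 2 \<and> x \<notin> Tset (d k) ((1/2) ^ k)"
        using elim(1) by eventually_elim auto
      then obtain k where k: "(1/2::real) ^ k < e / 2" "x \<notin> Tset (d k) ((1/2) ^ k)"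
        by (auto simp: eventually_sequentially)
      obtain \<eta> where \<eta>: "0 < \<eta>" "\<And>u. \<bar>u - x\<bar> < \<eta> \<Longrightarrow> ext (g k) u = ext (g k) x"
        using elim(2) unfolding loc_const_def by blast
      have db: "norm (kconv (hk a) (d k) x) < e / 2" if "0 < a" for a
      proof -
        have "norm (kconv (hk a) (d k) x) \<le> (1/2) ^ k"
        proof (rule ccontr)
          assume "\<not> ?thesis"
          then have "x \<in> Tset (d k) ((1/2) ^ k)" unfolding Tset_def using that by (intro CollectI exI[of _ a]) simp
          then show False using k(2) by blast
        qed
        then show ?thesis using k(1) by linarith
      qed
      have dec: "kconv (hk a) (ext f) x = kconv (hk a) (d k) x + kconv (hk a) (ext (g k)) x" if "0 < a" for a
        using kconv_diff[OF kernel_measurable(3) kernel_bounds(3)[OF that] fi gi, of k x] by (simp add: dk)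
      have "dist (?F a) (?F b) < e" if "0 < a" "a < \<eta>" "0 < b" "b < \<eta>" for a b
      proof -
        have "kconv (hk a) (ext (g k)) x = kconv (hk b) (ext (g k)) x"
          by (rule kconv_hk_loc_const[OF gi \<eta>(2)]) (use that in auto)
        then have "kconv (hk a) (ext f) x - kconv (hk b) (ext f) x = kconv (hk a) (d k) x - kconv (hk b) (d k) x"
          using dec[OF that(1)] dec[OF that(3)] by simp
        also have "norm \<dots> < e"
          using norm_triangle_ineq4[of "kconv (hk a) (d k) x" "kconv (hk b) (d k) x"] db[OF that(1)] db[OF that(3)] by linarith
        finally have "norm (kconv (hk a) (ext f) x - kconv (hk b) (ext f) x) < e" .
        moreover have "?F a - ?F b = complex_of_real (1 / pi) * (kconv (hk a) (ext f) x - kconv (hk b) (ext f) x)"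
          by (simp add: right_diff_distrib)
        then have "dist (?F a) (?F b) = 1 / pi * norm (kconv (hk a) (ext f) x - kconv (hk b) (ext f) x)"
          by (simp add: dist_norm norm_mult norm_divide)
        moreover have "1 / pi \<le> 1" using pi_ge_two by simp
        then have "1 / pi * norm (kconv (hk a) (ext f) x - kconv (hk b) (ext f) x) \<le> 1 * norm (kconv (hk a) (ext f) x - kconv (hk b) (ext f) x)"
          by (intro mult_right_mono) auto
        ultimately show ?thesis by linarith
      qed
      then show "\<exists>\<eta>>0. \<forall>a b. 0 < a \<longrightarrow> a < \<eta> \<longrightarrow> 0 < b \<longrightarrow> b < \<eta> \<longrightarrow> dist (?F a) (?F b) < e"
        using \<eta>(1) by blast
    qed
    then obtain L where L: "(?F \<longlongrightarrow> L) (at_right 0)" by blast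
    then have "hilbert f x = L" unfolding hilbert_eq_kconv by (intro tendsto_Lim) auto
    then show ?case using L by simp
  qed
qed

section \<open>Measurability, linearity and continuity of the transform\<close>

lemma AE_M1I: "AE x in lebesgue. P x \<Longrightarrow> AE x in M1. P x"
  by (subst AE_restrict_space_iff) auto

lemma hilbert_measurable:
  assumes f: "f \<in> L1"
  shows "hilbert f \<in> L0"
proof -
  let ?F = "\<lambda>\<epsilon> x. complex_of_real (1 / pi) * kconv (hk \<epsilon>) (ext f) x"
  have fi: "integrable lebesgue (ext f)" using f by (simp add: L1_iff)
  have Fm: "?F \<epsilon> \<in> borel_measurable lebesgue" if "0 < \<epsilon>" for \<epsilon>
  proof -
    have "continuous_on UNIV (kconv (hk \<epsilon>) (ext f))"
      using isCont_kconv_kernels(3)[OF that fi] by (simp add: continuous_at_imp_continuous_on)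
    then have "kconv (hk \<epsilon>) (ext f) \<in> borel_measurable borel" by (rule borel_measurable_continuous_onI)
    then have "kconv (hk \<epsilon>) (ext f) \<in> borel_measurable lborel" by simp
    then have "kconv (hk \<epsilon>) (ext f) \<in> borel_measurable lebesgue" by (rule measurable_completion)
    then show ?thesis by (intro borel_measurable_times) auto
  qed
  have "AE x in lebesgue. (\<lambda>n. ?F (1 / real (Suc n)) x) \<longlonglongrightarrow> hilbert f x"
    using hilbert_tendsto[OF f]
  proof eventually_elim
    case (elim x)
    have "filterlim (\<lambda>n. 1 / real (Suc n)) (at_right 0) sequentially"
      using LIMSEQ_inverse_real_of_nat by (simp add: filterlim_at inverse_eq_divide)
    from filterlim_compose[OF elim this] show ?case .
  qed
  \<comment> \<open>As a function of x, \<open>lim\<close> along the heights 1/(n+1) is measurable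
    even though it may fail to converge on a null set.\<close>
  then have "AE x in lebesgue. lim (\<lambda>n. ?F (1 / real (Suc n)) x) = hilbert f x"
    by eventually_elim (rule limI)
  moreover have "(\<lambda>x. lim (\<lambda>n. ?F (1 / real (Suc n)) x)) \<in> borel_measurable lebesgue"
    by (intro borel_measurable_lim_metric Fm) auto
  ultimately have "hilbert f \<in> borel_measurable lebesgue" by (rule borel_measurable_AE[rotated])
  then show ?thesis unfolding L0_def by (rule measurable_restrict_space1)
qed

lemma hilbert_Tset:
  assumes f: "f \<in> L1"
  shows "AE x in lebesgue. \<forall>l. l < norm (hilbert f x) \<longrightarrow> x \<in> Tset (ext f) l"
  using hilbert_tendsto[OF f]
proof eventually_elim
  case (elim x)
  show ?case
  proof (intro allI impI)
    fix l assume l: "l < norm (hilbert f x)"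
    have "((\<lambda>\<epsilon>. norm (complex_of_real (1 / pi) * kconv (hk \<epsilon>) (ext f) x)) \<longlongrightarrow> norm (hilbert f x)) (at_right 0)"
      by (intro tendsto_norm elim)
    from order_tendstoD(1)[OF this l]
    have "\<forall>\<^sub>F \<epsilon> in at_right 0. 0 < \<epsilon> \<and> l < norm (complex_of_real (1 / pi) * kconv (hk \<epsilon>) (ext f) x)"
      using eventually_at_right_less[of "0::real"] by eventually_elim auto
    then obtain \<epsilon> where e: "0 < \<epsilon>" "l < norm (complex_of_real (1 / pi) * kconv (hk \<epsilon>) (ext f) x)"
      using eventually_happens trivial_limit_at_right_real by (metis (no_types, lifting))
    have "norm (complex_of_real (1 / pi) * kconv (hk \<epsilon>) (ext f) x) = 1 / pi * norm (kconv (hk \<epsilon>) (ext f) x)"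
      by (simp add: norm_mult norm_divide)
    \<comment> \<open>The factor 1/\<pi> is below 1 and is given away, so that levels of
      \<open>hilbert f\<close> and of the truncations can be compared directly.\<close>
    also have "\<dots> \<le> 1 * norm (kconv (hk \<epsilon>) (ext f) x)"
      using pi_ge_two by (intro mult_right_mono) auto
    finally show "x \<in> Tset (ext f) l" using e by (auto simp: Tset_def)
  qed
qed

text \<open>The exceptional null set is inherent: where a limit fails to exist, \<open>Lim\<close>
  returns an unspecified value.\<close>

lemma hilbert_add:
  assumes "f \<in> L1" "g \<in> L1"
  shows "AE x in lebesgue. hilbert (\<lambda>u. f u + g u) x = hilbert f x + hilbert g x"
proof -
  have fg: "(\<lambda>u. f u + g u) \<in> L1" using assms by (simp add: L1_def)
  have i: "integrable lebesgue (ext f)" "integrable lebesgue (ext g)" using assms by (auto simp: L1_iff)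
  show ?thesis
    using hilbert_tendsto[OF assms(1)] hilbert_tendsto[OF assms(2)]
  proof eventually_elim
    case (elim x)
    let ?F = "\<lambda>f \<epsilon>. complex_of_real (1 / pi) * kconv (hk \<epsilon>) (ext f) x"
    have "((\<lambda>\<epsilon>. ?F f \<epsilon> + ?F g \<epsilon>) \<longlongrightarrow> hilbert f x + hilbert g x) (at_right 0)"
      by (intro tendsto_add elim)
    moreover have "\<forall>\<^sub>F \<epsilon> in at_right 0. ?F f \<epsilon> + ?F g \<epsilon> = ?F (\<lambda>u. f u + g u) \<epsilon>"
      using eventually_at_right_less[of "0::real"]
      by eventually_elim (simp add: ext_linear kconv_add[OF kernel_measurable(3) kernel_bounds(3) i] distrib_left add_divide_distrib)
    ultimately have "(?F (\<lambda>u. f u + g u) \<longlongrightarrow> hilbert f x + hilbert g x) (at_right 0)"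
      by (simp add: tendsto_cong)
    then show ?case unfolding hilbert_eq_kconv[of "\<lambda>u. f u + g u"] by (intro tendsto_Lim) auto
  qed
qed

lemma hilbert_cmult:
  assumes "f \<in> L1"
  shows "AE x in lebesgue. hilbert (\<lambda>u. c * f u) x = c * hilbert f x"
  using hilbert_tendsto[OF assms]
proof eventually_elim
  case (elim x)
  let ?F = "\<lambda>f \<epsilon>. complex_of_real (1 / pi) * kconv (hk \<epsilon>) (ext f) x"
  have "((\<lambda>\<epsilon>. c * ?F f \<epsilon>) \<longlongrightarrow> c * hilbert f x) (at_right 0)"
    by (intro tendsto_mult tendsto_const elim)
  moreover have "(\<lambda>\<epsilon>. c * ?F f \<epsilon>) = ?F (\<lambda>u. c * f u)"
    by (auto simp: fun_eq_iff ext_linear kconv_def simp flip: mult_scaleR_right)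
  ultimately have "(?F (\<lambda>u. c * f u) \<longlongrightarrow> c * hilbert f x) (at_right 0)" by simp
  then show ?case unfolding hilbert_eq_kconv[of "\<lambda>u. c * f u"] by (intro tendsto_Lim) auto
qed

text \<open>Equality holds at every point, because the truncated integrals do not see null sets and
  \<open>hilbert\<close> depends on nothing else.\<close>

lemma hilbert_cong_AE:
  assumes "AE x in M1. f x = g x"
  shows "hilbert f = hilbert g"
proof
  fix t
  have ae: "AE x in lebesgue. ext f x = ext g x"
  proof -
    have "AE x in lebesgue. x \<in> {-1<..<1} \<longrightarrow> f x = g x"
      using assms by (subst (asm) AE_restrict_space_iff) auto
    then show ?thesis by eventually_elim (auto simp: ext_def indicator_def)
  qed
  have "kconv k (ext f) t = kconv k (ext g) t" for k
  proof -
    let ?f = "\<lambda>u. k (u - t) *\<^sub>R ext f u" and ?g = "\<lambda>u. k (u - t) *\<^sub>R ext g u"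
    have e: "AE u in lebesgue. ?f u = ?g u" "AE u in lebesgue. ?g u = ?f u"
      using ae by (eventually_elim, simp)+
    show ?thesis unfolding kconv_def
    proof (cases "?f \<in> borel_measurable lebesgue")
      case True
      then show "integral\<^sup>L lebesgue ?f = integral\<^sup>L lebesgue ?g"
        using e borel_measurable_AE[OF True e(1)] by (intro integral_cong_AE) auto
    next
      \<comment> \<open>Without measurability neither function is integrable, and both integrals
        take the default value 0.\<close>
      case False
      then have ni: "\<not> integrable lebesgue ?f" "\<not> integrable lebesgue ?g"
        using borel_measurable_AE[OF _ e(2)] by auto
      show "integral\<^sup>L lebesgue ?f = integral\<^sup>L lebesgue ?g"
        by (rule trans[OF not_integrable_integral_eq[OF ni(1)] not_integrable_integral_eq[OF ni(2), symmetric]])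
    qed
  qed
  then show "hilbert f t = hilbert g t" unfolding hilbert_eq_kconv by simp
qed

text \<open>The weak type bound yields only convergence in measure; a subsequence with L^1 errors
  below 4^-k converges almost everywhere.\<close>

lemma hilbert_tendsto_L1:
  assumes f: "f \<in> L1" "\<And>k. F k \<in> L1" and lim: "(\<lambda>k. LINT x|M1. norm (F k x - f x)) \<longlonglongrightarrow> 0"
  shows "\<exists>r::nat\<Rightarrow>nat. strict_mono r \<and> (AE x in M1. (\<lambda>k. hilbert (F (r k)) x) \<longlonglongrightarrow> hilbert f x)"
proof -
  \<comment> \<open>Writing the difference with the factor -1 lets \<open>hilbert_add\<close> and
    \<open>hilbert_cmult\<close> split it.\<close>
  define d where "d k = (\<lambda>x. F k x + (-1) * f x)" for k
  have dL: "d k \<in> L1" for k using f by (auto simp: L1_def d_def)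
  have dlim: "(\<lambda>k. LINT x|M1. norm (d k x)) \<longlonglongrightarrow> 0" using lim by (simp add: d_def)
  have "\<exists>r::nat\<Rightarrow>nat. \<forall>n. (LINT x|M1. norm (d (r n) x)) < (1/4) ^ n \<and> r n < r (Suc n)"
  proof (intro dependent_nat_choice)
    have *: "\<exists>m>N. (LINT x|M1. norm (d m x)) < (1/4) ^ n" for N n
    proof -
      have "\<forall>\<^sub>F m in sequentially. (LINT x|M1. norm (d m x)) < (1/4) ^ n"
        by (rule order_tendstoD(2)[OF dlim]) simp
      then have "\<forall>\<^sub>F m in sequentially. N < m \<and> (LINT x|M1. norm (d m x)) < (1/4) ^ n"
        using eventually_gt_at_top[of N] by eventually_elim auto
      then show ?thesis by (auto simp: eventually_sequentially)
    qed
    show "\<exists>m. (LINT x|M1. norm (d m x)) < (1/4) ^ 0" using *[of 0 0] by auto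
    show "\<exists>m'. (LINT x|M1. norm (d m' x)) < (1/4) ^ Suc n \<and> m < m'" for m n using *[of m "Suc n"] by auto
  qed
  then obtain r :: "nat \<Rightarrow> nat" where r: "\<And>n. (LINT x|M1. norm (d (r n) x)) < (1/4) ^ n" "\<And>n. r n < r (Suc n)" by auto
  have mono: "strict_mono r" using r(2) by (simp add: strict_mono_Suc_iff)
  have ei: "integrable lebesgue (ext (d (r k)))" for k using dL by (simp add: L1_iff)
  have "AE x in lebesgue. \<forall>\<^sub>F k in sequentially. x \<notin> Tset (ext (d (r k))) ((1/2) ^ k)"
    by (rule AE_eventually_notin_Tset[OF ei ext_outside]) (simp_all add: L1_integral_ext less_imp_le[OF r(1)])
  moreover have "AE x in lebesgue. \<forall>k l. l < norm (hilbert (d (r k)) x) \<longrightarrow> x \<in> Tset (ext (d (r k))) l"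
    using hilbert_Tset[OF dL] by (simp add: AE_all_countable)
  moreover have "AE x in lebesgue. \<forall>k. hilbert (d (r k)) x = hilbert (F (r k)) x + hilbert (\<lambda>u. (-1) * f u) x"
    unfolding d_def AE_all_countable using f by (intro allI hilbert_add) (auto simp: L1_def)
  moreover have "AE x in lebesgue. hilbert (\<lambda>u. (-1) * f u) x = (-1) * hilbert f x"
    by (rule hilbert_cmult[OF f(1)])
  ultimately have "AE x in lebesgue. (\<lambda>k. hilbert (F (r k)) x) \<longlonglongrightarrow> hilbert f x"
  proof eventually_elim
    case (elim x)
    have "\<forall>\<^sub>F k in sequentially. norm (hilbert (d (r k)) x) \<le> (1/2) ^ k"
      using elim(1)
    proof eventually_elim
      case (elim k)
      then show ?case using \<open>\<forall>k l. l < norm (hilbert (d (r k)) x) \<longrightarrow> x \<in> Tset (ext (d (r k))) l\<close>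
        by (meson not_le)
    qed
    then have "(\<lambda>k. hilbert (d (r k)) x) \<longlonglongrightarrow> 0"
      by (rule Lim_null_comparison) (intro LIMSEQ_power_zero, simp)
    then have "(\<lambda>k. hilbert (d (r k)) x + hilbert f x) \<longlonglongrightarrow> 0 + hilbert f x"
      by (intro tendsto_add tendsto_const)
    then show ?case using elim(3,4) by simp
  qed
  then show ?thesis using mono AE_M1I by blast
qed

section \<open>Rearrangement invariant spaces and dilations\<close>

lemma bfsD:
  assumes "bfs \<rho>"
  shows bfs_zero_iff: "f \<in> L0 \<Longrightarrow> \<rho> f = 0 \<longleftrightarrow> (AE x in M1. f x = 0)"
    and bfs_triangle: "f \<in> L0 \<Longrightarrow> g \<in> L0 \<Longrightarrow> \<rho> (\<lambda>x. f x + g x) \<le> \<rho> f + \<rho> g"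
    and bfs_scale: "f \<in> L0 \<Longrightarrow> \<rho> (\<lambda>x. c * f x) = ennreal (cmod c) * \<rho> f"
    and bfs_ideal: "f \<in> L0 \<Longrightarrow> g \<in> L0 \<Longrightarrow> (AE x in M1. cmod (g x) \<le> cmod (f x)) \<Longrightarrow> \<rho> g \<le> \<rho> f"
    and bfs_fatou: "(\<And>n. F n \<in> L0) \<Longrightarrow> f \<in> L0 \<Longrightarrow>
        (AE x in M1. incseq (\<lambda>n. cmod (F n x)) \<and> (\<lambda>n. cmod (F n x)) \<longlonglongrightarrow> cmod (f x)) \<Longrightarrow>
        (\<lambda>n. \<rho> (F n)) \<longlonglongrightarrow> \<rho> f"
  using assms unfolding bfs_def by blast+

lemma L0_intros:
  "f \<in> L0 \<Longrightarrow> g \<in> L0 \<Longrightarrow> (\<lambda>x. f x + g x) \<in> L0"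
  "f \<in> L0 \<Longrightarrow> g \<in> L0 \<Longrightarrow> (\<lambda>x. f x - g x) \<in> L0"
  "f \<in> L0 \<Longrightarrow> g \<in> L0 \<Longrightarrow> (\<lambda>x. f x * g x) \<in> L0"
  "f \<in> L0 \<Longrightarrow> (\<lambda>x. complex_of_real (cmod (f x))) \<in> L0"
  "(\<lambda>x. c) \<in> L0"
  "A \<in> sets lebesgue \<Longrightarrow> indicator A \<in> L0"
proof -
  show "A \<in> sets lebesgue \<Longrightarrow> indicator A \<in> L0"
    unfolding L0_def by (rule measurable_restrict_space1) (rule borel_measurable_indicator)
qed (auto simp: L0_def)

lemma bfs_cong:
  assumes "bfs \<rho>" "f \<in> L0" "g \<in> L0" "AE x in M1. cmod (f x) = cmod (g x)"
  shows "\<rho> f = \<rho> g"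
proof (rule antisym)
  show "\<rho> f \<le> \<rho> g" using assms(4) by (intro bfs_ideal[OF assms(1,3,2)]) auto
  show "\<rho> g \<le> \<rho> f" using assms(4) by (intro bfs_ideal[OF assms(1,2,3)]) auto
qed

lemma bfs_sum_le:
  assumes \<rho>: "bfs \<rho>" and "finite A" and F: "\<And>i. i \<in> A \<Longrightarrow> F i \<in> L0"
  shows "(\<lambda>x. \<Sum>i\<in>A. F i x) \<in> L0 \<and> \<rho> (\<lambda>x. \<Sum>i\<in>A. F i x) \<le> (\<Sum>i\<in>A. \<rho> (F i))"
  using assms(2) F
proof (induction A)
  case empty
  have "\<rho> (\<lambda>x. 0) = 0" by (subst bfs_zero_iff[OF \<rho> L0_intros(5)]) simp
  then show ?case by (simp add: L0_intros)
next
  case (insert a A)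
  then have IH: "(\<lambda>x. \<Sum>i\<in>A. F i x) \<in> L0" "\<rho> (\<lambda>x. \<Sum>i\<in>A. F i x) \<le> (\<Sum>i\<in>A. \<rho> (F i))" by auto
  have "\<rho> (\<lambda>x. F a x + (\<Sum>i\<in>A. F i x)) \<le> \<rho> (F a) + \<rho> (\<lambda>x. \<Sum>i\<in>A. F i x)"
    using insert IH by (intro bfs_triangle[OF \<rho>]) auto
  also have "\<dots> \<le> \<rho> (F a) + (\<Sum>i\<in>A. \<rho> (F i))" using IH by (intro add_left_mono)
  finally show ?case using insert IH by (simp add: L0_intros)
qed

text \<open>The Fatou property speaks of increasing moduli; the tail infima of |F k| reduce almost
  everywhere convergence to it. It is phrased for any \<rho> with the two properties because it also
  serves \<open>TX_norm\<close> in the proof of its completeness.\<close>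

lemma fatou_liminf_le:
  assumes ideal: "\<And>f g. f \<in> L0 \<Longrightarrow> g \<in> L0 \<Longrightarrow> (AE x in M1. cmod (g x) \<le> cmod (f x)) \<Longrightarrow> \<rho> g \<le> \<rho> f"
    and fatou: "\<And>F f. (\<And>n. F n \<in> L0) \<Longrightarrow> f \<in> L0 \<Longrightarrow>
        (AE x in M1. incseq (\<lambda>n. cmod (F n x)) \<and> (\<lambda>n. cmod (F n x)) \<longlonglongrightarrow> cmod (f x)) \<Longrightarrow>
        (\<lambda>n. \<rho> (F n)) \<longlonglongrightarrow> (\<rho> f :: ennreal)"
    and F: "\<And>n. F n \<in> L0" and f: "f \<in> L0"
    and lim: "AE x in M1. (\<lambda>n. F n x) \<longlonglongrightarrow> f x" and le: "\<And>n. \<rho> (F n) \<le> m"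
  shows "\<rho> f \<le> m"
proof -
  define G where "G n x = complex_of_real (INF k\<in>{n..}. cmod (F k x))" for n x
  have bdd: "bdd_below ((\<lambda>k. cmod (F k x)) ` A)" for A x by (rule bdd_belowI[of _ 0]) auto
  have G: "G n \<in> L0" for n
    unfolding G_def[abs_def] L0_def using F
    by (intro measurable_compose[OF _ borel_measurable_of_real] borel_measurable_cINF bdd borel_measurable_norm) (auto simp: L0_def)
  have nn: "0 \<le> (INF k\<in>{n..}. cmod (F k x))" for n x by (rule cINF_greatest) auto
  have "AE x in M1. incseq (\<lambda>n. cmod (G n x)) \<and> (\<lambda>n. cmod (G n x)) \<longlonglongrightarrow> cmod (f x)"
    using lim
  proof eventually_elim
    case (elim x)
    have cG: "cmod (G n x) = (INF k\<in>{n..}. cmod (F k x))" for n using nn by (simp add: G_def)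
    have inc: "incseq (\<lambda>n. cmod (G n x))"
      unfolding cG by (intro incseq_SucI cINF_superset_mono bdd) auto
    have "(\<lambda>n. cmod (G n x)) \<longlonglongrightarrow> cmod (f x)"
    proof (rule LIMSEQ_I)
      fix e :: real assume e: "0 < e"
      have "(\<lambda>n. cmod (F n x)) \<longlonglongrightarrow> cmod (f x)" by (intro tendsto_norm elim)
      from LIMSEQ_D[OF this half_gt_zero[OF e]] obtain N where N: "\<And>n. n \<ge> N \<Longrightarrow> \<bar>cmod (F n x) - cmod (f x)\<bar> < e / 2"
        by auto
      have "norm (cmod (G n x) - cmod (f x)) < e" if n: "n \<ge> N" for n
      proof -
        have "cmod (f x) - e / 2 \<le> cmod (G n x)"
          unfolding cG
        proof (rule cINF_greatest)
          fix k assume "k \<in> {n..}"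
          then have "\<bar>cmod (F k x) - cmod (f x)\<bar> < e / 2" using n by (intro N) simp
          then show "cmod (f x) - e / 2 \<le> cmod (F k x)" by linarith
        qed simp
        moreover have "cmod (G n x) \<le> cmod (F n x)"
          unfolding cG by (intro cINF_lower bdd) auto
        ultimately show ?thesis using N[OF n] e unfolding real_norm_def by linarith
      qed
      then show "\<exists>N. \<forall>n\<ge>N. norm (cmod (G n x) - cmod (f x)) < e" by blast
    qed
    with inc show ?case by simp
  qed
  then have "(\<lambda>n. \<rho> (G n)) \<longlonglongrightarrow> \<rho> f" by (intro fatou G f)
  moreover have "\<rho> (G n) \<le> m" for n
  proof -
    have "\<rho> (G n) \<le> \<rho> (F n)"
    proof (rule ideal[OF F G], rule AE_I2)
      fix x
      have "(INF k\<in>{n..}. cmod (F k x)) \<le> cmod (F n x)" by (intro cINF_lower bdd) auto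
      then show "cmod (G n x) \<le> cmod (F n x)" using nn by (simp add: G_def)
    qed
    then show ?thesis using le order_trans by blast
  qed
  ultimately show ?thesis by (intro tendsto_upperbound[of _ _ sequentially]) auto
qed

lemma bfs_liminf_le:
  assumes \<rho>: "bfs \<rho>" and F: "\<And>n. F n \<in> L0" and f: "f \<in> L0"
    and lim: "AE x in M1. (\<lambda>n. F n x) \<longlonglongrightarrow> f x" and le: "\<And>n. \<rho> (F n) \<le> m"
  shows "\<rho> f \<le> m"
proof (rule fatou_liminf_le[where \<rho>=\<rho> and F=F and f=f])
  show "\<rho> g \<le> \<rho> f" if "f \<in> L0" "g \<in> L0" "AE x in M1. cmod (g x) \<le> cmod (f x)" for f g
    using that by (rule bfs_ideal[OF \<rho>])
  show "(\<lambda>n. \<rho> (F n)) \<longlonglongrightarrow> \<rho> f" if "\<And>n. F n \<in> L0" "f \<in> L0"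
    "AE x in M1. incseq (\<lambda>n. cmod (F n x)) \<and> (\<lambda>n. cmod (F n x)) \<longlonglongrightarrow> cmod (f x)" for F f
    using that by (rule bfs_fatou[OF \<rho>])
qed (use F f lim le in auto)

lemma bfs_indicator_pos:
  assumes \<rho>: "bfs \<rho>" and ab: "-1 \<le> a" "a < b" "b \<le> 1"
  obtains p :: real where "0 < p" "ennreal p \<le> \<rho> (indicator {a<..<b})"
proof
  let ?A = "{a<..<b}"
  have AL: "(indicator ?A :: real \<Rightarrow> complex) \<in> L0" by (intro L0_intros(6)) auto
  have pos: "\<rho> (indicator ?A) \<noteq> 0"
  proof
    assume "\<rho> (indicator ?A) = 0"
    then have "AE x in M1. indicator ?A x = (0::complex)" using bfs_zero_iff[OF \<rho> AL] by simp
    then have "AE x in lebesgue. x \<in> {-1<..<1} \<longrightarrow> indicator ?A x = (0::complex)"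
      by (subst (asm) AE_restrict_space_iff) auto
    then have "AE x in lebesgue. x \<notin> ?A"
      by eventually_elim (use ab in \<open>auto simp: indicator_def split: if_splits\<close>)
    then have "?A \<in> null_sets lebesgue" by (subst AE_iff_null_sets) auto
    then have "emeasure lebesgue ?A = 0" by (rule null_setsD1)
    then show False using ab by simp
  qed
  \<comment> \<open>The norm of the indicator may be infinite, so it is capped at 1 before
    conversion to a real number.\<close>
  let ?p = "enn2real (min 1 (\<rho> (indicator ?A)))"
  have "min 1 (\<rho> (indicator ?A)) < top" by (rule le_less_trans[OF min.cobounded1]) simp
  moreover have "0 < min 1 (\<rho> (indicator ?A))" using pos by (simp add: min_def zero_less_iff_neq_zero)
  ultimately have "ennreal ?p = min 1 (\<rho> (indicator ?A))" "0 < ?p"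
    by (simp_all only: ennreal_enn2real enn2real_positive_iff)
  then show "0 < ?p" "ennreal ?p \<le> \<rho> (indicator ?A)" by simp_all
qed

section \<open>Comparison of norms through distribution functions\<close>

lemma ri_bfs: "ri_space \<rho> \<Longrightarrow> bfs \<rho>"
  by (simp add: ri_space_def)

text \<open>A smaller distribution function enlarges the set of levels whose infimum is the
  rearrangement. Infinite norm of f is included, so the lemma applies before finiteness is
  known.\<close>

lemma ri_distr_le:
  assumes \<rho>: "ri_space \<rho>" and f: "f \<in> L0" and g: "g \<in> L0"
    and le: "\<And>s. 0 \<le> s \<Longrightarrow> distr_fun g s \<le> distr_fun f s"
  shows "\<rho> g \<le> \<rho> f"
proof (cases "\<rho> f < \<infinity>")
  case True
  then have "f \<in> bfs_space \<rho>" using f by (simp add: bfs_space_def)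
  moreover have "rearr g t \<le> rearr f t" for t
    unfolding rearr_def using le by (intro Inf_superset_mono) (auto intro: order_trans)
  ultimately show ?thesis using \<rho> g unfolding ri_space_def by blast
qed (simp add: less_top[symmetric])

lemma distr_fun_lebesgue: "distr_fun f s = emeasure lebesgue {x. -1 < x \<and> x < 1 \<and> s < cmod (f x)}"
proof -
  have "distr_fun f s = emeasure lebesgue {x \<in> space M1. s < cmod (f x)}"
    unfolding distr_fun_def by (intro emeasure_restrict_space) (auto simp: space_restrict_space)
  also have "{x \<in> space M1. s < cmod (f x)} = {x. -1 < x \<and> x < 1 \<and> s < cmod (f x)}"
    by (auto simp: space_restrict_space)
  finally show ?thesis .
qed

lemma sets_level:
  assumes "f \<in> L0"
  shows "{x. -1 < x \<and> x < 1 \<and> s < cmod (f x)} \<in> sets lebesgue"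
proof -
  have [measurable]: "f \<in> borel_measurable M1" using assms by (simp add: L0_def)
  have "{x \<in> space M1. s < cmod (f x)} \<in> sets M1" by measurable
  then have "{x \<in> space M1. s < cmod (f x)} \<in> sets lebesgue"
    using sets_restrict_space_iff[of "{-1<..<1::real}" lebesgue] by simp
  also have "{x \<in> space M1. s < cmod (f x)} = {x. -1 < x \<and> x < 1 \<and> s < cmod (f x)}"
    by (auto simp: space_restrict_space)
  finally show ?thesis .
qed

section \<open>Dilations and their norms\<close>

lemma affine_lebesgue_measurable: "c \<noteq> 0 \<Longrightarrow> (\<lambda>x::real. t + c * x) \<in> lebesgue \<rightarrow>\<^sub>M lebesgue"
  using lebesgue_affine_measurable[of "\<lambda>_. c" t] by simp

lemma emeasure_affine_image:
  fixes S :: "real set"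
  shows "emeasure lebesgue ((\<lambda>x. t + c * x) ` S) = ennreal \<bar>c\<bar> * emeasure lebesgue S"
  using emeasure_lebesgue_affine[of c t S] by (simp add: add.commute)

lemma L0_affine:
  assumes f: "f \<in> L0" and c: "c \<noteq> 0"
  shows "(\<lambda>x. indicator {-1<..<1} (t + c * x) *\<^sub>R f (t + c * x)) \<in> L0"
proof -
  have "ext f \<in> borel_measurable lebesgue"
    using f unfolding L0_def ext_def[abs_def] by (subst (asm) borel_measurable_restrict_space_iff) auto
  from measurable_compose[OF affine_lebesgue_measurable[OF c, of t] this]
  have "(\<lambda>x. ext f (t + c * x)) \<in> borel_measurable lebesgue" .
  then show ?thesis unfolding L0_def ext_def by (rule measurable_restrict_space1)
qed

lemma AE_M1_notin: "finite D \<Longrightarrow> AE x in M1. x \<notin> D"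
  by (intro AE_M1I AE_not_in) (auto simp: negligible_iff_null_sets[symmetric] intro!: negligible_finite)

lemma M1_borel_AE:
  fixes f g :: "real \<Rightarrow> complex"
  assumes f: "f \<in> L0" and ae: "AE x in M1. f x = g x"
  shows "g \<in> L0"
proof -
  have "ext f \<in> borel_measurable lebesgue"
    using f unfolding L0_def ext_def[abs_def] by (subst (asm) borel_measurable_restrict_space_iff) auto
  moreover have "AE x in lebesgue. ext f x = ext g x"
  proof -
    have "AE x in lebesgue. x \<in> {-1<..<1} \<longrightarrow> f x = g x"
      using ae by (subst (asm) AE_restrict_space_iff) auto
    then show ?thesis by eventually_elim (auto simp: ext_def indicator_def)
  qed
  ultimately have "ext g \<in> borel_measurable lebesgue" by (rule borel_measurable_AE)
  then show ?thesis unfolding L0_def ext_def[abs_def] by (subst borel_measurable_restrict_space_iff) auto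
qed

lemma dil_AE:
  assumes "0 < a"
  shows "AE x in M1. dil a f x = indicator {-1<..<1} (0 + a * x) *\<^sub>R f (0 + a * x)"
proof -
  \<comment> \<open>\<open>dil\<close> cuts off at the closed interval while the space lives on the
    open one; the two versions differ only at these points.\<close>
  have "finite {1/a, -1/a}" by simp
  from AE_M1_notin[OF this] show ?thesis
  proof eventually_elim
  case (elim x)
  then have "x * a \<noteq> 1" "x * a \<noteq> -1" using assms by (auto simp: field_simps)
  then show ?case by (auto simp: dil_def indicator_def mult.commute[of a] abs_if split: if_splits)
  qed
qed

lemma dil_L0:
  assumes "f \<in> L0" "0 < a"
  shows "dil a f \<in> L0"
proof (rule M1_borel_AE[OF L0_affine[OF assms(1), of a 0]])
  show "a \<noteq> 0" using assms(2) by simp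
  show "AE x in M1. indicator {-1<..<1} (0 + a * x) *\<^sub>R f (0 + a * x) = dil a f x"
    using dil_AE[OF assms(2), of f] by eventually_elim (rule sym)
qed

text \<open>Scaling by a carries the level set of the dilation into the part of that of f inside
  (-a, a). For a = 1/n it is this central part that \<open>dil_inverse_nat_le\<close> distributes
  over n cells.\<close>

lemma distr_dil_le:
  assumes f: "f \<in> L0" and a: "0 < a" and s: "0 \<le> s"
  shows "ennreal a * distr_fun (dil a f) s \<le> emeasure lebesgue {y. -1 < y \<and> y < 1 \<and> -a < y \<and> y < a \<and> s < cmod (f y)}"
proof -
  let ?S = "{x. -1 < x \<and> x < 1 \<and> s < cmod (dil a f x)}"
  let ?T = "{y. -1 < y \<and> y < 1 \<and> -a < y \<and> y < a \<and> s < cmod (f y)}"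
  \<comment> \<open>The closed cut-off in \<open>dil\<close> can reach the points -1 and 1, which
    form a null set.\<close>
  have ends: "{-1, 1::real} \<in> sets lebesgue" using finite_imp_closed[of "{-1, 1::real}"] by simp
  have T: "?T \<in> sets lebesgue"
  proof -
    have "?T = {y. -1 < y \<and> y < 1 \<and> s < cmod (f y)} \<inter> {-a<..<a}" by auto
    also have "\<dots> \<in> sets lebesgue" using sets_level[OF f] by (intro sets.Int) auto
    finally show ?thesis .
  qed
  have "ennreal a * distr_fun (dil a f) s = emeasure lebesgue ((\<lambda>x. 0 + a * x) ` ?S)"
    using a by (simp only: distr_fun_lebesgue emeasure_affine_image) simp
  also have "\<dots> \<le> emeasure lebesgue (?T \<union> {-1, 1})"
  proof (intro emeasure_mono)
    show "(\<lambda>x. 0 + a * x) ` ?S \<subseteq> ?T \<union> {-1, 1}"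
    proof
      fix y assume "y \<in> (\<lambda>x. 0 + a * x) ` ?S"
      then obtain x where x: "-1 < x" "x < 1" "s < cmod (dil a f x)" "y = a * x" by auto
      then have "\<bar>x * a\<bar> \<le> 1" "s < cmod (f y)" using s by (auto simp: dil_def mult.commute split: if_splits)
      moreover have "a * -1 < a * x" "a * x < a * 1" using a x by (intro mult_strict_left_mono; simp)+
      ultimately show "y \<in> ?T \<union> {-1, 1}" using x(4) by (auto simp: mult.commute[of x])
    qed
    show "?T \<union> {-1, 1} \<in> sets lebesgue" by (intro sets.Un T ends)
  qed
  also have "\<dots> \<le> emeasure lebesgue ?T + emeasure lebesgue {-1, 1::real}"
    by (intro emeasure_subadditive T ends)
  also have "emeasure lebesgue {-1, 1::real} = 0"
    by (rule null_setsD1) (simp only: negligible_iff_null_sets[symmetric] negligible_finite finite.intros)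
  finally show ?thesis by (simp only: add_0_right)
qed

lemma dil_ge1_le:
  assumes \<rho>: "ri_space \<rho>" and f: "f \<in> L0" and a: "1 \<le> a"
  shows "\<rho> (dil a f) \<le> \<rho> f"
proof (rule ri_distr_le[OF \<rho> f dil_L0[OF f]])
  show "0 < a" using a by simp
  fix s :: real assume s: "0 \<le> s"
  have "distr_fun (dil a f) s \<le> ennreal a * distr_fun (dil a f) s"
    using mult_right_mono[of 1 "ennreal a" "distr_fun (dil a f) s"] a by simp
  also have "\<dots> \<le> emeasure lebesgue {y. -1 < y \<and> y < 1 \<and> -a < y \<and> y < a \<and> s < cmod (f y)}"
    using a s by (intro distr_dil_le f) auto
  also have "\<dots> \<le> distr_fun f s"
    unfolding distr_fun_lebesgue by (intro emeasure_mono sets_level f) auto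
  finally show "distr_fun (dil a f) s \<le> distr_fun f s" .
qed

text \<open>The translates of \<open>f\<close>, restricted to \<open>(-1/n, 1/n)\<close>, into the \<open>n\<close> cells of a partition of the interval add up
  to a function equimeasurable with the dilation.\<close>

lemma dil_inverse_nat_le:
  assumes \<rho>: "ri_space \<rho>" and f: "f \<in> L0" and n: "0 < n"
  shows "\<rho> (dil (1 / real n) f) \<le> ennreal (real n) * \<rho> f"
proof -
  note b = ri_bfs[OF \<rho>]
  \<comment> \<open>The centre of the i-th of n cells of length 2/n.\<close>
  define c where "c i = -1 + (2 * real i + 1) / real n" for i
  define J where "J i = {c i - 1 / real n <..< c i + 1 / real n}" for i
  define g where "g i x = indicator (J i) x *\<^sub>R (indicator {-1<..<1} (- c i + 1 * x) *\<^sub>R f (- c i + 1 * x))" for i x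
  have aux: "d \<le> ennreal (real n) * e" if "ennreal (1 / real n) * d \<le> e" for d e
  proof -
    have "ennreal (real n) * (ennreal (1 / real n) * d) \<le> ennreal (real n) * e"
      using that by (rule mult_left_mono) simp
    then show ?thesis using n by (simp add: mult.assoc[symmetric] ennreal_mult[symmetric])
  qed
  have gf: "g i x = (if x \<in> J i \<and> - c i + x \<in> {-1<..<1} then f (- c i + x) else 0)" for i x
    by (auto simp: g_def)
  have nn: "1 / real n \<le> 1" using n by simp
  have Jsub: "J i \<subseteq> {-1<..<1}" if "i < n" for i
  proof -
    have "2 * real i + 2 \<le> 2 * real n" using that by linarith
    then have "(2 * real i + 1) / real n + 1 / real n \<le> 2" using n by (simp add: add_divide_distrib[symmetric] pos_divide_le_eq)
    moreover have "0 \<le> (2 * real i + 1) / real n - 1 / real n" using n by (simp add: diff_divide_distrib[symmetric])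
    ultimately show ?thesis by (auto simp: J_def c_def)
  qed
  have Jdisj: "J i \<inter> J j = {}" if "i \<noteq> j" for i j
  proof -
    have *: "c i + 1 / real n \<le> c j - 1 / real n" if "i < j" for i j
    proof -
      have "2 * real i + 2 \<le> 2 * real j" using that by linarith
      then have "(2 * real i + 2) / real n \<le> (2 * real j) / real n" by (intro divide_right_mono) auto
      then show ?thesis by (simp add: c_def add_divide_distrib)
    qed
    show ?thesis
    proof (rule equals0I)
      fix x assume "x \<in> J i \<inter> J j"
      then have "c i - 1 / real n < x" "x < c i + 1 / real n" "c j - 1 / real n < x" "x < c j + 1 / real n"
        by (auto simp: J_def)
      then show False using that *[of i j] *[of j i] by (cases i j rule: linorder_cases) linarith+
    qed
  qed
  have gL: "g i \<in> L0" for i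
  proof -
    have "(\<lambda>x. complex_of_real (indicator (J i) x) * (indicator {-1<..<1} (- c i + 1 * x) *\<^sub>R f (- c i + 1 * x))) \<in> L0"
      unfolding L0_def using L0_affine[OF f, of 1 "- c i"]
      
      by (intro borel_measurable_times measurable_compose[OF _ borel_measurable_of_real]
          measurable_restrict_space1[OF borel_measurable_indicator]) (auto simp: L0_def J_def)
    then show ?thesis by (simp add: g_def[abs_def] scaleR_conv_of_real)
  qed
  let ?T = "\<lambda>s. {y. -1 < y \<and> y < 1 \<and> -(1 / real n) < y \<and> y < 1 / real n \<and> s < cmod (f y)}"
  have T: "?T s \<in> sets lebesgue" for s
  proof -
    have "?T s = {y. -1 < y \<and> y < 1 \<and> s < cmod (f y)} \<inter> {-(1 / real n)<..<1 / real n}" by auto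
    also have "\<dots> \<in> sets lebesgue" using sets_level[OF f] by (intro sets.Int) auto
    finally show ?thesis .
  qed
  have gi: "{x. s < cmod (g i x)} = (\<lambda>x. c i + 1 * x) ` ?T s" if "0 \<le> s" for s i
  proof (intro set_eqI iffI)
    fix x assume "x \<in> {x. s < cmod (g i x)}"
    then have "x \<in> J i" "- c i + x \<in> {-1<..<1}" "s < cmod (f (- c i + x))"
      using that by (auto simp: gf split: if_splits)
    then show "x \<in> (\<lambda>x. c i + 1 * x) ` ?T s"
      by (intro image_eqI[of _ _ "- c i + x"]) (auto simp: J_def)
  next
    fix x assume "x \<in> (\<lambda>x. c i + 1 * x) ` ?T s"
    then show "x \<in> {x. s < cmod (g i x)}" using nn by (auto simp: gf J_def)
  qed
  have em: "emeasure lebesgue {x. s < cmod (g i x)} = emeasure lebesgue (?T s)" if "0 \<le> s" for s i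
    using emeasure_affine_image[of "c i" 1 "?T s"] by (simp only: gi[OF that] abs_one ennreal_1 mult_1)
  have sm: "{x. s < cmod (g i x)} \<in> sets lebesgue" if "0 \<le> s" "i < n" for s i
  proof -
    have "{x. s < cmod (g i x)} = {x. -1 < x \<and> x < 1 \<and> s < cmod (g i x)}"
      using Jsub[OF that(2)] that(1) by (auto simp: gf split: if_splits)
    then show ?thesis using sets_level[OF gL, of s i] by simp
  qed
  have gle: "\<rho> (g i) \<le> \<rho> f" if "i < n" for i
  proof (rule ri_distr_le[OF \<rho> f gL])
    fix s :: real assume s: "0 \<le> s"
    have "distr_fun (g i) s \<le> emeasure lebesgue {x. s < cmod (g i x)}"
      unfolding distr_fun_lebesgue using sm[OF s that] by (intro emeasure_mono) auto
    also have "\<dots> \<le> distr_fun f s"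
      unfolding em[OF s] distr_fun_lebesgue by (intro emeasure_mono sets_level f) auto
    finally show "distr_fun (g i) s \<le> distr_fun f s" .
  qed
  let ?G = "\<lambda>x. \<Sum>i<n. g i x"
  have G: "?G \<in> L0" "\<rho> ?G \<le> (\<Sum>i<n. \<rho> (g i))" using bfs_sum_le[OF b, of "{..<n}" g] gL by auto
  have "\<rho> (dil (1 / real n) f) \<le> \<rho> ?G"
  proof (rule ri_distr_le[OF \<rho> G(1) dil_L0[OF f]])
    fix s :: real assume s: "0 \<le> s"
    have "ennreal (1 / real n) * distr_fun (dil (1 / real n) f) s \<le> emeasure lebesgue (?T s)"
      using n by (intro distr_dil_le[OF f _ s]) simp
    then have "distr_fun (dil (1 / real n) f) s \<le> ennreal (real n) * emeasure lebesgue (?T s)"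
      by (rule aux)
    also have "\<dots> = (\<Sum>i<n. emeasure lebesgue {x. s < cmod (g i x)})"
      by (simp only: em[OF s] sum_constant card_lessThan ennreal_of_nat_eq_real_of_nat)
    also have "\<dots> = emeasure lebesgue (\<Union>i<n. {x. s < cmod (g i x)})"
    proof (intro sum_emeasure)
      show "disjoint_family_on (\<lambda>i. {x. s < cmod (g i x)}) {..<n}"
        unfolding disjoint_family_on_def
      proof (intro ballI impI equals0I)
        fix i j x assume ij: "i \<noteq> j" and x: "x \<in> {x. s < cmod (g i x)} \<inter> {x. s < cmod (g j x)}"
        then have "x \<in> J i" "x \<in> J j" using s by (auto simp: gf split: if_splits)
        then show False using Jdisj[OF ij] by auto
      qed
    qed (use sm[OF s] in auto)
    also have "\<dots> \<le> distr_fun ?G s"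
      unfolding distr_fun_lebesgue
    proof (intro emeasure_mono sets_level G subsetI)
      fix x assume "x \<in> (\<Union>i<n. {x. s < cmod (g i x)})"
      then obtain i where i: "i < n" "s < cmod (g i x)" by auto
      then have xJ: "x \<in> J i" using s by (auto simp: gf split: if_splits)
      have "g j x = 0" if "j \<noteq> i" for j using Jdisj[OF that] xJ by (auto simp: gf)
      then have "?G x = g i x" using i(1) by (subst sum.remove[where x=i]) (auto intro!: sum.neutral)
      then show "x \<in> {x. -1 < x \<and> x < 1 \<and> s < cmod (\<Sum>i<n. g i x)}" using i xJ Jsub[OF i(1)] by auto
    qed
    finally show "distr_fun (dil (1 / real n) f) s \<le> distr_fun ?G s" .
  qed (use n in auto)
  also note G(2)
  also have "(\<Sum>i<n. \<rho> (g i)) \<le> (\<Sum>i<n. \<rho> f)" using gle by (intro sum_mono) auto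
  also have "\<dots> = ennreal (real n) * \<rho> f" by (simp add: ennreal_of_nat_eq_real_of_nat)
  finally show ?thesis .
qed

lemma dil_dil_le1: "a \<le> 1 \<Longrightarrow> 0 < a \<Longrightarrow> \<bar>x\<bar> \<le> 1 \<Longrightarrow> dil a (dil b f) x = dil (a * b) f x"
proof -
  assume a: "a \<le> 1" "0 < a" "\<bar>x\<bar> \<le> 1"
  then have "\<bar>x * a\<bar> \<le> 1" using mult_mono[of "\<bar>x\<bar>" 1 a 1] by (simp add: abs_mult)
  then show ?thesis by (simp add: dil_def mult.assoc)
qed

text \<open>Dilation by a is dilation by n a \<ge> 1, of norm at most 1, followed by dilation by
  1/n, of norm at most n. In this order the second cut-off removes nothing.\<close>

lemma dil_le_nat:
  assumes \<rho>: "ri_space \<rho>" and f: "f \<in> L0" and n: "0 < n" and a: "1 / real n \<le> a"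
  shows "\<rho> (dil a f) \<le> ennreal (real n) * \<rho> f"
proof -
  note b = ri_bfs[OF \<rho>]
  have na: "1 \<le> real n * a" using a n by (simp add: field_simps)
  then have a0: "0 < a" using n by (smt (verit) mult_nonneg_nonpos of_nat_0_le_iff)
  have h: "dil (real n * a) f \<in> L0" using f na by (intro dil_L0) auto
  have "\<rho> (dil a f) = \<rho> (dil (1 / real n) (dil (real n * a) f))"
  proof (rule bfs_cong[OF b dil_L0[OF f a0] dil_L0[OF h]])
    show "AE x in M1. cmod (dil a f x) = cmod (dil (1 / real n) (dil (real n * a) f) x)"
      using n by (intro AE_I2) (simp add: space_restrict_space dil_dil_le1 abs_le_iff)
  qed (use n in auto)
  also have "\<dots> \<le> ennreal (real n) * \<rho> (dil (real n * a) f)"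
    by (rule dil_inverse_nat_le[OF \<rho> h n])
  also have "\<dots> \<le> ennreal (real n) * \<rho> f"
    by (intro mult_left_mono dil_ge1_le[OF \<rho> f na]) auto
  finally show ?thesis .
qed

text \<open>The Boyd indices are formed from \<open>enn2real\<close> of this norm, which would send
  infinity to 0; finiteness makes the logarithms mean what they should.\<close>

lemma dil_norm_finite:
  assumes \<rho>: "ri_space \<rho>" and a: "0 < a"
  shows "dil_norm \<rho> a < \<infinity>"
proof -
  obtain n :: nat where n: "0 < n" "1 / real n \<le> a"
    using a by (metis less_imp_le nat_approx_posE of_nat_Suc zero_less_Suc)
  have "dil_norm \<rho> a \<le> ennreal (real n)"
    unfolding dil_norm_def
  proof (rule Sup_least, clarify)
    fix f assume f: "f \<in> bfs_space \<rho>" "\<rho> f \<le> 1"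
    then have "\<rho> (dil a f) \<le> ennreal (real n) * \<rho> f"
      by (intro dil_le_nat \<rho> n) (auto simp: bfs_space_def)
    also have "\<dots> \<le> ennreal (real n) * 1" using f by (intro mult_left_mono) auto
    finally show "\<rho> (dil a f) \<le> ennreal (real n)" by simp
  qed
  also have "\<dots> < \<infinity>" by simp
  finally show ?thesis .
qed

lemma dil_le_dil_norm:
  assumes \<rho>: "ri_space \<rho>" and a: "0 < a" and f: "f \<in> L0" and fin: "\<rho> f < \<infinity>"
  shows "\<rho> (dil a f) \<le> dil_norm \<rho> a * \<rho> f"
proof -
  note b = ri_bfs[OF \<rho>]
  consider "\<rho> f = 0" | r where "0 < r" "\<rho> f = ennreal r"
    using fin by (cases "\<rho> f") (auto simp: less_le)
  then show ?thesis
  proof cases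
    case 1
    obtain n :: nat where n: "0 < n" "1 / real n \<le> a"
      using a by (metis less_imp_le nat_approx_posE of_nat_Suc zero_less_Suc)
    from dil_le_nat[OF \<rho> f n] 1 show ?thesis by simp
  next
    case 2
    define g where "g = (\<lambda>x. complex_of_real (1 / r) * f x)"
    have g: "g \<in> L0" unfolding g_def by (intro L0_intros f)
    have "\<rho> g = ennreal (1 / r) * ennreal r" unfolding g_def bfs_scale[OF b f] 2(2) using 2(1) by (simp add: norm_divide)
    also have "\<dots> = 1" using 2(1) by (simp add: ennreal_mult[symmetric])
    finally have "\<rho> g = 1" .
    then have "\<rho> (dil a g) \<le> dil_norm \<rho> a"
      unfolding dil_norm_def using g by (intro Sup_upper) (auto simp: bfs_space_def)
    moreover have "dil a g = (\<lambda>x. complex_of_real (1 / r) * dil a f x)"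
      by (auto simp: dil_def g_def fun_eq_iff)
    then have "\<rho> (dil a g) = ennreal (1 / r) * \<rho> (dil a f)"
      using 2(1) by (simp only: bfs_scale[OF b dil_L0[OF f a]]) (simp add: norm_divide)
    ultimately have "ennreal r * (ennreal (1 / r) * \<rho> (dil a f)) \<le> ennreal r * dil_norm \<rho> a"
      by (intro mult_left_mono) auto
    then show ?thesis using 2 by (simp add: mult.assoc[symmetric] ennreal_mult[symmetric] mult.commute)
  qed
qed

text \<open>A positive supremum yields one t < 1 with positive quotient; as ln t < 0, dilation by q
  = 1/t has norm below 1. The powers of this single dilation give geometric decay.\<close>

lemma boyd_lower_pos:
  assumes \<rho>: "ri_space \<rho>" and pos: "0 < boyd_lower \<rho>"
  obtains q \<theta> :: real where "1 < q" "0 \<le> \<theta>" "\<theta> < 1" "dil_norm \<rho> q \<le> ennreal \<theta>"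
proof -
  let ?S = "{ln (enn2real (dil_norm \<rho> (1 / t))) / ln t | t. 0 < t \<and> t < 1}"
  have "\<exists>y\<in>?S. 0 < y"
  proof (rule ccontr)
    assume "\<not> ?thesis"
    then have "y \<le> 0" if "y \<in> ?S" for y using that by (meson not_less)
    moreover have "?S \<noteq> {}" by (auto intro: exI[of _ "1/2"])
    ultimately have "Sup ?S \<le> 0" by (intro cSup_least)
    then show False using pos by (simp add: boyd_lower_def)
  qed
  then obtain t where t: "0 < t" "t < 1" "0 < ln (enn2real (dil_norm \<rho> (1 / t))) / ln t" by auto
  let ?N = "enn2real (dil_norm \<rho> (1 / t))"
  have "ln t < 0" using t by simp
  then have lnN: "ln ?N < 0" using t(3) by (simp add: zero_less_divide_iff)
  \<comment> \<open>By the convention ln 0 = 0, a negative logarithm excludes the value 0.\<close>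
  have "0 < ?N" using lnN by (metis enn2real_nonneg less_le ln_0 less_irrefl)
  then have "?N < 1" using lnN by simp
  moreover have "dil_norm \<rho> (1 / t) < \<infinity>" using t by (intro dil_norm_finite \<rho>) auto
  then have "dil_norm \<rho> (1 / t) \<le> ennreal ?N" by simp
  ultimately show ?thesis using that[of "1 / t" ?N] t by simp
qed

text \<open>Dually, the infimum yields B > 1 such that dilation by 1/B has norm below B; a weight
  1/B per step then outweighs the dilation.\<close>

lemma boyd_upper_less_1:
  assumes \<rho>: "ri_space \<rho>" and less: "boyd_upper \<rho> < 1"
  obtains B \<theta> :: real where "1 < B" "0 \<le> \<theta>" "\<theta> < B" "dil_norm \<rho> (1 / B) \<le> ennreal \<theta>"
proof -
  let ?S = "{ln (enn2real (dil_norm \<rho> (1 / t))) / ln t | t. 1 < t}"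
  have "\<exists>y\<in>?S. y < 1"
  proof (rule ccontr)
    assume "\<not> ?thesis"
    then have "1 \<le> y" if "y \<in> ?S" for y using that by (meson not_less)
    moreover have "?S \<noteq> {}" by (auto intro: exI[of _ 2])
    ultimately have "1 \<le> Inf ?S" by (intro cInf_greatest)
    then show False using less by (simp add: boyd_upper_def)
  qed
  then obtain t where t: "1 < t" "ln (enn2real (dil_norm \<rho> (1 / t))) / ln t < 1" by auto
  let ?N = "enn2real (dil_norm \<rho> (1 / t))"
  have "ln ?N < ln t" using t by (simp add: pos_divide_less_eq)
  then have "?N < t" using t(1) by (cases "?N = 0") (auto simp: less_le)
  moreover have "dil_norm \<rho> (1 / t) < \<infinity>" using t by (intro dil_norm_finite \<rho>) auto
  then have "dil_norm \<rho> (1 / t) \<le> ennreal ?N" by simp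
  ultimately show ?thesis using that[of t ?N] t by simp
qed

section \<open>Decreasing rearrangements\<close>

text \<open>For \<open>t \<le> 0\<close> the infimum may be over the empty set; only positive arguments are used.\<close>

definition dec_rearr :: "(real \<Rightarrow> complex) \<Rightarrow> real \<Rightarrow> real" where
  "dec_rearr f t = Inf {s. 0 \<le> s \<and> distr_fun f s \<le> ennreal t}"

text \<open>The even function on \<open>(-1, 1)\<close> whose decreasing rearrangement is \<open>g\<close>; being even, it is compatible with
  dilations about the origin. The value at \<open>0\<close>, where \<open>g\<close> may blow up, is immaterial.\<close>

definition even_fun :: "(real \<Rightarrow> real) \<Rightarrow> real \<Rightarrow> complex" where
  "even_fun g s = complex_of_real (if s = 0 then 0 else g (2 * \<bar>s\<bar>))"

section \<open>Distribution functions and rearrangements\<close>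

lemma distr_fun_mono: "f \<in> L0 \<Longrightarrow> s \<le> s' \<Longrightarrow> distr_fun f s' \<le> distr_fun f s"
  unfolding distr_fun_lebesgue by (intro emeasure_mono sets_level) auto

lemma distr_fun_le_2: "distr_fun f s \<le> 2"
proof -
  have "distr_fun f s \<le> emeasure lebesgue {-1<..<1::real}"
    unfolding distr_fun_lebesgue by (intro emeasure_mono) auto
  then show ?thesis by simp
qed

lemma distr_fun_right_cont:
  assumes f: "f \<in> L0" and le: "\<And>e. 0 < e \<Longrightarrow> distr_fun f (s + e) \<le> c"
  shows "distr_fun f s \<le> c"
proof -
  let ?A = "\<lambda>n. {x. -1 < x \<and> x < 1 \<and> s + 1 / real (Suc n) < cmod (f x)}"
  have "{x. -1 < x \<and> x < 1 \<and> s < cmod (f x)} = (\<Union>n. ?A n)"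
  proof (intro set_eqI iffI)
    fix x assume x: "x \<in> {x. -1 < x \<and> x < 1 \<and> s < cmod (f x)}"
    then obtain n where "1 / real (Suc n) < cmod (f x) - s" by (metis (mono_tags, lifting) diff_gt_0_iff_gt mem_Collect_eq nat_approx_posE)
    then show "x \<in> (\<Union>n. ?A n)" using x by (auto intro!: exI[of _ n])
  next
    fix x assume "x \<in> (\<Union>n. ?A n)"
    then obtain n where "-1 < x" "x < 1" "s + 1 / real (Suc n) < cmod (f x)" by blast
    moreover have "0 < 1 / real (Suc n)" by simp
    ultimately have "-1 < x \<and> x < 1 \<and> s < cmod (f x)" by linarith
    then show "x \<in> {x. -1 < x \<and> x < 1 \<and> s < cmod (f x)}" by blast
  qed
  then have "distr_fun f s = emeasure lebesgue (\<Union>n. ?A n)" by (simp only: distr_fun_lebesgue)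
  also have "\<dots> = (SUP n. emeasure lebesgue (?A n))"
  proof (intro SUP_emeasure_incseq[symmetric] incseq_SucI)
    show "?A n \<subseteq> ?A (Suc n)" for n
    proof -
      have "1 / real (Suc (Suc n)) \<le> 1 / real (Suc n)" by (simp add: frac_le)
      then show ?thesis by (auto simp del: of_nat_Suc)
    qed
    show "range ?A \<subseteq> sets lebesgue" using sets_level[OF f] by blast
  qed
  also have "\<dots> \<le> c"
    by (intro SUP_least) (use le in \<open>simp only: distr_fun_lebesgue[symmetric] divide_pos_pos zero_less_one of_nat_0_less_iff zero_less_Suc\<close>)
  finally show ?thesis .
qed

text \<open>Finite values and finite total measure: the sets where |f| exceeds n decrease to the
  empty set, so their measures tend to 0 and eventually drop below t.\<close>

lemma dec_rearr_nonempty: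
  assumes f: "f \<in> L0" and t: "0 < t"
  shows "{s. 0 \<le> s \<and> distr_fun f s \<le> ennreal t} \<noteq> {}"
proof -
  let ?A = "\<lambda>n. {x. -1 < x \<and> x < 1 \<and> real n < cmod (f x)}"
  have "(\<lambda>n. emeasure lebesgue (?A n)) \<longlonglongrightarrow> emeasure lebesgue (\<Inter>n. ?A n)"
  proof (rule Lim_emeasure_decseq)
    show "range ?A \<subseteq> sets lebesgue" using sets_level[OF f] by blast
    show "decseq ?A" by (auto simp: decseq_def)
    show "emeasure lebesgue (?A n) \<noteq> \<infinity>" for n
      using distr_fun_le_2[of f "real n"] unfolding distr_fun_lebesgue by (auto simp: top_unique)
  qed
  moreover have "(\<Inter>n. ?A n) = {}"
  proof (rule equals0I)
    fix x assume "x \<in> (\<Inter>n. ?A n)"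
    then have "real n < cmod (f x)" for n by blast
    then show False using reals_Archimedean2[of "cmod (f x)"] by (meson less_asym)
  qed
  ultimately have "(\<lambda>n. distr_fun f (real n)) \<longlonglongrightarrow> 0" unfolding distr_fun_lebesgue by simp
  from order_tendstoD(2)[OF this, of "ennreal t"] t
  obtain n where "distr_fun f (real n) < ennreal t" by (auto simp: eventually_sequentially)
  then have "real n \<in> {s. 0 \<le> s \<and> distr_fun f s \<le> ennreal t}" by simp
  then show ?thesis by blast
qed

lemma dec_rearr_bdd: "bdd_below {s. 0 \<le> s \<and> distr_fun f s \<le> ennreal t}"
  by (rule bdd_belowI[of _ 0]) auto

lemma dec_rearr_nonneg: "f \<in> L0 \<Longrightarrow> 0 < t \<Longrightarrow> 0 \<le> dec_rearr f t"
  unfolding dec_rearr_def by (intro cInf_greatest dec_rearr_nonempty) auto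

lemma dec_rearr_le: "0 \<le> s \<Longrightarrow> distr_fun f s \<le> ennreal t \<Longrightarrow> dec_rearr f t \<le> s"
  unfolding dec_rearr_def by (intro cInf_lower dec_rearr_bdd) auto

text \<open>Right continuity of the distribution function means that the infimum is
  attained.\<close>

lemma distr_dec_rearr:
  assumes f: "f \<in> L0" and t: "0 < t"
  shows "distr_fun f (dec_rearr f t) \<le> ennreal t"
proof (rule distr_fun_right_cont[OF f])
  fix e :: real assume "0 < e"
  then have "dec_rearr f t < dec_rearr f t + e" by simp
  then obtain s where "distr_fun f s \<le> ennreal t" "s < dec_rearr f t + e"
    using cInf_lessD[OF dec_rearr_nonempty[OF f t]] unfolding dec_rearr_def by blast
  then show "distr_fun f (dec_rearr f t + e) \<le> ennreal t"
    using distr_fun_mono[OF f, of s "dec_rearr f t + e"] by auto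
qed

lemma dec_rearr_antimono:
  assumes f: "f \<in> L0" and "0 < t" "t \<le> t'"
  shows "dec_rearr f t' \<le> dec_rearr f t"
proof (rule dec_rearr_le[OF dec_rearr_nonneg[OF f assms(2)]])
  have "distr_fun f (dec_rearr f t) \<le> ennreal t" by (rule distr_dec_rearr[OF f assms(2)])
  also have "\<dots> \<le> ennreal t'" using assms by (intro ennreal_leI)
  finally show "distr_fun f (dec_rearr f t) \<le> ennreal t'" .
qed

lemma dec_rearr_ge_2:
  assumes f: "f \<in> L0" and "2 \<le> t"
  shows "dec_rearr f t = 0"
proof (rule antisym)
  have "distr_fun f 0 \<le> ennreal 2" using distr_fun_le_2[of f 0] by simp
  also have "\<dots> \<le> ennreal t" using assms by (intro ennreal_leI)
  finally show "dec_rearr f t \<le> 0" by (intro dec_rearr_le) auto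
  show "0 \<le> dec_rearr f t" using assms by (intro dec_rearr_nonneg) auto
qed

section \<open>Decreasing profiles and the norms of their even representatives\<close>

definition decr_fun :: "(real \<Rightarrow> real) \<Rightarrow> bool" where
  "decr_fun g \<longleftrightarrow> (\<forall>t>0. 0 \<le> g t) \<and> (\<forall>t t'. 0 < t \<longrightarrow> t \<le> t' \<longrightarrow> g t' \<le> g t)"

lemma decr_funD: "decr_fun g \<Longrightarrow> 0 < t \<Longrightarrow> 0 \<le> g t" "decr_fun g \<Longrightarrow> 0 < t \<Longrightarrow> t \<le> t' \<Longrightarrow> g t' \<le> g t"
  unfolding decr_fun_def by blast+

lemma decr_fun_dec_rearr: "f \<in> L0 \<Longrightarrow> decr_fun (dec_rearr f)"
  unfolding decr_fun_def using dec_rearr_nonneg dec_rearr_antimono by blast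

lemma decr_fun_scale: "decr_fun g \<Longrightarrow> 0 < a \<Longrightarrow> decr_fun (\<lambda>t. g (a * t))"
  unfolding decr_fun_def by simp

lemma decr_fun_cmult: "decr_fun g \<Longrightarrow> 0 \<le> c \<Longrightarrow> decr_fun (\<lambda>t. c * g t)"
  unfolding decr_fun_def by (simp add: mult_left_mono)

lemma even_fun_L0:
  assumes g: "decr_fun g"
  shows "even_fun g \<in> L0"
proof -
  have "mono_on {0<..} (\<lambda>t. - g t)" using g by (auto simp: mono_on_def decr_fun_def)
  then have "(\<lambda>t. - g t) \<in> borel_measurable (restrict_space borel {0<..})" by (rule borel_measurable_mono_on_fnc)
  then have "(\<lambda>t. - (- g t)) \<in> borel_measurable (restrict_space borel {0<..})" by (rule borel_measurable_uminus)
  then have "g \<in> borel_measurable (restrict_space borel {0<..})" by simp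
  then have m: "(\<lambda>t. indicator {0<..} t *\<^sub>R g t) \<in> borel_measurable borel"
    by (subst (asm) borel_measurable_restrict_space_iff) auto
  have "(\<lambda>s. 2 * \<bar>s\<bar> :: real) \<in> borel_measurable lborel" by measurable
  from measurable_compose[OF this m] 
  have "(\<lambda>s. indicator {0<..} (2 * \<bar>s\<bar>) *\<^sub>R g (2 * \<bar>s\<bar>)) \<in> borel_measurable lborel" .
  then have "(\<lambda>s. indicator {0<..} (2 * \<bar>s\<bar>) *\<^sub>R g (2 * \<bar>s\<bar>)) \<in> borel_measurable lebesgue"
    by (rule measurable_completion)
  then have "(\<lambda>s. complex_of_real (indicator {0<..} (2 * \<bar>s\<bar>) *\<^sub>R g (2 * \<bar>s\<bar>))) \<in> borel_measurable lebesgue"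
    by (rule measurable_compose[OF _ borel_measurable_of_real])
  also have "(\<lambda>s. complex_of_real (indicator {0<..} (2 * \<bar>s\<bar>) *\<^sub>R g (2 * \<bar>s\<bar>))) = even_fun g"
    by (auto simp: even_fun_def fun_eq_iff indicator_def)
  finally show ?thesis unfolding L0_def by (rule measurable_restrict_space1)
qed

lemma cmod_even_fun: "decr_fun g \<Longrightarrow> cmod (even_fun g s) = (if s = 0 then 0 else g (2 * \<bar>s\<bar>))"
  by (simp add: even_fun_def decr_funD)

text \<open>The profile is read at 2|x| because the interval |x| < d/2 has length d: where the value
  exceeds s, 2|x| is below the measure d of the set where |f| exceeds s.\<close>

lemma even_fun_dec_rearr_le:
  assumes \<rho>: "ri_space \<rho>" and f: "f \<in> L0"
  shows "\<rho> (even_fun (dec_rearr f)) \<le> \<rho> f"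
proof (rule ri_distr_le[OF \<rho> f even_fun_L0[OF decr_fun_dec_rearr[OF f]]])
  fix s :: real assume s: "0 \<le> s"
  define d where "d = enn2real (distr_fun f s)"
  have d: "distr_fun f s = ennreal d" "0 \<le> d"
    using distr_fun_le_2[of f s] unfolding d_def by (cases "distr_fun f s"; simp add: top_unique)+
  have "distr_fun (even_fun (dec_rearr f)) s \<le> emeasure lebesgue {- (d / 2) .. d / 2}"
    unfolding distr_fun_lebesgue
  proof (intro emeasure_mono subsetI)
    fix x assume "x \<in> {x. -1 < x \<and> x < 1 \<and> s < cmod (even_fun (dec_rearr f) x)}"
    then have "s < cmod (even_fun (dec_rearr f) x)" by simp
    then have x: "x \<noteq> 0" "s < dec_rearr f (2 * \<bar>x\<bar>)"
      using s by (auto simp: cmod_even_fun[OF decr_fun_dec_rearr[OF f]] split: if_splits)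
    then have "\<not> distr_fun f s \<le> ennreal (2 * \<bar>x\<bar>)" using dec_rearr_le[OF s] by (meson not_le)
    then have "2 * \<bar>x\<bar> < d" unfolding d(1) using d(2) by (simp add: ennreal_le_iff2 not_le)
    then show "x \<in> {- (d / 2) .. d / 2}" by auto
  qed auto
  also have "\<dots> = ennreal d" using d(2) by simp
  finally show "distr_fun (even_fun (dec_rearr f)) s \<le> distr_fun f s" by (simp add: d(1))
qed

text \<open>The two functions can differ only where |x a| > 1. For a < 1 there is no such point; for
  a \<ge> 1 the last hypothesis makes the profile vanish there.\<close>

lemma even_fun_dil:
  assumes \<rho>: "ri_space \<rho>" and g: "decr_fun g" and a: "0 < a" and z: "1 \<le> a \<Longrightarrow> \<forall>t\<ge>2. g t = 0"
  shows "\<rho> (even_fun (\<lambda>t. g (a * t))) = \<rho> (dil a (even_fun g))"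
proof (rule bfs_cong[OF ri_bfs[OF \<rho>] even_fun_L0[OF decr_fun_scale[OF g a]] dil_L0[OF even_fun_L0[OF g] a]])
  show "AE x in M1. cmod (even_fun (\<lambda>t. g (a * t)) x) = cmod (dil a (even_fun g) x)"
  proof (rule AE_I2)
    fix x assume "x \<in> space M1"
    then have x: "\<bar>x\<bar> < 1" by (simp add: space_restrict_space abs_less_iff)
    have e: "2 * \<bar>x * a\<bar> = a * (2 * \<bar>x\<bar>)" using a by (simp add: abs_mult)
    have "even_fun (\<lambda>t. g (a * t)) x = dil a (even_fun g) x"
    proof (cases "\<bar>x * a\<bar> \<le> 1")
      case True
      then show ?thesis using a e by (simp add: dil_def even_fun_def mult.left_commute[of a 2])
    next
      case False
      then have "1 \<le> a" using x a mult_mono[of "\<bar>x\<bar>" 1 a 1] by (cases "a \<le> 1") (auto simp: abs_mult)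
      moreover have "2 \<le> a * (2 * \<bar>x\<bar>)" using False e by linarith
      ultimately show ?thesis using False z by (simp add: dil_def even_fun_def)
    qed
    then show "cmod (even_fun (\<lambda>t. g (a * t)) x) = cmod (dil a (even_fun g) x)" by simp
  qed
qed

text \<open>One dilation bound applied k times. Scaling by a \<ge> 1 keeps a profile zero from 2 on,
  so that hypothesis passes through the induction.\<close>

lemma even_fun_iterate:
  assumes \<rho>: "ri_space \<rho>" and g: "decr_fun g" and a: "0 < a" and z: "1 \<le> a \<Longrightarrow> \<forall>t\<ge>2. g t = 0"
    and \<theta>: "0 \<le> \<theta>" "dil_norm \<rho> a \<le> ennreal \<theta>" and r: "0 \<le> r" "\<rho> (even_fun g) \<le> ennreal r"
  shows "\<rho> (even_fun (\<lambda>t. g (a ^ k * t))) \<le> ennreal (\<theta> ^ k * r)"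
proof (induction k)
  case 0
  then show ?case using r by simp
next
  case (Suc k)
  let ?g = "\<lambda>t. g (a ^ k * t)"
  have dg: "decr_fun ?g" using g a by (intro decr_fun_scale) auto
  have zg: "\<forall>t\<ge>2. ?g t = 0" if "1 \<le> a"
  proof (intro allI impI)
    fix t :: real assume t: "2 \<le> t"
    have "1 * t \<le> a ^ k * t" using that t by (intro mult_right_mono) (auto intro: one_le_power)
    then have "2 \<le> a ^ k * t" using t by linarith
    then show "?g t = 0" using z[OF that] by blast
  qed
  have "(\<lambda>t. g (a ^ Suc k * t)) = (\<lambda>t. ?g (a * t))" by (simp add: mult.assoc mult.left_commute)
  then have "\<rho> (even_fun (\<lambda>t. g (a ^ Suc k * t))) = \<rho> (dil a (even_fun ?g))"
    using even_fun_dil[OF \<rho> dg a zg] by simp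
  also have "\<dots> \<le> dil_norm \<rho> a * \<rho> (even_fun ?g)"
  proof (rule dil_le_dil_norm[OF \<rho> a even_fun_L0[OF dg]])
    show "\<rho> (even_fun ?g) < \<infinity>" by (rule le_less_trans[OF Suc]) (simp only: infinity_ennreal_def ennreal_less_top)
  qed
  also have "\<dots> \<le> ennreal \<theta> * ennreal (\<theta> ^ k * r)" by (intro mult_mono \<theta> Suc) auto
  also have "\<dots> = ennreal (\<theta> ^ Suc k * r)" using \<theta> r by (simp add: ennreal_mult[symmetric] mult.assoc)
  finally show ?case .
qed

text \<open>Summable norms force pointwise convergence: a decreasing partial sum is at least its
  value at t on (0, t], so that value times the norm of an indicator is bounded by the sum of the c
  n. The Fatou property then bounds the norm of the limit.\<close>

lemma even_fun_suminf:
  fixes c :: "nat \<Rightarrow> real"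
  assumes \<rho>: "bfs \<rho>" and g: "\<And>n. decr_fun (g n)" and c: "\<And>n. 0 \<le> c n" "summable c"
    and le: "\<And>n. \<rho> (even_fun (g n)) \<le> ennreal (c n)"
  shows "\<And>t. 0 < t \<Longrightarrow> summable (\<lambda>n. g n t)" "decr_fun (\<lambda>t. \<Sum>n. g n t)"
    "\<rho> (even_fun (\<lambda>t. \<Sum>n. g n t)) \<le> ennreal (\<Sum>n. c n)"
proof -
  define S where "S N t = (\<Sum>n<N. g n t)" for N t
  have S: "decr_fun (S N)" for N
    unfolding S_def decr_fun_def using decr_funD[OF g] by (auto intro!: sum_nonneg sum_mono)
  have Sle: "\<rho> (even_fun (S N)) \<le> ennreal (\<Sum>n. c n)" for N
  proof -
    have "\<rho> (\<lambda>x. \<Sum>n<N. even_fun (g n) x) \<le> (\<Sum>n<N. \<rho> (even_fun (g n)))"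
      using bfs_sum_le[OF \<rho>, of "{..<N}" "\<lambda>n. even_fun (g n)"] even_fun_L0[OF g] by blast
    moreover have "(\<lambda>x. \<Sum>n<N. even_fun (g n) x) = even_fun (S N)"
      by (auto simp: even_fun_def S_def fun_eq_iff)
    moreover have "(\<Sum>n<N. \<rho> (even_fun (g n))) \<le> (\<Sum>n<N. ennreal (c n))" by (intro sum_mono le)
    moreover have "(\<Sum>n<N. ennreal (c n)) = ennreal (\<Sum>n<N. c n)" using c by (simp add: sum_ennreal)
    moreover have "ennreal (\<Sum>n<N. c n) \<le> ennreal (\<Sum>n. c n)"
      using c by (intro ennreal_leI sum_le_suminf) auto
    ultimately show ?thesis by (metis order_trans)
  qed
  have sm1: "summable (\<lambda>n. g n t)" if t: "0 < t" "t \<le> 1" for t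
  proof -
    \<comment> \<open>For t \<le> 1 this interval lies in (-1,1), and on it 2|x| < t. Larger t
      follow by monotonicity.\<close>
    let ?A = "{-(t/2)<..<t/2}"
    have AL: "(indicator ?A :: real \<Rightarrow> complex) \<in> L0" by (intro L0_intros(6)) auto
    obtain p where p: "ennreal p \<le> \<rho> (indicator ?A)" "0 < p"
      by (rule bfs_indicator_pos[OF \<rho>, of "-(t/2)" "t/2"]) (use t in auto)
    have b: "S N t \<le> (\<Sum>n. c n) / p" for N
    proof -
      have St: "0 \<le> S N t" using decr_funD(1)[OF S t(1)] .
      have "ennreal (S N t) * ennreal p \<le> ennreal (cmod (of_real (S N t))) * \<rho> (indicator ?A)"
        using St p(1) by (intro mult_mono) auto
      also have "\<dots> = \<rho> (\<lambda>x. complex_of_real (S N t) * indicator ?A x)"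
        by (rule bfs_scale[OF \<rho> AL, symmetric])
      also have "\<dots> \<le> \<rho> (even_fun (S N))"
      proof (rule bfs_ideal[OF \<rho> even_fun_L0[OF S] L0_intros(3)[OF L0_intros(5) AL]])
        have "AE x in M1. x \<notin> {0::real}" by (rule AE_M1_notin) simp
        then show "AE x in M1. cmod (complex_of_real (S N t) * indicator ?A x) \<le> cmod (even_fun (S N) x)"
        proof eventually_elim
          case (elim x)
          show ?case
          proof (cases "x \<in> ?A")
            case True
            then have "2 * \<bar>x\<bar> \<le> t" by auto
            then have "S N t \<le> S N (2 * \<bar>x\<bar>)" using elim by (intro decr_funD(2)[OF S]) auto
            then show ?thesis using True St elim by (simp add: norm_mult cmod_even_fun[OF S])
          qed simp
        qed
      qed
      also have "\<dots> \<le> ennreal (\<Sum>n. c n)" by (rule Sle)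
      finally have "ennreal (S N t * p) \<le> ennreal (\<Sum>n. c n)" using St p(2) by (simp add: ennreal_mult)
      then have "S N t * p \<le> (\<Sum>n. c n)" using suminf_nonneg[OF c(2,1)] by (simp add: ennreal_le_iff)
      then show ?thesis using p(2) by (simp add: field_simps)
    qed
    show ?thesis
      using b decr_funD(1)[OF g t(1)] unfolding S_def by (intro bounded_imp_summable[where B="(\<Sum>n. c n) / p"])
        (auto simp: lessThan_Suc_atMost[symmetric] simp del: sum.lessThan_Suc)
  qed
  show sm: "summable (\<lambda>n. g n t)" if t: "0 < t" for t
  proof (cases "t \<le> 1")
    case False
    show ?thesis
    proof (rule summable_comparison_test[OF _ sm1[of 1]])
      show "\<exists>N. \<forall>n\<ge>N. norm (g n t) \<le> g n 1"
        using False t decr_funD[OF g] by (intro exI[of _ 0]) auto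
    qed auto
  qed (use sm1 t in auto)
  show dG: "decr_fun (\<lambda>t. \<Sum>n. g n t)"
    unfolding decr_fun_def using sm decr_funD[OF g] by (auto intro!: suminf_nonneg suminf_le)
  have "(\<lambda>N. \<rho> (even_fun (S N))) \<longlonglongrightarrow> \<rho> (even_fun (\<lambda>t. \<Sum>n. g n t))"
  proof (rule bfs_fatou[OF \<rho> even_fun_L0[OF S] even_fun_L0[OF dG]])
    show "AE x in M1. incseq (\<lambda>N. cmod (even_fun (S N) x)) \<and> (\<lambda>N. cmod (even_fun (S N) x)) \<longlonglongrightarrow> cmod (even_fun (\<lambda>t. \<Sum>n. g n t) x)"
    proof (rule AE_I2)
      fix x
      show "incseq (\<lambda>N. cmod (even_fun (S N) x)) \<and> (\<lambda>N. cmod (even_fun (S N) x)) \<longlonglongrightarrow> cmod (even_fun (\<lambda>t. \<Sum>n. g n t) x)"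
      proof (cases "x = 0")
        case False
        then have t: "0 < 2 * \<bar>x\<bar>" by simp
        have "incseq (\<lambda>N. S N (2 * \<bar>x\<bar>))"
          unfolding S_def using decr_funD(1)[OF g t] by (intro incseq_SucI) simp
        moreover have "(\<lambda>N. S N (2 * \<bar>x\<bar>)) \<longlonglongrightarrow> (\<Sum>n. g n (2 * \<bar>x\<bar>))"
          unfolding S_def by (rule summable_LIMSEQ[OF sm[OF t]])
        ultimately show ?thesis using False by (simp add: cmod_even_fun[OF S] cmod_even_fun[OF dG])
      qed (simp add: even_fun_def incseq_def)
    qed
  qed
  then show "\<rho> (even_fun (\<lambda>t. \<Sum>n. g n t)) \<le> ennreal (\<Sum>n. c n)"
    using Sle by (intro tendsto_upperbound[of _ _ sequentially]) auto
qed

text \<open>A discrete form of integrating the rearrangement over (0, t). The set where |f| exceeds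
  \<open>dec_rearr f t\<close> is cut at the levels belonging to t/B^j; in the j-th layer |f| is at
  most the next level, and the layer has measure at most t/B^j.\<close>

lemma nn_integral_large_le:
  assumes f: "f \<in> L0" and t: "0 < t" and B: "1 < B"
    and sm: "summable (\<lambda>j. (1 / B) ^ j * dec_rearr f ((1 / B) ^ Suc j * t))"
  shows "(\<integral>\<^sup>+x. ennreal (cmod (f x)) * indicator {x. dec_rearr f t < cmod (f x)} x \<partial>M1)
    \<le> ennreal (t * (\<Sum>j. (1 / B) ^ j * dec_rearr f ((1 / B) ^ Suc j * t)))"
proof -
  let ?b = "1 / B"
  have term_le: "c j \<le> suminf c" for c :: "nat \<Rightarrow> ennreal" and j
    using sum_le_suminf[of c "{j}"] by simp
  define a where "a j = dec_rearr f (?b ^ j * t)" for j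
  have bt: "0 < ?b ^ j * t" for j using B t by simp
  have a0: "0 \<le> a j" for j unfolding a_def by (rule dec_rearr_nonneg[OF f bt])
  have [measurable]: "f \<in> borel_measurable M1" using f by (simp add: L0_def)
  let ?L = "\<lambda>j. {x \<in> space M1. a j < cmod (f x)}"
  have Lm [measurable]: "?L j \<in> sets M1" for j by measurable
  have LD: "emeasure M1 (?L j) \<le> ennreal (?b ^ j * t)" for j
    using distr_dec_rearr[OF f bt[of j]] by (simp add: distr_fun_def a_def)
  \<comment> \<open>The measures of the \<open>?L j\<close> tend to 0, so points above every level
    form a null set; every other point of the set falls into some layer.\<close>
  have "AE x in M1. x \<notin> (\<Inter>j. ?L j)"
  proof -
    have "emeasure M1 (\<Inter>j. ?L j) \<le> 0"
    proof (rule tendsto_lowerbound[of "\<lambda>j. ennreal (?b ^ j * t)" _ sequentially])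
      have "(\<lambda>j. ?b ^ j * t) \<longlonglongrightarrow> 0 * t"
        using B by (intro tendsto_mult tendsto_const LIMSEQ_power_zero) simp
      then have "(\<lambda>j. ennreal (?b ^ j * t)) \<longlonglongrightarrow> ennreal (0 * t)" by (intro tendsto_ennrealI)
      then show "(\<lambda>j. ennreal (?b ^ j * t)) \<longlonglongrightarrow> 0" by simp
      show "\<forall>\<^sub>F j in sequentially. emeasure M1 (\<Inter>j. ?L j) \<le> ennreal (?b ^ j * t)"
      proof (rule always_eventually, rule allI)
        fix j
        have "emeasure M1 (\<Inter>j. ?L j) \<le> emeasure M1 (?L j)" by (intro emeasure_mono Lm) auto
        then show "emeasure M1 (\<Inter>j. ?L j) \<le> ennreal (?b ^ j * t)" using LD order_trans by blast
      qed
    qed simp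
    then have "(\<Inter>j. ?L j) \<in> null_sets M1" by (intro null_setsI sets.countable_INT image_subsetI Lm) simp_all
    then show ?thesis by (rule AE_not_in)
  qed
  then have ae: "AE x in M1. ennreal (cmod (f x)) * indicator {x. dec_rearr f t < cmod (f x)} x
      \<le> (\<Sum>j. ennreal (a (Suc j)) * indicator (?L j) x)"
  proof (rule AE_mp, intro AE_I2 impI)
    fix x assume xs: "x \<in> space M1" and x: "x \<notin> (\<Inter>j. ?L j)"
    show "ennreal (cmod (f x)) * indicator {x. dec_rearr f t < cmod (f x)} x \<le> (\<Sum>j. ennreal (a (Suc j)) * indicator (?L j) x)"
    proof (cases "dec_rearr f t < cmod (f x)")
      case True
      have ex: "\<exists>j. cmod (f x) \<le> a j" using x xs by (auto simp: not_less)
      define k where "k = (LEAST j. cmod (f x) \<le> a j)"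
      have k: "cmod (f x) \<le> a k" unfolding k_def by (rule LeastI_ex[OF ex])
      have "k \<noteq> 0" using k True by (intro notI) (simp add: a_def)
      then obtain j where j: "k = Suc j" by (cases k) auto
      have "\<not> cmod (f x) \<le> a j" using not_less_Least[of j "\<lambda>j. cmod (f x) \<le> a j"] j by (simp add: k_def)
      then have xL: "x \<in> ?L j" using xs by simp
      have "ennreal (cmod (f x)) * indicator {x. dec_rearr f t < cmod (f x)} x = ennreal (cmod (f x))" using True by simp
      also have "\<dots> \<le> ennreal (a (Suc j)) * indicator (?L j) x"
        using k j xL by (simp add: ennreal_leI)
      also have "\<dots> \<le> (\<Sum>j. ennreal (a (Suc j)) * indicator (?L j) x)"
        by (rule term_le)
      finally show ?thesis .
    qed simp
  qed
  have "(\<integral>\<^sup>+x. ennreal (cmod (f x)) * indicator {x. dec_rearr f t < cmod (f x)} x \<partial>M1)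
      \<le> (\<integral>\<^sup>+x. (\<Sum>j. ennreal (a (Suc j)) * indicator (?L j) x) \<partial>M1)"
    by (rule nn_integral_mono_AE[OF ae])
  also have "\<dots> = (\<Sum>j. \<integral>\<^sup>+x. ennreal (a (Suc j)) * indicator (?L j) x \<partial>M1)"
    by (intro nn_integral_suminf borel_measurable_times_ennreal borel_measurable_indicator Lm) auto
  also have "\<dots> = (\<Sum>j. ennreal (a (Suc j)) * emeasure M1 (?L j))"
    by (intro suminf_cong nn_integral_cmult_indicator Lm)
  also have "\<dots> \<le> (\<Sum>j. ennreal (t * (?b ^ j * a (Suc j))))"
  proof (intro suminf_le)
    fix j
    have "ennreal (a (Suc j)) * emeasure M1 (?L j) \<le> ennreal (a (Suc j)) * ennreal (?b ^ j * t)"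
      by (intro mult_left_mono LD) auto
    also have "\<dots> = ennreal (t * (?b ^ j * a (Suc j)))"
      using a0 bt[of j] by (simp add: ennreal_mult[symmetric] mult_ac)
    finally show "ennreal (a (Suc j)) * emeasure M1 (?L j) \<le> ennreal (t * (?b ^ j * a (Suc j)))" .
  qed auto
  also have "\<dots> = ennreal (\<Sum>j. t * (?b ^ j * a (Suc j)))"
    by (intro suminf_ennreal2 summable_mult mult_nonneg_nonneg a0) (use sm B t in \<open>auto simp: a_def\<close>)
  also have "(\<Sum>j. t * (?b ^ j * a (Suc j))) = t * (\<Sum>j. ?b ^ j * a (Suc j))"
    using sm by (intro suminf_mult) (simp add: a_def)
  finally show ?thesis by (simp add: a_def)
qed

text \<open>Let S be the series and split f at m = \<open>dec_rearr f t\<close>. The part up to m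
  has Poisson averages at most 16 m \<le> 16 S; the part above has mass at most t S, so the weak
  bound with constant 80 at level 80 S gives measure t. Hence 96 = 16 + 80, and \<eta> keeps the
  level positive when S = 0.\<close>

lemma emeasure_Mset_rearr_le:
  assumes f: "f \<in> L1" and t: "0 < t" and B: "1 < B"
    and sm: "summable (\<lambda>j. (1 / B) ^ j * dec_rearr f ((1 / B) ^ Suc j * t))" (is "summable ?a")
    and \<eta>: "0 < \<eta>"
  shows "emeasure lebesgue (Mset (ext f) (96 * (\<Sum>j. ?a j) + \<eta>)) \<le> ennreal t"
proof -
  have f0: "f \<in> L0" using f by (auto simp: L1_def L0_def)
  let ?S = "\<Sum>j. ?a j"
  let ?m = "dec_rearr f t"
  have a0: "0 \<le> ?a j" for j using B t by (intro mult_nonneg_nonneg dec_rearr_nonneg f0) auto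
  have m0: "0 \<le> ?m" by (rule dec_rearr_nonneg[OF f0 t])
  have mS: "?m \<le> ?S"
  proof -
    have "?m \<le> dec_rearr f ((1 / B) ^ Suc 0 * t)" using B t by (intro dec_rearr_antimono f0) (auto simp: field_simps)
    also have "\<dots> = ?a 0" by simp
    also have "\<dots> \<le> ?S" using sum_le_suminf[OF sm, of "{0}"] a0 by simp
    finally show ?thesis .
  qed
  have S0: "0 \<le> ?S" using mS m0 by simp
  have fi: "integrable lebesgue (ext f)" using f by (simp add: L1_iff)
  have [measurable]: "ext f \<in> borel_measurable lebesgue" using fi by auto
  let ?A = "{u. ?m < norm (ext f u)}"
  have Am: "?A \<in> sets lebesgue"
  proof -
    have "{u \<in> space lebesgue. ?m < norm (ext f u)} \<in> sets lebesgue" by measurable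
    then show ?thesis by simp
  qed
  let ?f1 = "\<lambda>u. indicator ?A u *\<^sub>R ext f u"
  have f1: "integrable lebesgue ?f1" by (rule integrable_cutoff[OF fi Am])
  have F1: "(LINT u|lebesgue. norm (?f1 u)) \<le> t * ?S"
  proof -
    have "ennreal (LINT u|lebesgue. norm (?f1 u)) = (\<integral>\<^sup>+u. ennreal (norm (?f1 u)) \<partial>lebesgue)"
      by (intro nn_integral_eq_integral[symmetric] integrable_norm[OF f1]) auto
    also have "\<dots> = (\<integral>\<^sup>+x. ennreal (cmod (f x)) * indicator {x. ?m < cmod (f x)} x * indicator {-1<..<1} x \<partial>lebesgue)"
      by (intro nn_integral_cong) (use m0 in \<open>auto simp: ext_def indicator_def\<close>)
    also have "\<dots> = (\<integral>\<^sup>+x. ennreal (cmod (f x)) * indicator {x. ?m < cmod (f x)} x \<partial>M1)"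
      by (intro nn_integral_restrict_space[symmetric]) simp
    also have "\<dots> \<le> ennreal (t * ?S)" by (rule nn_integral_large_le[OF f0 t B sm])
    finally show ?thesis using t S0 by (simp add: ennreal_le_iff)
  qed
  have sub: "Mset (ext f) (96 * ?S + \<eta>) \<subseteq> Mset ?f1 (80 * ?S + \<eta>)"
  proof
    fix x assume "x \<in> Mset (ext f) (96 * ?S + \<eta>)"
    then obtain h where h: "0 < h" "kconv (pk h) (\<lambda>u. norm (ext f u)) x > 96 * ?S + \<eta>" by (auto simp: Mset_def)
    let ?g2 = "\<lambda>u. norm (ext f u) - norm (?f1 u)"
    have g2i: "integrable lebesgue ?g2"
      by (intro Bochner_Integration.integrable_diff integrable_norm fi f1)
    have g2: "0 \<le> ?g2 u" "?g2 u \<le> ?m" for u using m0 by (auto simp: indicator_def)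
    have "kconv (pk h) ?g2 x \<le> 16 * ?m"
    proof (rule kconv_pk_le[OF g2i g2(1) h(1)])
      fix r :: real assume r: "0 < r"
      have "(LINT u:cball x r|lebesgue. ?g2 u) \<le> (LINT u:cball x r|lebesgue. ?m)"
        unfolding set_lebesgue_integral_def
      proof (rule integral_mono)
        show "integrable lebesgue (\<lambda>u. indicator (cball x r) u *\<^sub>R ?g2 u)"
          by (rule integrable_mult_indicator[OF _ g2i]) simp
        show "integrable lebesgue (\<lambda>u. indicator (cball x r) u *\<^sub>R ?m)"
          by (intro integrable_scaleR_left integrable_real_indicator) (use r in \<open>auto simp: cball_eq_atLeastAtMost\<close>)
        show "indicator (cball x r) u *\<^sub>R ?g2 u \<le> indicator (cball x r) u *\<^sub>R ?m" for u
          by (intro scaleR_left_mono g2) auto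
      qed
      also have "\<dots> = 2 * r * ?m" using r by (simp add: cball_eq_atLeastAtMost set_lebesgue_integral_def)
      finally show "(LINT u:cball x r|lebesgue. ?g2 u) \<le> 2 * r * ?m" .
    qed
    moreover have "kconv (pk h) (\<lambda>u. norm (ext f u)) x = kconv (pk h) ?g2 x + kconv (pk h) (\<lambda>u. norm (?f1 u)) x"
      using kconv_add[OF kernel_measurable(1) kernel_bounds(1)[OF h(1)] g2i integrable_norm[OF f1], of x] by simp
    ultimately have "kconv (pk h) (\<lambda>u. norm (?f1 u)) x > 80 * ?S + \<eta>" using h(2) mS by linarith
    then show "x \<in> Mset ?f1 (80 * ?S + \<eta>)" using h(1) unfolding Mset_def by blast
  qed
  have pos: "0 < 80 * ?S + \<eta>" using S0 \<eta> by simp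
  have "emeasure lebesgue (Mset (ext f) (96 * ?S + \<eta>)) \<le> emeasure lebesgue (Mset ?f1 (80 * ?S + \<eta>))"
    by (intro emeasure_mono sub sets_Mset_Hset f1)
  also have "\<dots> \<le> ennreal (80 / (80 * ?S + \<eta>) * (LINT u|lebesgue. norm (?f1 u)))"
    by (rule emeasure_Mset_le[OF f1 pos])
  also have "\<dots> \<le> ennreal (80 / (80 * ?S + \<eta>) * (t * ?S))"
    using F1 pos by (intro ennreal_leI mult_left_mono) auto
  also have "\<dots> \<le> ennreal t"
  proof (intro ennreal_leI)
    have "80 * (t * ?S) \<le> t * (80 * ?S + \<eta>)" using t \<eta> by (simp add: algebra_simps)
    then show "80 / (80 * ?S + \<eta>) * (t * ?S) \<le> t" using pos by (simp add: pos_divide_le_eq)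
  qed
  finally show ?thesis .
qed

section \<open>Boundedness on rearrangement invariant spaces\<close>

lemma Hset_antimono: "a \<le> b \<Longrightarrow> Hset f b \<subseteq> Hset f a"
  by (auto simp: Hset_def intro: le_less_trans)

text \<open>Iterating the good-lambda inequality along the scales \<open>q^k t\<close> replaces the level of the maximal Hilbert
  transform by a sum of levels of the maximal function.\<close>

lemma Hset_iterate:
  assumes q: "1 < q" and K: "0 < K"
    and good: "\<And>a b. 0 < a \<Longrightarrow> 0 < b \<Longrightarrow>
      emeasure lebesgue (Hset g (a + K * b)) \<le> emeasure lebesgue (Mset g b) + ennreal (1 / (2 * q)) * emeasure lebesgue (Hset g a)"
    and g: "integrable lebesgue g" "\<And>u. u \<notin> {-1<..<1} \<Longrightarrow> g u = 0"
    and S: "\<And>t. 0 < t \<Longrightarrow> 0 \<le> S t" "\<And>t e. 0 < t \<Longrightarrow> 0 < e \<Longrightarrow> emeasure lebesgue (Mset g (S t + e)) \<le> ennreal t"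
    and \<eta>: "0 < \<eta>"
  shows "0 < t \<Longrightarrow> emeasure lebesgue (Hset g (K * (\<Sum>k<n. S (q ^ k * t / 2) + \<eta>)
      + (10 ^ 8 * (LINT u|lebesgue. norm (g u)) + \<eta>) / (q ^ n * t))) \<le> ennreal t"
proof (induction n arbitrary: t)
  \<comment> \<open>The base case is the plain weak type bound. In the general statement its level
    is divided by q^n and so becomes negligible.\<close>
  case 0
  let ?F = "LINT u|lebesgue. norm (g u)"
  let ?l = "(10 ^ 8 * ?F + \<eta>) / t"
  have F0: "0 \<le> ?F" by simp
  have pos: "0 < 10 ^ 8 * ?F + \<eta>" using F0 \<eta> by (simp add: add_nonneg_pos)
  then have l: "0 < ?l" using 0 by simp
  have "emeasure lebesgue (Hset g ?l) \<le> ennreal (10 ^ 8 / ?l * ?F)" by (rule emeasure_Hset_le[OF g l])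
  also have "\<dots> \<le> ennreal t"
  proof (rule ennreal_leI)
    have "10 ^ 8 / ?l * ?F = t * (10 ^ 8 * ?F) / (10 ^ 8 * ?F + \<eta>)" by simp
    also have "\<dots> \<le> t" using pos 0 \<eta> by (simp add: pos_divide_le_eq)
    finally show "10 ^ 8 / ?l * ?F \<le> t" .
  qed
  finally show ?case by simp
next
  case (Suc n)
  let ?F = "LINT u|lebesgue. norm (g u)"
  have F0: "0 \<le> ?F" by simp
  have pos: "0 < 10 ^ 8 * ?F + \<eta>" using F0 \<eta> by (simp add: add_nonneg_pos)
  have qt: "0 < q * t" using q Suc.prems by simp
  let ?a = "K * (\<Sum>k<n. S (q ^ k * (q * t) / 2) + \<eta>) + (10 ^ 8 * ?F + \<eta>) / (q ^ n * (q * t))"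
  let ?b = "S (t / 2) + \<eta>"
  have b: "0 < ?b" using S(1)[of "t / 2"] Suc.prems \<eta> by simp
  have "0 \<le> (\<Sum>k<n. S (q ^ k * (q * t) / 2) + \<eta>)"
    using S(1) qt q \<eta> by (intro sum_nonneg add_nonneg_nonneg S(1)) auto
  moreover have "0 < (10 ^ 8 * ?F + \<eta>) / (q ^ n * (q * t))" using pos qt q by simp
  ultimately have a: "0 < ?a" using K by (simp add: add_nonneg_pos)
  have eq: "?a + K * ?b = K * (\<Sum>k<Suc n. S (q ^ k * t / 2) + \<eta>) + (10 ^ 8 * ?F + \<eta>) / (q ^ Suc n * t)"
  proof -
    have "(\<Sum>k<Suc n. S (q ^ k * t / 2) + \<eta>) = ?b + (\<Sum>k<n. S (q ^ Suc k * t / 2) + \<eta>)"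
      by (subst sum.lessThan_Suc_shift) simp
    moreover have "q ^ k * (q * t) = q ^ Suc k * t" for k by simp
    ultimately show ?thesis by (simp only: distrib_left add_ac)
  qed
  have "emeasure lebesgue (Hset g (?a + K * ?b)) \<le> emeasure lebesgue (Mset g ?b) + ennreal (1 / (2 * q)) * emeasure lebesgue (Hset g ?a)"
    by (rule good[OF a b])
  \<comment> \<open>The induction hypothesis at q t controls measure q t, which the weight 1/(2 q)
    turns into t/2; the maximal function accounts for the other half.\<close>
  also have "\<dots> \<le> ennreal (t / 2) + ennreal (1 / (2 * q)) * ennreal (q * t)"
    using Suc.prems \<eta> by (intro add_mono mult_left_mono S(2) Suc.IH[OF qt]) auto
  also have "\<dots> = ennreal (t / 2 + 1 / (2 * q) * (q * t))"
    using q Suc.prems by (simp only: ennreal_mult[symmetric] ennreal_plus[symmetric] divide_nonneg_pos mult_nonneg_nonneg less_imp_le zero_less_numeral zero_le_one mult_pos_pos zero_less_divide_iff less_trans[OF zero_less_one q])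
  also have "t / 2 + 1 / (2 * q) * (q * t) = t" using q by simp
  finally show ?case unfolding eq .
qed

text \<open>First n is taken so large that the remainder over q^n t is at most e/2, then \<eta> so
  small that its n copies cost at most e/2.\<close>

lemma Hset_le_limit:
  assumes q: "1 < q" and K: "0 < K"
    and good: "\<And>a b. 0 < a \<Longrightarrow> 0 < b \<Longrightarrow>
      emeasure lebesgue (Hset g (a + K * b)) \<le> emeasure lebesgue (Mset g b) + ennreal (1 / (2 * q)) * emeasure lebesgue (Hset g a)"
    and g: "integrable lebesgue g" "\<And>u. u \<notin> {-1<..<1} \<Longrightarrow> g u = 0"
    and S: "\<And>t. 0 < t \<Longrightarrow> 0 \<le> S t" "\<And>t e. 0 < t \<Longrightarrow> 0 < e \<Longrightarrow> emeasure lebesgue (Mset g (S t + e)) \<le> ennreal t"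
    and \<Phi>: "\<And>n. (\<Sum>k<n. S (q ^ k * t / 2)) \<le> \<Phi>" and t: "0 < t" and e: "0 < e"
  shows "emeasure lebesgue (Hset g (K * \<Phi> + e)) \<le> ennreal t"
proof -
  let ?F = "LINT u|lebesgue. norm (g u)"
  have F0: "0 \<le> ?F" by simp
  obtain n where n: "(10 ^ 8 * ?F + 1) / t / (e / 2) < q ^ n" using real_arch_pow[OF q] by blast
  define \<eta> where "\<eta> = min 1 (e / (2 * K * (real n + 1)))"
  have \<eta>: "0 < \<eta>" "\<eta> \<le> 1" using e K by (auto simp: \<eta>_def)
  have "K * (real n * \<eta>) \<le> e / 2"
  proof -
    have "K * (real n * \<eta>) \<le> K * ((real n + 1) * (e / (2 * K * (real n + 1))))"
      using K e by (intro mult_left_mono mult_mono) (auto simp: \<eta>_def)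
    also have "\<dots> = e / 2"
    proof -
      have "K * (N * (e / (2 * K * N))) = e / 2" if "0 < N" for N :: real using K that by simp
      from this[of "real n + 1"] show ?thesis by simp
    qed
    finally show ?thesis .
  qed
  moreover have "(10 ^ 8 * ?F + \<eta>) / (q ^ n * t) \<le> e / 2"
  proof -
    have "(10 ^ 8 * ?F + \<eta>) / (q ^ n * t) \<le> (10 ^ 8 * ?F + 1) / (q ^ n * t)"
      using \<eta> q t by (intro divide_right_mono) auto
    also have "\<dots> \<le> e / 2" using n q t e by (simp add: pos_divide_less_eq pos_divide_le_eq mult_ac less_imp_le)
    finally show ?thesis .
  qed
  moreover have "K * (\<Sum>k<n. S (q ^ k * t / 2) + \<eta>) \<le> K * \<Phi> + K * (real n * \<eta>)"
  proof -
    have "(\<Sum>k<n. S (q ^ k * t / 2) + \<eta>) = (\<Sum>k<n. S (q ^ k * t / 2)) + real n * \<eta>" by (simp add: sum.distrib)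
    then show ?thesis using \<Phi>[of n] K by (simp add: distrib_left[symmetric])
  qed
  ultimately have le: "K * (\<Sum>k<n. S (q ^ k * t / 2) + \<eta>) + (10 ^ 8 * ?F + \<eta>) / (q ^ n * t) \<le> K * \<Phi> + e" by linarith
  have "emeasure lebesgue (Hset g (K * \<Phi> + e)) \<le> emeasure lebesgue (Hset g (K * (\<Sum>k<n. S (q ^ k * t / 2) + \<eta>) + (10 ^ 8 * ?F + \<eta>) / (q ^ n * t)))"
    by (intro emeasure_mono Hset_antimono le sets_Mset_Hset g(1))
  also have "\<dots> \<le> ennreal t" by (rule Hset_iterate[OF q K good g S \<eta>(1) t])
  finally show ?thesis .
qed

lemma emeasure_real_dense_le:
  fixes A B :: ennreal
  assumes "A \<le> 2" "\<And>t. 0 < t \<Longrightarrow> t < 2 \<Longrightarrow> ennreal t < A \<Longrightarrow> ennreal t \<le> B"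
  shows "A \<le> B"
proof (rule dense_le)
  fix y assume y: "y < A"
  show "y \<le> B"
  proof (cases "y = 0")
    case False
    have "y < 2" using y assms(1) by (rule less_le_trans)
    then obtain t where t: "y = ennreal t" "0 \<le> t" by (cases y) auto
    have "0 < t" using False t by (cases "t = 0") auto
    moreover have "t < 2" using \<open>y < 2\<close> t by (simp add: ennreal_less_numeral_iff)
    ultimately show ?thesis using assms(2)[of t] y t by simp
  qed simp
qed

text \<open>D says that G lies above the rearrangement of the transform. Any t below the measure of
  the set where the transform exceeds s then has s < G t, and by monotonicity
  \<open>even_fun G\<close> exceeds s on the interval of length t around 0, the point 0
  excepted.\<close>

lemma hilbert_le_even_fun:
  assumes \<rho>: "ri_space \<rho>" and f: "f \<in> L1" and G: "decr_fun G"
    and D: "\<And>t. 0 < t \<Longrightarrow> t < 2 \<Longrightarrow> distr_fun (hilbert f) (G t) \<le> ennreal t"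
  shows "\<rho> (hilbert f) \<le> \<rho> (even_fun G)"
proof (rule ri_distr_le[OF \<rho> even_fun_L0[OF G] hilbert_measurable[OF f]])
  fix s :: real assume s: "0 \<le> s"
  show "distr_fun (hilbert f) s \<le> distr_fun (even_fun G) s"
  proof (rule emeasure_real_dense_le[OF distr_fun_le_2])
    fix t :: real assume t: "0 < t" "t < 2" and less: "ennreal t < distr_fun (hilbert f) s"
    have Gs: "s < G t"
    proof (rule ccontr)
      assume "\<not> ?thesis"
      then have "distr_fun (hilbert f) s \<le> distr_fun (hilbert f) (G t)"
        by (intro distr_fun_mono hilbert_measurable f) simp
      also have "\<dots> \<le> ennreal t" by (rule D[OF t])
      finally show False using less by simp
    qed
    have "ennreal t = emeasure lebesgue {- (t/2) .. t/2}" using t by simp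
    also have "\<dots> \<le> emeasure lebesgue ({x. -1 < x \<and> x < 1 \<and> s < cmod (even_fun G x)} \<union> {0})"
    proof (intro emeasure_mono subsetI)
      fix x assume x: "x \<in> {- (t/2) .. t/2}"
      show "x \<in> {x. -1 < x \<and> x < 1 \<and> s < cmod (even_fun G x)} \<union> {0}"
      proof (cases "x = 0")
        case False
        have "2 * \<bar>x\<bar> \<le> t" using x by auto
        then have "G t \<le> G (2 * \<bar>x\<bar>)" using False by (intro decr_funD(2)[OF G]) auto
        then show ?thesis using False x t Gs by (simp add: cmod_even_fun[OF G])
      qed simp
    qed (intro sets.Un sets_level even_fun_L0 G, simp)
    also have "\<dots> \<le> emeasure lebesgue {x. -1 < x \<and> x < 1 \<and> s < cmod (even_fun G x)} + emeasure lebesgue {0::real}"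
      by (intro emeasure_subadditive sets_level even_fun_L0 G) simp
    also have "emeasure lebesgue {0::real} = 0" by simp
    finally show "ennreal t \<le> distr_fun (even_fun G) s" by (simp only: distr_fun_lebesgue add_0_right)
  qed
qed

text \<open>The level of the maximal Hilbert transform at t sums levels S (q^k t) of the maximal
  function up to a factor, and each S is a series over t/B^j. After exchange of the sums, R collects
  the q-scales with ratio \<theta> < 1, and \<Phi> collects the B-scales of R with ratio \<tau>/B <
  1.\<close>

lemma hilbert_bounded:
  assumes \<rho>: "ri_space \<rho>" and low: "0 < boyd_lower \<rho>" and up: "boyd_upper \<rho> < 1"
  obtains C :: real where "0 \<le> C" "\<And>f. f \<in> bfs_space \<rho> \<Longrightarrow> f \<in> L1 \<and> \<rho> (hilbert f) \<le> ennreal C * \<rho> f"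
proof -
  note b = ri_bfs[OF \<rho>]
  obtain q \<theta> where q: "1 < q" "0 \<le> \<theta>" "\<theta> < 1" "dil_norm \<rho> q \<le> ennreal \<theta>" by (rule boyd_lower_pos[OF \<rho> low])
  obtain B \<tau> where B: "1 < B" "0 \<le> \<tau>" "\<tau> < B" "dil_norm \<rho> (1 / B) \<le> ennreal \<tau>" by (rule boyd_upper_less_1[OF \<rho> up])
  obtain K where K: "0 < K" and good: "\<And>f a b. integrable lebesgue f \<Longrightarrow> (\<And>u. u \<notin> {-1<..<1} \<Longrightarrow> f u = 0) \<Longrightarrow> 0 < a \<Longrightarrow> 0 < b \<Longrightarrow>
      emeasure lebesgue (Hset f (a + K * b)) \<le> emeasure lebesgue (Mset f b) + ennreal (1 / (2 * q)) * emeasure lebesgue (Hset f a)"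
  proof (rule good_lambda)
    show "0 < 1 / (2 * q)" using q(1) by simp
  next
    fix K :: real
    assume "0 < K" "\<And>f a b. integrable lebesgue f \<Longrightarrow> (\<And>u. u \<notin> {-1<..<1} \<Longrightarrow> f u = 0) \<Longrightarrow> 0 < a \<Longrightarrow> 0 < b \<Longrightarrow>
      emeasure lebesgue (Hset f (a + K * b)) \<le> emeasure lebesgue (Mset f b) + ennreal (1 / (2 * q)) * emeasure lebesgue (Hset f a)"
    then show thesis by (rule that)
  qed
  let ?\<beta> = "1 / B"
  have \<beta>: "0 < ?\<beta>" "?\<beta> < 1" using B by auto
  have sumR: "summable (\<lambda>k. \<theta> ^ k)" using q by (intro summable_geometric) auto
  define cR where "cR = (\<Sum>k. \<theta> ^ k)"
  have cR0: "0 \<le> cR" unfolding cR_def using q by (intro suminf_nonneg sumR) auto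
  have sumP: "summable (\<lambda>j. (?\<beta> * \<tau>) ^ j)" using B by (intro summable_geometric) auto
  define cP where "cP = (\<Sum>j. (?\<beta> * \<tau>) ^ j)"
  have cP0: "0 \<le> cP" unfolding cP_def using B by (intro suminf_nonneg sumP) auto
  define K3 where "K3 = 96 * K + 96"
  have K30: "0 \<le> K3" using K by (simp add: K3_def)
  \<comment> \<open>cR and cP are the two geometric sums, the extra \<tau> comes from the exponent
    Suc j, the 4 from a final dilation by 1/4, and K3 joins the conjugate transform (96 K) with the
    Poisson correction (96).\<close>
  define C where "C = 4 * (K3 * (cP * (\<tau> * cR)))"
  have "f \<in> L1 \<and> \<rho> (hilbert f) \<le> ennreal C * \<rho> f" if fX: "f \<in> bfs_space \<rho>" for f
  proof -
    have f: "f \<in> L0" and fin: "\<rho> f < \<infinity>" using fX by (auto simp: bfs_space_def)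
    define r where "r = enn2real (\<rho> f)"
    have r: "\<rho> f = ennreal r" "0 \<le> r" using fin by (auto simp: r_def)
    let ?d = "dec_rearr f"
    have dd: "decr_fun ?d" by (rule decr_fun_dec_rearr[OF f])
    have q0: "0 < q" using q by simp
    have "\<rho> (even_fun ?d) \<le> ennreal r" using even_fun_dec_rearr_le[OF \<rho> f] r by simp
    note it1 = even_fun_iterate[OF \<rho> dd q0 _ q(2,4) r(2) this]
    have itR: "\<rho> (even_fun (\<lambda>t. ?d (q ^ k * t))) \<le> ennreal (\<theta> ^ k * r)" for k
      by (rule it1) (use dec_rearr_ge_2[OF f] in blast)
    have ddq: "decr_fun (\<lambda>t. ?d (q ^ k * t))" for k using q0 by (intro decr_fun_scale dd) simp
    have nn1: "0 \<le> \<theta> ^ k * r" for k using q r by simp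
    define R where "R t = (\<Sum>k. ?d (q ^ k * t))" for t
    note sR = even_fun_suminf[OF b ddq nn1 summable_mult2[OF sumR, of r] itR]
    have smR: "summable (\<lambda>k. ?d (q ^ k * t))" if "0 < t" for t using sR(1)[OF that] .
    have dR: "decr_fun R" unfolding R_def using sR(2) .
    have nR: "\<rho> (even_fun R) \<le> ennreal (cR * r)"
      using sR(3) unfolding R_def cR_def suminf_mult2[OF sumR, of r] .
    have R2: "?\<beta> \<ge> 1 \<Longrightarrow> \<forall>t\<ge>2. R t = 0" using \<beta> by simp
    note it2 = even_fun_iterate[OF \<rho> dR \<beta>(1) R2 B(2,4) mult_nonneg_nonneg[OF cR0 r(2)] nR]
    define \<Phi> where "\<Phi> t = (\<Sum>j. ?\<beta> ^ j * R (?\<beta> ^ Suc j * t))" for t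
    have dRb: "decr_fun (\<lambda>t. ?\<beta> ^ j * R (?\<beta> ^ Suc j * t))" for j
      using \<beta> by (intro decr_fun_cmult decr_fun_scale dR) auto
    have nP: "\<rho> (even_fun (\<lambda>t. ?\<beta> ^ j * R (?\<beta> ^ Suc j * t))) \<le> ennreal ((?\<beta> * \<tau>) ^ j * (\<tau> * (cR * r)))" for j
    proof -
      have "even_fun (\<lambda>t. ?\<beta> ^ j * R (?\<beta> ^ Suc j * t)) = (\<lambda>x. complex_of_real (?\<beta> ^ j) * even_fun (\<lambda>t. R (?\<beta> ^ Suc j * t)) x)"
        by (auto simp: even_fun_def fun_eq_iff)
      then have "\<rho> (even_fun (\<lambda>t. ?\<beta> ^ j * R (?\<beta> ^ Suc j * t))) = ennreal (cmod (complex_of_real (?\<beta> ^ j))) * \<rho> (even_fun (\<lambda>t. R (?\<beta> ^ Suc j * t)))"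
        using \<beta> by (simp only: bfs_scale[OF b even_fun_L0[OF decr_fun_scale[OF dR]]] zero_less_power)
      also have "cmod (complex_of_real (?\<beta> ^ j)) = ?\<beta> ^ j" using \<beta>(1) by (simp only: norm_of_real abs_of_pos zero_less_power)
      also have "ennreal (?\<beta> ^ j) * \<rho> (even_fun (\<lambda>t. R (?\<beta> ^ Suc j * t))) \<le> ennreal (?\<beta> ^ j) * ennreal (\<tau> ^ Suc j * (cR * r))"
        by (intro mult_left_mono it2) simp_all
      also have "\<dots> = ennreal (?\<beta> ^ j * (\<tau> ^ Suc j * (cR * r)))"
        using \<beta>(1) B(2) cR0 r(2) by (intro ennreal_mult[symmetric] mult_nonneg_nonneg zero_le_power) auto
      also have "?\<beta> ^ j * (\<tau> ^ Suc j * (cR * r)) = (?\<beta> * \<tau>) ^ j * (\<tau> * (cR * r))"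
        by (simp only: power_mult_distrib power_Suc mult_ac)
      finally show ?thesis .
    qed
    have nn2: "0 \<le> (?\<beta> * \<tau>) ^ j * (\<tau> * (cR * r))" for j using B cR0 r by simp
    note sP = even_fun_suminf[OF b dRb nn2 summable_mult2[OF sumP] nP]
    have smP: "summable (\<lambda>j. ?\<beta> ^ j * R (?\<beta> ^ Suc j * t))" if "0 < t" for t using sP(1)[OF that] .
    have dP: "decr_fun \<Phi>" unfolding \<Phi>_def using sP(2) .
    have nPhi: "\<rho> (even_fun \<Phi>) \<le> ennreal (cP * (\<tau> * (cR * r)))"
      using sP(3) unfolding \<Phi>_def cP_def suminf_mult2[OF sumP, of "\<tau> * (cR * r)"] .
    \<comment> \<open>Up to the factor 96, the level of the maximal function at scale t. Its series
      is dominated termwise by that of \<Phi>, which provides summability.\<close>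
    define S where "S t = (\<Sum>j. ?\<beta> ^ j * ?d (?\<beta> ^ Suc j * t))" for t
    have bt: "0 < ?\<beta> ^ j * t" if "0 < t" for j t using that \<beta> by simp
    have sumdR: "(\<Sum>k<n. ?d (q ^ k * t)) \<le> R t" if "0 < t" for n t
      unfolding R_def using q0 that by (intro sum_le_suminf smR dec_rearr_nonneg[OF f]) auto
    have smS: "summable (\<lambda>j. ?\<beta> ^ j * ?d (?\<beta> ^ Suc j * t))" if t: "0 < t" for t
    proof (rule summable_comparison_test[OF _ smP[OF t]])
      have "norm (?\<beta> ^ j * ?d (?\<beta> ^ Suc j * t)) \<le> ?\<beta> ^ j * R (?\<beta> ^ Suc j * t)" for j
      proof -
        have "?d (?\<beta> ^ Suc j * t) \<le> R (?\<beta> ^ Suc j * t)" using sumdR[OF bt[OF t, of "Suc j"], of 1] by simp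
        moreover have "0 \<le> ?d (?\<beta> ^ Suc j * t)" by (rule dec_rearr_nonneg[OF f bt[OF t]])
        moreover have "0 \<le> ?\<beta> ^ j" using \<beta>(1) by (intro zero_le_power) simp
        ultimately show ?thesis unfolding real_norm_def abs_mult by (intro mult_mono) simp_all
      qed
      then show "\<exists>N. \<forall>j\<ge>N. norm (?\<beta> ^ j * ?d (?\<beta> ^ Suc j * t)) \<le> ?\<beta> ^ j * R (?\<beta> ^ Suc j * t)" by blast
    qed
    have S0: "0 \<le> S t" if "0 < t" for t
      unfolding S_def using \<beta>(1)
      by (intro suminf_nonneg smS that mult_nonneg_nonneg dec_rearr_nonneg[OF f bt[OF that]] zero_le_power) simp
    \<comment> \<open>Finitely many k may be interchanged with the series in j; the inner sum over k
      is then bounded by R.\<close>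
    have sumS: "(\<Sum>k<n. S (q ^ k * t)) \<le> \<Phi> t" if t: "0 < t" for n t
    proof -
      have qt: "0 < q ^ k * t" for k using q0 t by simp
      have "(\<Sum>k<n. S (q ^ k * t)) = (\<Sum>j. \<Sum>k<n. ?\<beta> ^ j * ?d (?\<beta> ^ Suc j * (q ^ k * t)))"
        unfolding S_def by (intro suminf_sum[symmetric] smS qt)
      also have "\<dots> \<le> \<Phi> t"
        unfolding \<Phi>_def
      proof (intro suminf_le summable_sum smS qt smP t)
        fix j
        have "(\<Sum>k<n. ?\<beta> ^ j * ?d (?\<beta> ^ Suc j * (q ^ k * t))) = ?\<beta> ^ j * (\<Sum>k<n. ?d (q ^ k * (?\<beta> ^ Suc j * t)))"
          by (simp only: sum_distrib_left mult.left_commute)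
        also have "\<dots> \<le> ?\<beta> ^ j * R (?\<beta> ^ Suc j * t)"
          using \<beta>(1) by (intro mult_left_mono sumdR bt t zero_le_power) simp
        finally show "(\<Sum>k<n. ?\<beta> ^ j * ?d (?\<beta> ^ Suc j * (q ^ k * t))) \<le> ?\<beta> ^ j * R (?\<beta> ^ Suc j * t)" .
      qed
      finally show ?thesis .
    qed
    \<comment> \<open>\<open>dec_rearr f 2\<close> is 0, so the estimate for the large part of f at
      t = 2 covers all of f.\<close>
    have fL1: "f \<in> L1"
    proof -
      have "(\<integral>\<^sup>+x. ennreal (cmod (f x)) \<partial>M1) = (\<integral>\<^sup>+x. ennreal (cmod (f x)) * indicator {x. ?d 2 < cmod (f x)} x \<partial>M1)"
        using dec_rearr_ge_2[OF f order_refl] by (intro nn_integral_cong) (auto simp: indicator_def)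
      also have "\<dots> \<le> ennreal (2 * S 2)"
        unfolding S_def using smS[of 2] by (intro nn_integral_large_le[OF f _ B(1)]) auto
      also have "\<dots> < \<infinity>" by (simp only: infinity_ennreal_def ennreal_less_top)
      finally have "(\<integral>\<^sup>+x. ennreal (cmod (f x)) \<partial>M1) < \<infinity>" .
      then show ?thesis using f unfolding L1_def L0_def mem_Collect_eq integrable_iff_bounded by blast
    qed
    let ?g = "ext f"
    have g: "integrable lebesgue ?g" "\<And>u. u \<notin> {-1<..<1} \<Longrightarrow> ?g u = 0"
      using fL1 by (auto simp: L1_iff ext_outside)
    have M: "emeasure lebesgue (Mset ?g (96 * S t + e)) \<le> ennreal t" if "0 < t" "0 < e" for t e
      unfolding S_def by (rule emeasure_Mset_rearr_le[OF fL1 that(1) B(1) smS[OF that(1)] that(2)])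
    have S960: "0 \<le> 96 * S t" if "0 < t" for t using S0[OF that] by simp
    have H: "emeasure lebesgue (Hset ?g (K * (96 * \<Phi> (t / 2)) + e)) \<le> ennreal t" if t: "0 < t" and e: "0 < e" for t e
    proof (rule Hset_le_limit[where S="\<lambda>t. 96 * S t" and q=q])
      show "(\<Sum>k<n. 96 * S (q ^ k * t / 2)) \<le> 96 * \<Phi> (t / 2)" for n
        using sumS[of "t / 2" n] t by (simp only: sum_distrib_left[symmetric] times_divide_eq_right) simp
    qed (use q(1) K good g M S960 t e in blast)+
    \<comment> \<open>The budget is t/2 for the conjugate transform, whose level then involves
      \<Phi> (t/4), and t/4 for the Poisson correction; e is shared equally.\<close>
    have D: "distr_fun (hilbert f) (K3 * \<Phi> (t / 4)) \<le> ennreal t" if t: "0 < t" for t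
    proof (rule distr_fun_right_cont[OF hilbert_measurable[OF fL1]])
      fix e :: real assume e: "0 < e"
      let ?l = "K3 * \<Phi> (t / 4) + e"
      let ?H = "Hset ?g (K * (96 * \<Phi> (t / 4)) + e / 2)"
      let ?M = "Mset ?g (96 * S (t / 4) + e / 2)"
      have SP: "S (t / 4) \<le> \<Phi> (t / 4)" using sumS[of "t / 4" 1] t by simp
      have "K * (96 * \<Phi> (t / 4)) + e / 2 + (96 * S (t / 4) + e / 2) \<le> ?l"
        using SP by (simp add: K3_def algebra_simps)
      then have sub: "Tset ?g ?l \<subseteq> ?H \<union> ?M" by (rule Tset_subset[OF g(1)])
      have "AE x in lebesgue. x \<in> {x. -1 < x \<and> x < 1 \<and> ?l < cmod (hilbert f x)} \<longrightarrow> x \<in> ?H \<union> ?M"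
        using hilbert_Tset[OF fL1] by eventually_elim (use sub in blast)
      then have "distr_fun (hilbert f) ?l \<le> emeasure lebesgue (?H \<union> ?M)"
        unfolding distr_fun_lebesgue by (intro emeasure_mono_AE sets.Un sets_Mset_Hset g)
      also have "\<dots> \<le> emeasure lebesgue ?H + emeasure lebesgue ?M"
        by (intro emeasure_subadditive sets_Mset_Hset g)
      also have "\<dots> \<le> ennreal (t / 2) + ennreal (t / 4)"
        using H[of "t / 2" "e / 2"] M[of "t / 4" "e / 2"] t e by (intro add_mono) simp_all
      also have "\<dots> = ennreal (t / 2 + t / 4)" using t by (intro ennreal_plus[symmetric]) auto
      also have "\<dots> \<le> ennreal t" using t by (intro ennreal_leI) simp
      finally show "distr_fun (hilbert f) (K3 * \<Phi> (t / 4) + e) \<le> ennreal t" .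
    qed
    have dG: "decr_fun (\<lambda>t. K3 * \<Phi> (1 / 4 * t))"
      using K30 by (intro decr_fun_cmult decr_fun_scale dP) auto
    have "\<rho> (hilbert f) \<le> \<rho> (even_fun (\<lambda>t. K3 * \<Phi> (1 / 4 * t)))"
      by (rule hilbert_le_even_fun[OF \<rho> fL1 dG]) (use D in simp)
    also have "even_fun (\<lambda>t. K3 * \<Phi> (1 / 4 * t)) = (\<lambda>x. complex_of_real K3 * even_fun (\<lambda>t. \<Phi> (1 / 4 * t)) x)"
      by (auto simp: even_fun_def fun_eq_iff)
    also have "\<rho> \<dots> = ennreal K3 * \<rho> (even_fun (\<lambda>t. \<Phi> (1 / 4 * t)))"
      using K30 bfs_scale[OF b even_fun_L0[OF decr_fun_scale[OF dP, of "1/4"]], of "complex_of_real K3"] by simp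
    also have "\<rho> (even_fun (\<lambda>t. \<Phi> (1 / 4 * t))) = \<rho> (dil (1 / 4) (even_fun \<Phi>))"
      by (rule even_fun_dil[OF \<rho> dP]) auto
    also have "\<rho> (dil (1 / 4) (even_fun \<Phi>)) \<le> ennreal 4 * \<rho> (even_fun \<Phi>)"
      using dil_inverse_nat_le[OF \<rho> even_fun_L0[OF dP], of 4] by simp
    also have "\<dots> \<le> ennreal 4 * ennreal (cP * (\<tau> * (cR * r)))"
      by (intro mult_left_mono nPhi) simp
    finally have "\<rho> (hilbert f) \<le> ennreal K3 * (ennreal 4 * ennreal (cP * (\<tau> * (cR * r))))"
      by (simp add: mult_left_mono)
    also have "\<dots> = ennreal (K3 * (4 * (cP * (\<tau> * (cR * r)))))"
    proof -
      have n: "0 \<le> cP * (\<tau> * (cR * r))" using cP0 B(2) cR0 r(2) by (intro mult_nonneg_nonneg)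
      have "ennreal 4 * ennreal (cP * (\<tau> * (cR * r))) = ennreal (4 * (cP * (\<tau> * (cR * r))))"
        using n by (intro ennreal_mult[symmetric]) auto
      then show ?thesis using n K30 by (simp only: ennreal_mult[of K3] zero_le_numeral mult_nonneg_nonneg)
    qed
    also have "K3 * (4 * (cP * (\<tau> * (cR * r)))) = C * r" by (simp only: C_def mult_ac)
    also have "ennreal (C * r) = ennreal C * \<rho> f"
    proof -
      have "0 \<le> C" unfolding C_def using K30 cP0 B(2) cR0 by (intro mult_nonneg_nonneg) auto
      then show ?thesis using r by (simp add: ennreal_mult)
    qed
    finally show ?thesis using fL1 by blast
  qed
  moreover have "0 \<le> C" unfolding C_def using K30 cP0 B(2) cR0 by (intro mult_nonneg_nonneg) auto
  ultimately show ?thesis using that by blast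
qed

section \<open>The optimal domain\<close>

lemma L1_L0: "f \<in> L1 \<Longrightarrow> f \<in> L0"
  by (auto simp: L1_def L0_def)

lemma L1_dominated:
  assumes "f \<in> L1" "h \<in> L0" "AE x in M1. cmod (h x) \<le> cmod (f x)"
  shows "h \<in> L1"
  using assms unfolding L1_def L0_def mem_Collect_eq by (blast intro: Bochner_Integration.integrable_bound)

text \<open>The Fatou property, applied along an almost everywhere convergent subsequence of
  transforms, gives lower semicontinuity with respect to L^1 convergence.\<close>

lemma hilbert_lsc:
  assumes \<rho>: "bfs \<rho>" and f: "f \<in> L1" "\<And>k. F k \<in> L1"
    and lim: "(\<lambda>k. LINT x|M1. norm (F k x - f x)) \<longlonglongrightarrow> 0" and le: "\<And>k. \<rho> (hilbert (F k)) \<le> m"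
  shows "\<rho> (hilbert f) \<le> m"
proof -
  obtain r :: "nat \<Rightarrow> nat" where "AE x in M1. (\<lambda>k. hilbert (F (r k)) x) \<longlonglongrightarrow> hilbert f x"
    using hilbert_tendsto_L1[OF f lim] by blast
  then show ?thesis
    by (rule bfs_liminf_le[OF \<rho> hilbert_measurable[OF f(2)] hilbert_measurable[OF f(1)] _ le])
qed

text \<open>Off the support of a nonnegative function the principal value is an ordinary integral of constant sign.\<close>

lemma hilbert_off_support:
  fixes w :: "real \<Rightarrow> real" and \<sigma> :: real
  assumes w: "integrable lebesgue w" "\<And>u. 0 \<le> w u" and eh: "ext h = (\<lambda>u. complex_of_real (w u))"
    and \<sigma>: "\<bar>\<sigma>\<bar> = 1" and \<delta>: "0 < \<delta>" and supp: "\<And>u. w u \<noteq> 0 \<Longrightarrow> \<delta> < \<sigma> * (u - t) \<and> \<sigma> * (u - t) \<le> 2"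
  shows "(LINT u|lebesgue. w u) / (2 * pi) \<le> cmod (hilbert h t)"
proof -
  have abs: "\<bar>u - t\<bar> = \<sigma> * (u - t)" if "w u \<noteq> 0" for u
  proof -
    have "\<bar>\<sigma> * (u - t)\<bar> = \<bar>u - t\<bar>" using \<sigma> by (simp add: abs_mult)
    then show ?thesis using supp[OF that] \<delta> by simp
  qed
  define c where "c = complex_of_real (1 / pi) * kconv (hk \<delta>) (ext h) t"
  have "((\<lambda>\<epsilon>. complex_of_real (1 / pi) * kconv (hk \<epsilon>) (ext h) t) \<longlongrightarrow> c) (at_right 0)"
  \<comment> \<open>Once \<epsilon> is below \<delta>, the truncation removes nothing from the
    support, so the truncated integrals are constant.\<close>
  proof (rule tendsto_eventually)
    have "\<forall>\<^sub>F \<epsilon> in at_right 0. \<epsilon> < \<delta>" using \<delta> by (auto simp: eventually_at_right)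
    then show "\<forall>\<^sub>F \<epsilon> in at_right 0. complex_of_real (1 / pi) * kconv (hk \<epsilon>) (ext h) t = c"
    proof eventually_elim
      case (elim \<epsilon>)
      have "hk \<epsilon> (u - t) *\<^sub>R ext h u = hk \<delta> (u - t) *\<^sub>R ext h u" for u
        using supp[of u] abs[of u] elim by (cases "w u = 0") (auto simp: eh hk_def)
      then have "(\<lambda>u. hk \<epsilon> (u - t) *\<^sub>R ext h u) = (\<lambda>u. hk \<delta> (u - t) *\<^sub>R ext h u)" by (rule HOL.ext)
      then show ?case unfolding c_def kconv_def by (simp only:)
    qed
  qed
  then have "hilbert h t = c" unfolding hilbert_eq_kconv by (intro tendsto_Lim) auto
  moreover have "kconv (hk \<delta>) (ext h) t = complex_of_real (kconv (hk \<delta>) w t)"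
    unfolding kconv_def eh by (simp add: scaleR_conv_of_real flip: integral_complex_of_real)
  moreover have "(LINT u|lebesgue. w u) / 2 \<le> \<bar>kconv (hk \<delta>) w t\<bar>"
  proof -
    have i: "integrable lebesgue (\<lambda>u. hk \<delta> (u - t) *\<^sub>R w u)"
      by (rule integrable_kernel[OF kernel_measurable(3) kernel_bounds(3)[OF \<delta>] w(1)])
    have "(LINT u|lebesgue. w u / 2) \<le> (LINT u|lebesgue. \<sigma> * (hk \<delta> (u - t) *\<^sub>R w u))"
    proof (intro integral_mono)
      fix u
      show "w u / 2 \<le> \<sigma> * (hk \<delta> (u - t) *\<^sub>R w u)"
      proof (cases "w u = 0")
        case False
        have s: "\<delta> < \<sigma> * (u - t)" "\<sigma> * (u - t) \<le> 2" using supp[OF False] by auto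
        have "\<sigma> * (1 / (u - t)) = 1 / (\<sigma> * (u - t))"
        proof -
          have "\<sigma> = 1 \<or> \<sigma> = -1" using \<sigma> by (auto simp: abs_if split: if_splits)
          then show ?thesis by (elim disjE) (simp_all add: minus_divide_right)
        qed
        \<comment> \<open>The distance from t to the support is at most 2, so the kernel is at least
          1/2 in modulus; this is the 2 in the final bound.\<close>
        also have "1 / 2 \<le> 1 / (\<sigma> * (u - t))" using s \<delta> by (intro divide_left_mono) auto
        finally have "1 / 2 \<le> \<sigma> * (1 / (u - t))" by simp
        then have "1 / 2 * w u \<le> \<sigma> * (1 / (u - t)) * w u" using w(2) by (intro mult_right_mono)
        moreover have "hk \<delta> (u - t) = 1 / (u - t)" using s(1) abs[OF False] by (simp add: hk_def)
        ultimately show ?thesis by (simp add: mult.assoc)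
      qed simp
    qed (use w i in auto)
    also have "\<dots> = \<sigma> * kconv (hk \<delta>) w t" by (simp add: kconv_def)
    also have "\<dots> \<le> \<bar>\<sigma> * kconv (hk \<delta>) w t\<bar>" by simp
    also have "\<dots> = \<bar>kconv (hk \<delta>) w t\<bar>" using \<sigma> by (simp add: abs_mult)
    finally show ?thesis by simp
  qed
  ultimately have cm: "cmod (hilbert h t) = 1 / pi * \<bar>kconv (hk \<delta>) w t\<bar>"
    and le: "(LINT u|lebesgue. w u) / 2 \<le> \<bar>kconv (hk \<delta>) w t\<bar>"
    by (simp_all only: c_def norm_mult norm_of_real) simp
  have "(LINT u|lebesgue. w u) / (2 * pi) = 1 / pi * ((LINT u|lebesgue. w u) / 2)" by simp
  also have "\<dots> \<le> 1 / pi * \<bar>kconv (hk \<delta>) w t\<bar>" by (intro mult_left_mono le) simp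
  also have "\<dots> = cmod (hilbert h t)" by (rule cm[symmetric])
  finally show ?thesis .
qed

section \<open>The norm of [T,X]: first properties, comparison with L^1, finiteness\<close>

lemma TX_norm_ge:
  assumes "f \<in> TX \<rho>" "h \<in> L0" "AE x in M1. cmod (h x) \<le> cmod (f x)"
  shows "\<rho> (hilbert h) \<le> TX_norm \<rho> f"
  using assms unfolding TX_norm_def by (auto intro!: Sup_upper)

lemma TX_norm_le:
  assumes "f \<in> TX \<rho>" "\<And>h. h \<in> L0 \<Longrightarrow> AE x in M1. cmod (h x) \<le> cmod (f x) \<Longrightarrow> \<rho> (hilbert h) \<le> m"
  shows "TX_norm \<rho> f \<le> m"
  using assms unfolding TX_norm_def by (auto intro!: Sup_least)

lemma TX_I:
  assumes "f \<in> L1" "m < \<infinity>" "\<And>h. h \<in> L0 \<Longrightarrow> AE x in M1. cmod (h x) \<le> cmod (f x) \<Longrightarrow> \<rho> (hilbert h) \<le> m"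
  shows "f \<in> TX \<rho>"
  unfolding TX_def bfs_space_def using assms hilbert_measurable L1_dominated[OF assms(1)]
  by (auto intro: le_less_trans)

lemma TX_subset: "f \<in> TX \<rho> \<Longrightarrow> f \<in> L1"
  by (simp add: TX_def)

lemma TX_dominated:
  assumes "f \<in> TX \<rho>" "g \<in> L0" "AE x in M1. cmod (g x) \<le> cmod (f x)"
  shows "g \<in> TX \<rho>"
proof -
  have "g \<in> L1" by (rule L1_dominated[OF TX_subset[OF assms(1)] assms(2,3)])
  moreover have "hilbert h \<in> bfs_space \<rho>" if "h \<in> L0" "AE x in M1. cmod (h x) \<le> cmod (g x)" for h
  proof -
    have "AE x in M1. cmod (h x) \<le> cmod (f x)" using that(2) assms(3) by eventually_elim simp
    then show ?thesis using assms(1) that(1) by (simp add: TX_def)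
  qed
  ultimately show ?thesis by (simp add: TX_def)
qed

lemma TX_norm_ideal:
  assumes "f \<in> L0" "g \<in> L0" "AE x in M1. cmod (g x) \<le> cmod (f x)"
  shows "TX_norm \<rho> g \<le> TX_norm \<rho> f"
proof (cases "f \<in> TX \<rho>")
  case True
  show ?thesis
  proof (rule TX_norm_le[OF TX_dominated[OF True assms(2,3)]])
    fix h assume h: "h \<in> L0" "AE x in M1. cmod (h x) \<le> cmod (g x)"
    have "AE x in M1. cmod (h x) \<le> cmod (f x)" using h(2) assms(3) by eventually_elim simp
    then show "\<rho> (hilbert h) \<le> TX_norm \<rho> f" by (rule TX_norm_ge[OF True h(1)])
  qed
qed (simp add: TX_norm_def)

text \<open>The test function is |f| restricted to A. On the interval from a to b, which lies to one
  side of A according to the sign \<sigma>, its transform is at least its mass over 2 \<pi>. The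
  separation \<delta> may depend on t, so the interval may touch A.\<close>

lemma TX_norm_half:
  assumes \<rho>: "bfs \<rho>" and f: "f \<in> TX \<rho>" and A: "A \<in> sets lebesgue" "A \<subseteq> {-1<..<1}"
    and J: "-1 \<le> a" "a < b" "b \<le> 1" and p: "ennreal p \<le> \<rho> (indicator {a<..<b})" "0 < p" and \<sigma>: "\<bar>\<sigma>\<bar> = 1"
    and sep: "\<And>t. t \<in> {a<..<b} \<Longrightarrow> \<exists>\<delta>>0. \<forall>u\<in>A. \<delta> < \<sigma> * (u - t)"
  shows "ennreal (LINT x|M1. indicator A x * cmod (f x)) \<le> ennreal (2 * pi / p) * TX_norm \<rho> f"
proof -
  define h where "h x = complex_of_real (indicator A x * cmod (f x))" for x
  have f0: "f \<in> L0" and f1: "f \<in> L1" using f TX_subset L1_L0 by auto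
  have h0: "h \<in> L0"
  proof -
    have "(\<lambda>x. complex_of_real (indicator A x * cmod (f x))) = (\<lambda>x. indicator A x * complex_of_real (cmod (f x)))"
      by (auto simp: fun_eq_iff indicator_def)
    then show ?thesis unfolding h_def[abs_def] using L0_intros(3)[OF L0_intros(6)[OF A(1)] L0_intros(4)[OF f0]] by simp
  qed
  have hf: "AE x in M1. cmod (h x) \<le> cmod (f x)" by (rule AE_I2) (simp add: h_def indicator_def)
  have h1: "h \<in> L1" by (rule L1_dominated[OF f1 h0 hf])
  define w where "w u = indicator A u * cmod (f u)" for u
  have eh: "ext h = (\<lambda>u. complex_of_real (w u))"
    using A(2) by (auto simp: ext_def h_def w_def fun_eq_iff indicator_def)
  have "norm (complex_of_real (w u)) = w u" for u unfolding norm_of_real by (simp add: w_def)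
  then have nw: "(\<lambda>u. norm (ext h u)) = w" unfolding eh by (intro HOL.ext)
  have wi: "integrable lebesgue w"
    using integrable_norm[of lebesgue "ext h"] h1 by (simp only: L1_iff nw)
  have W: "(LINT x|M1. indicator A x * cmod (f x)) = (LINT u|lebesgue. w u)"
  proof -
    have "(LINT x|M1. indicator A x * cmod (f x)) = (LINT x|M1. norm (h x))"
      unfolding h_def norm_of_real by (simp add: abs_mult)
    also have "\<dots> = (LINT u|lebesgue. norm (ext h u))" by (rule L1_integral_ext[symmetric])
    finally show ?thesis by (simp only: nw)
  qed
  let ?W = "LINT u|lebesgue. w u"
  have W0: "0 \<le> ?W" by (simp add: w_def)
  have JL: "(indicator {a<..<b} :: real \<Rightarrow> complex) \<in> L0" by (intro L0_intros(6)) auto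
  have "ennreal (?W / (2 * pi)) * ennreal p \<le> ennreal (cmod (of_real (?W / (2 * pi)))) * \<rho> (indicator {a<..<b})"
  proof (intro mult_mono p)
    show "ennreal (?W / (2 * pi)) \<le> ennreal (cmod (of_real (?W / (2 * pi))))"
      unfolding norm_of_real by (intro ennreal_leI abs_ge_self)
  qed auto
  also have "\<dots> = \<rho> (\<lambda>x. complex_of_real (?W / (2 * pi)) * indicator {a<..<b} x)"
    by (rule bfs_scale[OF \<rho> JL, symmetric])
  also have "\<dots> \<le> \<rho> (hilbert h)"
  proof (rule bfs_ideal[OF \<rho> hilbert_measurable[OF h1] L0_intros(3)[OF L0_intros(5) JL]], rule AE_I2)
    fix t
    show "cmod (complex_of_real (?W / (2 * pi)) * indicator {a<..<b} t) \<le> cmod (hilbert h t)"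
    proof (cases "t \<in> {a<..<b}")
      case True
      then obtain \<delta> where \<delta>: "0 < \<delta>" "\<And>u. u \<in> A \<Longrightarrow> \<delta> < \<sigma> * (u - t)" using sep by blast
      have "?W / (2 * pi) \<le> cmod (hilbert h t)"
      proof (rule hilbert_off_support[OF wi _ eh \<sigma> \<delta>(1)])
        fix u assume "w u \<noteq> 0"
        then have u: "u \<in> A" by (auto simp: w_def indicator_def split: if_splits)
        have "\<sigma> * (u - t) \<le> \<bar>\<sigma>\<bar> * \<bar>u - t\<bar>" by (metis abs_ge_self abs_mult)
        also have "\<dots> \<le> 2" using \<sigma> u A(2) True J by (auto simp: abs_le_iff)
        finally show "\<delta> < \<sigma> * (u - t) \<and> \<sigma> * (u - t) \<le> 2" using \<delta>(2)[OF u] by simp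
      qed (simp add: w_def)
      then show ?thesis using True W0 by (simp add: norm_divide)
    qed simp
  qed
  also have "\<dots> \<le> TX_norm \<rho> f" by (rule TX_norm_ge[OF f h0 hf])
  finally have "ennreal (?W / (2 * pi) * p) \<le> TX_norm \<rho> f"
    using W0 p(2) by (simp only: ennreal_mult divide_nonneg_pos less_imp_le pi_gt_zero mult_pos_pos zero_less_numeral)
  then have "ennreal (2 * pi / p) * ennreal (?W / (2 * pi) * p) \<le> ennreal (2 * pi / p) * TX_norm \<rho> f"
    by (intro mult_left_mono) auto
  moreover have "ennreal (2 * pi / p) * ennreal (?W / (2 * pi) * p) = ennreal (2 * pi / p * (?W / (2 * pi) * p))"
    using W0 p(2) by (intro ennreal_mult[symmetric]) auto
  moreover have "2 * pi / p * (?W / (2 * pi) * p) = ?W" using p(2) by simp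
  ultimately show ?thesis by (simp only: W)
qed

lemma L1_le_TX_norm:
  assumes \<rho>: "bfs \<rho>"
  obtains C :: real where "0 \<le> C" "\<And>f. f \<in> TX \<rho> \<Longrightarrow> ennreal (LINT x|M1. cmod (f x)) \<le> ennreal C * TX_norm \<rho> f"
proof -
  obtain p where p: "0 < p" "ennreal p \<le> \<rho> (indicator {0<..<1})"
    by (rule bfs_indicator_pos[OF \<rho>, of 0 1]) auto
  obtain p' where p': "0 < p'" "ennreal p' \<le> \<rho> (indicator {-1<..<0})"
    by (rule bfs_indicator_pos[OF \<rho>, of "-1" 0]) auto
  have "ennreal (LINT x|M1. cmod (f x)) \<le> ennreal (2 * pi / p + 2 * pi / p') * TX_norm \<rho> f" if f: "f \<in> TX \<rho>" for f
  proof -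
    have i: "integrable M1 (\<lambda>x. cmod (f x))" using TX_subset[OF f] by (simp add: L1_def)
    have sm: "{-1<..0::real} \<in> sets M1" "{0<..<1::real} \<in> sets M1"
      using sets_restrict_space_iff[of "{-1<..<1::real}" lebesgue]
      by (simp_all add: sets_restrict_space_iff subset_iff)
    have ii: "integrable M1 (\<lambda>x. indicator A x * cmod (f x))" if "A \<in> sets M1" for A
      using integrable_mult_indicator[OF that i] by simp
    have "(LINT x|M1. cmod (f x)) = (LINT x|M1. indicator {-1<..0} x * cmod (f x) + indicator {0<..<1} x * cmod (f x))"
      by (intro Bochner_Integration.integral_cong refl) (auto simp: indicator_def space_restrict_space)
    also have "\<dots> = (LINT x|M1. indicator {-1<..0} x * cmod (f x)) + (LINT x|M1. indicator {0<..<1} x * cmod (f x))"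
      by (intro Bochner_Integration.integral_add ii sm)
    finally have "ennreal (LINT x|M1. cmod (f x)) = ennreal (LINT x|M1. indicator {-1<..0} x * cmod (f x)) + ennreal (LINT x|M1. indicator {0<..<1} x * cmod (f x))"
      by (simp add: ennreal_plus)
    also have "\<dots> \<le> ennreal (2 * pi / p) * TX_norm \<rho> f + ennreal (2 * pi / p') * TX_norm \<rho> f"
    proof (rule add_mono)
      show "ennreal (LINT x|M1. indicator {-1<..0} x * cmod (f x)) \<le> ennreal (2 * pi / p) * TX_norm \<rho> f"
      proof (rule TX_norm_half[OF \<rho> f _ _ _ _ _ p(2,1), of _ "-1"])
        fix t :: real assume "t \<in> {0<..<1}"
        then show "\<exists>\<delta>>0. \<forall>u\<in>{-1<..0}. \<delta> < -1 * (u - t)" by (intro exI[of _ "t / 2"]) auto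
      qed auto
      show "ennreal (LINT x|M1. indicator {0<..<1} x * cmod (f x)) \<le> ennreal (2 * pi / p') * TX_norm \<rho> f"
      proof (rule TX_norm_half[OF \<rho> f _ _ _ _ _ p'(2,1), of _ 1])
        fix t :: real assume "t \<in> {-1<..<0}"
        then show "\<exists>\<delta>>0. \<forall>u\<in>{0<..<1}. \<delta> < 1 * (u - t)" by (intro exI[of _ "- t"]) auto
      qed auto
    qed
    also have "\<dots> = ennreal (2 * pi / p + 2 * pi / p') * TX_norm \<rho> f"
      using p(1) p'(1) by (subst ennreal_plus) (auto simp: distrib_right)
    finally show ?thesis .
  qed
  moreover have "0 \<le> 2 * pi / p + 2 * pi / p'" using p(1) p'(1) by simp
  ultimately show ?thesis using that by blast
qed

text \<open>The contrapositive of \<open>hilbert_lsc\<close>: a strict lower bound survives small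
  perturbations in L^1, so a hump once built is not destroyed by later corrections.\<close>

lemma hilbert_norm_lower_near:
  assumes \<rho>: "bfs \<rho>" and s: "s \<in> L1" and m: "m < \<rho> (hilbert s)"
  shows "\<exists>\<delta>>0. \<forall>y\<in>L1. (LINT x|M1. cmod (y x - s x)) \<le> \<delta> \<longrightarrow> m \<le> \<rho> (hilbert y)"
proof (rule ccontr)
  assume neg: "\<not> ?thesis"
  have "\<exists>y. y \<in> L1 \<and> (LINT x|M1. cmod (y x - s x)) \<le> 1 / real (Suc k) \<and> \<rho> (hilbert y) \<le> m" for k
  proof -
    have "0 < 1 / real (Suc k)" by simp
    then show ?thesis using neg by (meson linear not_le order.strict_implies_order)
  qed
  then obtain y where y: "\<And>k. y k \<in> L1" "\<And>k. (LINT x|M1. cmod (y k x - s x)) \<le> 1 / real (Suc k)" "\<And>k. \<rho> (hilbert (y k)) \<le> m"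
    by metis
  have "(\<lambda>k. LINT x|M1. cmod (y k x - s x)) \<longlonglongrightarrow> 0"
  proof (rule tendsto_sandwich[OF _ _ tendsto_const])
    show "(\<lambda>k. 1 / real (Suc k)) \<longlonglongrightarrow> 0"
      using LIMSEQ_inverse_real_of_nat by (simp add: inverse_eq_divide)
  qed (use y(2) in auto)
  then have "\<rho> (hilbert s) \<le> m" by (rule hilbert_lsc[OF \<rho> s y(1) _ y(3)])
  then show False using m by simp
qed

text \<open>A gliding hump: if the supremum were infinite, a rapidly convergent signed series of dominated
  functions would converge to a dominated function whose transform has infinite norm.\<close>

lemma TX_norm_finite:
  assumes \<rho>: "bfs \<rho>" and f: "f \<in> TX \<rho>"
  shows "TX_norm \<rho> f < \<infinity>"
proof (rule ccontr)
  assume "\<not> ?thesis"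
  then have inf: "TX_norm \<rho> f = \<infinity>" by (simp add: less_top[symmetric])
  have f1: "f \<in> L1" and f0: "f \<in> L0" using TX_subset[OF f] L1_L0 by auto
  have fi: "integrable M1 f" using f1 by (simp add: L1_def)
  let ?F = "LINT x|M1. cmod (f x)"
  have F0: "0 \<le> ?F" by simp
  have big: "\<exists>h\<in>L0. (AE x in M1. cmod (h x) \<le> cmod (f x)) \<and> ennreal r < \<rho> (hilbert h)" for r
  proof (rule ccontr)
    assume "\<not> ?thesis"
    then have "TX_norm \<rho> f \<le> ennreal r" by (intro TX_norm_le[OF f]) (auto simp: not_less)
    then show False using inf by (simp add: top_unique)
  qed
  \<comment> \<open>A stage consists of the partial sum and the share \<mu> of |f| still available.
    Every function within L^1 distance \<mu> times the norm of f of that sum already has a transform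
    of norm at least n.\<close>
  define P where "P n z \<longleftrightarrow> fst z \<in> L0 \<and> 0 < snd z \<and> snd z \<le> 1 \<and>
      (AE x in M1. cmod (fst z x) \<le> (1 - snd z) * cmod (f x)) \<and>
      (\<forall>y\<in>L1. (LINT x|M1. cmod (y x - fst z x)) \<le> snd z * ?F \<longrightarrow> ennreal (real n) \<le> \<rho> (hilbert y))"
    for n :: nat and z :: "(real \<Rightarrow> complex) \<times> real"
  \<comment> \<open>A correction uses at most half of the available share, and the share is at least
    halved; so all later corrections together stay within that share of |f|.\<close>
  define Q where "Q z z' \<longleftrightarrow> (AE x in M1. cmod (fst z' x - fst z x) \<le> snd z / 2 * cmod (f x)) \<and> snd z' \<le> snd z / 2"
    for z z' :: "(real \<Rightarrow> complex) \<times> real"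
  have "\<exists>Z. \<forall>n. P n (Z n) \<and> Q (Z n) (Z (Suc n))"
  proof (rule dependent_nat_choice)
    show "\<exists>z. P 0 z" by (rule exI[of _ "(\<lambda>_. 0, 1)"]) (simp add: P_def L0_intros)
  next
    fix z n assume Pz: "P n z"
    obtain s \<mu> where z: "z = (s, \<mu>)" by (cases z)
    have s: "s \<in> L0" "0 < \<mu>" "\<mu> \<le> 1" "AE x in M1. cmod (s x) \<le> (1 - \<mu>) * cmod (f x)"
      using Pz by (auto simp: P_def z)
    obtain h where h: "h \<in> L0" "AE x in M1. cmod (h x) \<le> cmod (f x)" "ennreal ((real n + 1) / (\<mu> / 2)) < \<rho> (hilbert h)"
      using big by blast
    have h1: "h \<in> L1" by (rule L1_dominated[OF f1 h(1,2)])
    have dom: "AE x in M1. cmod (s x) \<le> cmod (f x)"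
      using s(4)
    proof eventually_elim
      case (elim x)
      have "(1 - \<mu>) * cmod (f x) \<le> 1 * cmod (f x)" using s by (intro mult_right_mono) auto
      then show ?case using elim by simp
    qed
    have s1: "s \<in> L1" by (rule L1_dominated[OF f1 s(1) dom])
    define S where "S c x = s x + complex_of_real (c * (\<mu> / 2)) * h x" for c :: real and x
    have S1: "S c \<in> L1" for c using s1 h1 by (simp add: S_def[abs_def] L1_def)
    \<comment> \<open>If both signs failed, the difference \<mu> h of the two candidates would have
      a transform of norm at most 2 (n + 1), against the choice of h.\<close>
    have "\<exists>c\<in>{1,-1}. ennreal (real (Suc n)) < \<rho> (hilbert (S c))"
    proof (rule ccontr)
      assume "\<not> ?thesis"
      then have le: "\<rho> (hilbert (S 1)) \<le> ennreal (real (Suc n))" "\<rho> (hilbert (S (-1))) \<le> ennreal (real (Suc n))"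
        by (auto simp: not_less)
      have "\<rho> (hilbert (\<lambda>x. complex_of_real \<mu> * h x)) = \<rho> (\<lambda>x. hilbert (S 1) x + (-1) * hilbert (S (-1)) x)"
      proof (rule bfs_cong[OF \<rho>])
        have S1': "(\<lambda>x. (-1) * S (-1) x) \<in> L1" using S1[of "-1"] by (simp add: L1_def)
        show "hilbert (\<lambda>x. complex_of_real \<mu> * h x) \<in> L0"
          using h1 by (intro hilbert_measurable) (simp add: L1_def)
        show "(\<lambda>x. hilbert (S 1) x + (-1) * hilbert (S (-1)) x) \<in> L0"
          by (intro L0_intros hilbert_measurable S1)
        have eq: "(\<lambda>x. complex_of_real \<mu> * h x) = (\<lambda>x. S 1 x + (-1) * S (-1) x)"
          by (auto simp: S_def fun_eq_iff algebra_simps simp flip: distrib_right)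
        have "AE x in lebesgue. hilbert (\<lambda>x. complex_of_real \<mu> * h x) x = hilbert (S 1) x + hilbert (\<lambda>x. (-1) * S (-1) x) x"
          unfolding eq by (rule hilbert_add[OF S1 S1'])
        moreover have "AE x in lebesgue. hilbert (\<lambda>x. (-1) * S (-1) x) x = (-1) * hilbert (S (-1)) x"
          by (rule hilbert_cmult[OF S1])
        ultimately have "AE x in lebesgue. cmod (hilbert (\<lambda>x. complex_of_real \<mu> * h x) x) = cmod (hilbert (S 1) x + (-1) * hilbert (S (-1)) x)"
          by eventually_elim (simp only:)
        then show "AE x in M1. cmod (hilbert (\<lambda>x. complex_of_real \<mu> * h x) x) = cmod (hilbert (S 1) x + (-1) * hilbert (S (-1)) x)"
          by (rule AE_M1I)
      qed
      also have "\<dots> \<le> \<rho> (hilbert (S 1)) + \<rho> (\<lambda>x. (-1) * hilbert (S (-1)) x)"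
        by (intro bfs_triangle[OF \<rho>] L0_intros hilbert_measurable S1)
      also have "\<rho> (\<lambda>x. (-1) * hilbert (S (-1)) x) = \<rho> (hilbert (S (-1)))"
        by (subst bfs_scale[OF \<rho> hilbert_measurable[OF S1]]) simp
      also have "\<rho> (hilbert (S 1)) + \<rho> (hilbert (S (-1))) \<le> ennreal (real (Suc n)) + ennreal (real (Suc n))"
        by (intro add_mono le)
      also have "\<dots> = ennreal (2 * (real n + 1))" by (subst ennreal_plus[symmetric]) auto
      finally have up: "\<rho> (hilbert (\<lambda>x. complex_of_real \<mu> * h x)) \<le> ennreal (2 * (real n + 1))" .
      have "\<rho> (hilbert (\<lambda>x. complex_of_real \<mu> * h x)) = \<rho> (\<lambda>x. complex_of_real \<mu> * hilbert h x)"
      proof (rule bfs_cong[OF \<rho>])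
        show "hilbert (\<lambda>x. complex_of_real \<mu> * h x) \<in> L0"
          using h1 by (intro hilbert_measurable) (simp add: L1_def)
        show "(\<lambda>x. complex_of_real \<mu> * hilbert h x) \<in> L0" by (intro L0_intros hilbert_measurable h1)
        show "AE x in M1. cmod (hilbert (\<lambda>x. complex_of_real \<mu> * h x) x) = cmod (complex_of_real \<mu> * hilbert h x)"
          using AE_M1I[OF hilbert_cmult[OF h1, of "complex_of_real \<mu>"]] by eventually_elim (simp only:)
      qed
      also have "\<dots> = ennreal \<mu> * \<rho> (hilbert h)"
        using s(2) by (simp add: bfs_scale[OF \<rho> hilbert_measurable[OF h1]])
      finally have "ennreal \<mu> * \<rho> (hilbert h) \<le> ennreal (2 * (real n + 1))" using up by simp
      moreover have "ennreal \<mu> * ennreal ((real n + 1) / (\<mu> / 2)) < ennreal \<mu> * \<rho> (hilbert h)"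
        using h(3) s(2) by (intro ennreal_mult_strict_left_mono) auto
      moreover have "ennreal \<mu> * ennreal ((real n + 1) / (\<mu> / 2)) = ennreal (2 * (real n + 1))"
      proof -
        have "\<mu> * (N / (\<mu> / 2)) = 2 * N" for N :: real using s(2) by simp
        then show ?thesis using s(2) by (subst ennreal_mult[symmetric]) simp_all
      qed
      ultimately show False by simp
    qed
    then obtain c where c: "c \<in> {1,-1}" "ennreal (real (Suc n)) < \<rho> (hilbert (S c))" by blast
    obtain \<delta> where \<delta>: "0 < \<delta>" "\<And>y. y \<in> L1 \<Longrightarrow> (LINT x|M1. cmod (y x - S c x)) \<le> \<delta> \<Longrightarrow> ennreal (real (Suc n)) \<le> \<rho> (hilbert y)"
      using hilbert_norm_lower_near[OF \<rho> S1 c(2)] by blast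
    \<comment> \<open>The second bound fits the new L^1 ball into the neighbourhood on which the
      lower bound holds; \<open>?F + 1\<close> avoids division by 0.\<close>
    define \<mu>' where "\<mu>' = min (\<mu> / 2) (\<delta> / (?F + 1))"
    have \<mu>': "0 < \<mu>'" "\<mu>' \<le> \<mu> / 2" "\<mu>' * ?F \<le> \<delta>"
    proof -
      have "0 < ?F + 1" using F0 by linarith
      then have "0 < \<delta> / (?F + 1)" by (intro divide_pos_pos \<delta>)
      then show "0 < \<mu>'" using s(2) unfolding \<mu>'_def by simp
      show "\<mu>' \<le> \<mu> / 2" unfolding \<mu>'_def by (rule min.cobounded1)
      have "\<mu>' * ?F \<le> \<delta> / (?F + 1) * (?F + 1)"
        using F0 \<delta>(1) s(2) by (intro mult_mono) (auto simp: \<mu>'_def)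
      then show "\<mu>' * ?F \<le> \<delta>" using F0 by simp
    qed
    have cm: "cmod (complex_of_real (c * (\<mu> / 2))) = \<mu> / 2" using c(1) s(2) by (auto simp: norm_divide)
    have diff: "AE x in M1. cmod (S c x - s x) \<le> \<mu> / 2 * cmod (f x)"
      using h(2)
    proof eventually_elim
      case (elim x)
      have "cmod (S c x - s x) = \<mu> / 2 * cmod (h x)"
        unfolding S_def add_diff_cancel_left' norm_mult cm ..
      then show ?case using elim s(2) by (simp add: mult_left_mono)
    qed
    have "P (Suc n) (S c, \<mu>')"
      unfolding P_def fst_conv snd_conv
    proof (intro conjI ballI impI)
      show "S c \<in> L0" by (rule L1_L0[OF S1])
      show "0 < \<mu>'" by fact
      show "\<mu>' \<le> 1" using \<mu>' s by simp
      show "AE x in M1. cmod (S c x) \<le> (1 - \<mu>') * cmod (f x)"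
        using diff s(4)
      proof eventually_elim
        case (elim x)
        have "cmod (S c x) \<le> cmod (S c x - s x) + cmod (s x)" by (metis diff_add_cancel norm_triangle_ineq)
        also have "\<dots> \<le> \<mu> / 2 * cmod (f x) + (1 - \<mu>) * cmod (f x)" using elim by (intro add_mono)
        also have "\<dots> = (1 - \<mu> / 2) * cmod (f x)" by (simp add: algebra_simps)
        also have "\<dots> \<le> (1 - \<mu>') * cmod (f x)" using \<mu>' by (intro mult_right_mono) auto
        finally show ?case .
      qed
      fix y assume "y \<in> L1" "(LINT x|M1. cmod (y x - S c x)) \<le> \<mu>' * ?F"
      then show "ennreal (real (Suc n)) \<le> \<rho> (hilbert y)" using \<mu>'(3) by (intro \<delta>(2)) auto
    qed
    moreover have "Q z (S c, \<mu>')" using diff \<mu>'(2) by (simp add: Q_def z)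
    ultimately show "\<exists>z'. P (Suc n) z' \<and> Q z z'" by blast
  qed
  then obtain Z where Z: "\<And>n. P n (Z n)" "\<And>n. Q (Z n) (Z (Suc n))" by blast
  define s where "s n = fst (Z n)" for n
  define \<mu> where "\<mu> n = snd (Z n)" for n
  have s: "s n \<in> L0" "0 < \<mu> n" "\<mu> n \<le> 1" "AE x in M1. cmod (s n x) \<le> (1 - \<mu> n) * cmod (f x)"
    and hit: "\<And>y. y \<in> L1 \<Longrightarrow> (LINT x|M1. cmod (y x - s n x)) \<le> \<mu> n * ?F \<Longrightarrow> ennreal (real n) \<le> \<rho> (hilbert y)"
    and step: "AE x in M1. cmod (s (Suc n) x - s n x) \<le> \<mu> n / 2 * cmod (f x)" "\<mu> (Suc n) \<le> \<mu> n / 2" for n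
    using Z[of n] by (auto simp: P_def Q_def s_def \<mu>_def)
  have \<mu>lim: "\<mu> \<longlonglongrightarrow> 0"
  proof (rule tendsto_sandwich[OF _ _ tendsto_const])
    have "\<mu> n \<le> (1/2) ^ n" for n
    proof (induction n)
      case (Suc n) then show ?case using step(2)[of n] by simp
    qed (use s(3) in simp)
    then show "\<forall>\<^sub>F n in sequentially. \<mu> n \<le> (1/2) ^ n" by simp
    show "\<forall>\<^sub>F n in sequentially. 0 \<le> \<mu> n" using s(2) by (simp add: less_imp_le)
    show "(\<lambda>n. (1/2::real) ^ n) \<longlonglongrightarrow> 0" by (intro LIMSEQ_power_zero) simp
  qed
  define x where "x t = lim (\<lambda>n. s n t)" for t
  have x0: "x \<in> L0"
    using s(1) unfolding x_def[abs_def] L0_def by (intro borel_measurable_lim_metric)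
  have "AE t in M1. \<forall>n. cmod (s (Suc n) t - s n t) \<le> \<mu> n / 2 * cmod (f t)"
    using step(1) by (simp add: AE_all_countable)
  then have conv: "AE t in M1. \<forall>n. cmod (x t - s n t) \<le> \<mu> n * cmod (f t)"
  proof eventually_elim
    case (elim t)
    \<comment> \<open>Keeping the term \<mu> (n + k) in the bound is what closes the
      induction.\<close>
    have tele: "cmod (s (n + k) t - s n t) \<le> (\<mu> n - \<mu> (n + k)) * cmod (f t)" for n k
    proof (induction k)
      case (Suc k)
      have "cmod (s (n + Suc k) t - s n t) \<le> cmod (s (Suc (n + k)) t - s (n + k) t) + cmod (s (n + k) t - s n t)"
        by (metis add_Suc_right diff_add_cancel norm_triangle_ineq add_diff_eq)
      also have "\<dots> \<le> \<mu> (n + k) / 2 * cmod (f t) + (\<mu> n - \<mu> (n + k)) * cmod (f t)"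
        using elim Suc by (intro add_mono) auto
      also have "\<dots> = (\<mu> n - \<mu> (n + k) / 2) * cmod (f t)" by (simp add: algebra_simps)
      also have "\<dots> \<le> (\<mu> n - \<mu> (n + Suc k)) * cmod (f t)"
        using step(2)[of "n + k"] by (intro mult_right_mono) auto
      finally show ?case .
    qed simp
    have tele': "cmod (s m t - s n t) \<le> \<mu> n * cmod (f t)" if "n \<le> m" for m n
    proof -
      have "cmod (s m t - s n t) \<le> (\<mu> n - \<mu> m) * cmod (f t)" using tele[of n "m - n"] that by simp
      also have "\<dots> \<le> \<mu> n * cmod (f t)" using s(2)[of m] by (intro mult_right_mono) auto
      finally show ?thesis .
    qed
    have "Cauchy (\<lambda>n. s n t)"
    proof (rule CauchyI')
      fix e :: real assume e: "0 < e"
      have "(\<lambda>n. \<mu> n * cmod (f t)) \<longlonglongrightarrow> 0 * cmod (f t)" by (intro tendsto_mult \<mu>lim tendsto_const)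
      then have "\<forall>\<^sub>F n in sequentially. \<mu> n * cmod (f t) < e" using e by (intro order_tendstoD(2)) auto
      then obtain N where N: "\<And>n. n \<ge> N \<Longrightarrow> \<mu> n * cmod (f t) < e" by (auto simp: eventually_sequentially)
      have "dist (s m t) (s n t) < e" if "N \<le> m" "m < n" for m n
        using tele'[of m n] N[of m] that by (simp add: dist_norm norm_minus_commute)
      then show "\<exists>M. \<forall>m\<ge>M. \<forall>n>m. dist (s m t) (s n t) < e" by blast
    qed
    then have lim: "(\<lambda>m. s m t) \<longlonglongrightarrow> x t" unfolding x_def by (simp add: Cauchy_convergent_iff convergent_LIMSEQ_iff)
    show ?case
    proof
      fix n
      have "(\<lambda>m. cmod (s m t - s n t)) \<longlonglongrightarrow> cmod (x t - s n t)" by (intro tendsto_intros lim)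
      then show "cmod (x t - s n t) \<le> \<mu> n * cmod (f t)"
        by (rule tendsto_upperbound) (auto simp: eventually_sequentially intro!: exI[of _ n] tele')
    qed
  qed
  have xf: "AE t in M1. cmod (x t) \<le> cmod (f t)"
    using conv s(4)[of 0]
  proof eventually_elim
    case (elim t)
    have "cmod (x t) \<le> cmod (x t - s 0 t) + cmod (s 0 t)" by (metis diff_add_cancel norm_triangle_ineq)
    also have "\<dots> \<le> \<mu> 0 * cmod (f t) + (1 - \<mu> 0) * cmod (f t)" using elim by (intro add_mono) auto
    finally show ?case by (simp add: algebra_simps)
  qed
  have x1: "x \<in> L1" by (rule L1_dominated[OF f1 x0 xf])
  \<comment> \<open>The limit lies in the neighbourhood attached to every stage, so its transform
    has norm at least n for all n.\<close>
  have "ennreal (real n) \<le> \<rho> (hilbert x)" for n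
  proof (rule hit[OF x1])
    have sn: "AE t in M1. cmod (s n t) \<le> cmod (f t)"
      using s(4)[of n]
    proof eventually_elim
      case (elim t)
      have "(1 - \<mu> n) * cmod (f t) \<le> 1 * cmod (f t)" using s(2)[of n] by (intro mult_right_mono) auto
      then show ?case using elim by simp
    qed
    have "s n \<in> L1" by (rule L1_dominated[OF f1 s(1) sn])
    then have i: "integrable M1 (\<lambda>t. cmod (x t - s n t))" using x1 by (auto simp: L1_def)
    have "(LINT t|M1. cmod (x t - s n t)) \<le> (LINT t|M1. \<mu> n * cmod (f t))"
      using fi conv by (intro integral_mono_AE i) auto
    then show "(LINT t|M1. cmod (x t - s n t)) \<le> \<mu> n * ?F" by simp
  qed
  then have "\<rho> (hilbert x) = \<infinity>" by (metis ennreal_of_nat_eq_real_of_nat ennreal_SUP_of_nat_eq_top SUP_least top.extremum_uniqueI infinity_ennreal_def)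
  moreover have "\<rho> (hilbert x) < \<infinity>" using f x0 xf by (simp add: TX_def bfs_space_def)
  ultimately show False by simp
qed

section \<open>Norm axioms, Fatou property and completeness of [T,X]\<close>

lemma TX_norm_zero_iff:
  assumes \<rho>: "bfs \<rho>" and f: "f \<in> L0"
  shows "TX_norm \<rho> f = 0 \<longleftrightarrow> (AE x in M1. f x = 0)"
proof
  assume z: "TX_norm \<rho> f = 0"
  then have fT: "f \<in> TX \<rho>" by (auto simp: TX_norm_def split: if_splits)
  then have fi: "integrable M1 (\<lambda>x. cmod (f x))" using TX_subset by (auto simp: L1_def)
  obtain C where "ennreal (LINT x|M1. cmod (f x)) \<le> ennreal C * TX_norm \<rho> f"
    using L1_le_TX_norm[OF \<rho>] fT by metis
  then have "(LINT x|M1. cmod (f x)) \<le> 0" using z by (simp add: ennreal_eq_0_iff)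
  then have "(LINT x|M1. cmod (f x)) = 0" by (simp add: antisym)
  then have "AE x in M1. cmod (f x) = 0" using integral_nonneg_eq_0_iff_AE[OF fi] by simp
  then show "AE x in M1. f x = 0" by simp
next
  assume z: "AE x in M1. f x = 0"
  have "hilbert (\<lambda>_. 0) t = 0" for t
    unfolding hilbert_eq_kconv by (simp add: kconv_def ext_def tendsto_Lim)
  then have h0: "hilbert (\<lambda>_. 0) = (\<lambda>_. 0)" by (intro HOL.ext)
  have r0: "\<rho> (\<lambda>_. 0) = 0" by (subst bfs_zero_iff[OF \<rho> L0_intros(5)]) simp
  have small: "\<rho> (hilbert h) = 0" if "AE x in M1. cmod (h x) \<le> cmod (f x)" for h
  proof -
    have "AE x in M1. h x = 0" using that z by eventually_elim simp
    then have "hilbert h = hilbert (\<lambda>_. 0)" by (rule hilbert_cong_AE)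
    then show ?thesis by (simp add: h0 r0)
  qed
  have "f \<in> L1" by (rule L1_dominated[of "\<lambda>_. 0", OF _ f]) (use z in \<open>simp_all add: L1_def\<close>)
  then have fT: "f \<in> TX \<rho>" by (rule TX_I[where m=0]) (simp_all add: small)
  have "TX_norm \<rho> f \<le> 0" by (rule TX_norm_le[OF fT]) (simp add: small)
  then show "TX_norm \<rho> f = 0" by simp
qed

text \<open>A function dominated by |f + g| is split in the proportion of |f| to |g| into parts
  dominated by f and by g. Where both vanish, so does h, and the quotient 0/0 = 0 does no
  harm.\<close>

lemma TX_norm_triangle:
  assumes \<rho>: "bfs \<rho>" and f: "f \<in> L0" and g: "g \<in> L0"
  shows "TX_norm \<rho> (\<lambda>x. f x + g x) \<le> TX_norm \<rho> f + TX_norm \<rho> g"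
proof (cases "f \<in> TX \<rho> \<and> g \<in> TX \<rho>")
  case True
  then have fT: "f \<in> TX \<rho>" and gT: "g \<in> TX \<rho>" by auto
  have f1: "f \<in> L1" and g1: "g \<in> L1" using fT gT TX_subset by auto
  have fg: "(\<lambda>x. f x + g x) \<in> L1" using f1 g1 by (simp add: L1_def)
  have le: "\<rho> (hilbert h) \<le> TX_norm \<rho> f + TX_norm \<rho> g"
    if h: "h \<in> L0" "AE x in M1. cmod (h x) \<le> cmod (f x + g x)" for h
  proof -
    define w where "w x = complex_of_real (cmod (f x) / (cmod (f x) + cmod (g x)))" for x
    have [measurable]: "f \<in> borel_measurable M1" "g \<in> borel_measurable M1" using f g by (auto simp: L0_def)
    have w: "w \<in> L0" unfolding w_def[abs_def] L0_def by measurable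
    define h1 where "h1 x = h x * w x" for x
    define h2 where "h2 x = h x - h1 x" for x
    have h10: "h1 \<in> L0" unfolding h1_def[abs_def] by (intro L0_intros h w)
    have h20: "h2 \<in> L0" unfolding h2_def[abs_def] by (intro L0_intros h h10)
    have dom: "AE x in M1. cmod (h1 x) \<le> cmod (f x) \<and> cmod (h2 x) \<le> cmod (g x)"
      using h(2)
    proof eventually_elim
      case (elim x)
      define a where "a = cmod (f x)"
      define b where "b = cmod (g x)"
      have ab: "0 \<le> a" "0 \<le> b" by (auto simp: a_def b_def)
      have hab: "cmod (h x) \<le> a + b" using elim norm_triangle_ineq[of "f x" "g x"] by (simp add: a_def b_def)
      show ?case
      proof (cases "a + b = 0")
        case True
        then have "h x = 0" using hab by simp
        then show ?thesis by (simp add: h1_def h2_def)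
      next
        case False
        then have pos: "0 < a + b" using ab by simp
        have wx: "w x = complex_of_real (a / (a + b))" by (simp add: w_def a_def b_def)
        have "cmod (h1 x) = cmod (h x) * (a / (a + b))"
          unfolding h1_def wx norm_mult norm_of_real using ab by simp
        also have "\<dots> \<le> (a + b) * (a / (a + b))" using hab ab by (intro mult_right_mono) auto
        finally have 1: "cmod (h1 x) \<le> a" using pos by simp
        have "1 - a / (a + b) = b / (a + b)" using pos by (simp add: diff_divide_eq_iff)
        then have e: "1 - w x = complex_of_real (b / (a + b))" unfolding wx by (metis of_real_1 of_real_diff)
        have "h2 x = h x * (1 - w x)" by (simp add: h2_def h1_def algebra_simps)
        then have "cmod (h2 x) = cmod (h x) * (b / (a + b))"
          unfolding e using ab by (simp only: norm_mult norm_of_real) simp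
        also have "\<dots> \<le> (a + b) * (b / (a + b))" using hab ab by (intro mult_right_mono) auto
        finally show ?thesis using 1 pos by (simp add: a_def b_def)
      qed
    qed
    have d1: "AE x in M1. cmod (h1 x) \<le> cmod (f x)" and d2: "AE x in M1. cmod (h2 x) \<le> cmod (g x)"
      using dom by auto
    have L: "h1 \<in> L1" "h2 \<in> L1" by (rule L1_dominated[OF f1 h10 d1], rule L1_dominated[OF g1 h20 d2])
    have hh: "h = (\<lambda>x. h1 x + h2 x)" by (auto simp: h2_def)
    have "\<rho> (hilbert h) = \<rho> (\<lambda>x. hilbert h1 x + hilbert h2 x)"
    proof (rule bfs_cong[OF \<rho>])
      show "hilbert h \<in> L0" by (rule hilbert_measurable[OF L1_dominated[OF fg h]])
      show "(\<lambda>x. hilbert h1 x + hilbert h2 x) \<in> L0" by (intro L0_intros hilbert_measurable L)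
      have "AE x in M1. hilbert h x = hilbert h1 x + hilbert h2 x"
        unfolding hh by (rule AE_M1I[OF hilbert_add[OF L]])
      then show "AE x in M1. cmod (hilbert h x) = cmod (hilbert h1 x + hilbert h2 x)" by eventually_elim simp
    qed
    also have "\<dots> \<le> \<rho> (hilbert h1) + \<rho> (hilbert h2)" by (intro bfs_triangle[OF \<rho>] hilbert_measurable L)
    also have "\<dots> \<le> TX_norm \<rho> f + TX_norm \<rho> g"
      by (intro add_mono TX_norm_ge[OF fT h10 d1] TX_norm_ge[OF gT h20 d2])
    finally show ?thesis .
  qed
  have "TX_norm \<rho> f + TX_norm \<rho> g < \<infinity>"
    using TX_norm_finite[OF \<rho> fT] TX_norm_finite[OF \<rho> gT] by simp
  then have "(\<lambda>x. f x + g x) \<in> TX \<rho>" using le by (rule TX_I[OF fg])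
  then show ?thesis using le by (rule TX_norm_le)
next
  case False
  then have "TX_norm \<rho> f + TX_norm \<rho> g = \<infinity>" by (auto simp: TX_norm_def)
  then show ?thesis by (simp only: infinity_ennreal_def top_greatest)
qed

lemma TX_norm_cmult_le:
  assumes \<rho>: "bfs \<rho>" and f: "f \<in> TX \<rho>"
  shows "(\<lambda>x. c * f x) \<in> TX \<rho>" "TX_norm \<rho> (\<lambda>x. c * f x) \<le> ennreal (cmod c) * TX_norm \<rho> f"
proof -
  have f1: "f \<in> L1" by (rule TX_subset[OF f])
  have cf1: "(\<lambda>x. c * f x) \<in> L1" using f1 by (simp add: L1_def)
  have le: "\<rho> (hilbert h) \<le> ennreal (cmod c) * TX_norm \<rho> f"
    if h: "h \<in> L0" "AE x in M1. cmod (h x) \<le> cmod (c * f x)" for h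
  proof -
    define g where "g x = (if c = 0 then 0 else inverse c * h x)" for x
    have g0: "g \<in> L0" unfolding g_def[abs_def] using h by (cases "c = 0") (simp_all add: L0_intros)
    have gf: "AE x in M1. cmod (g x) \<le> cmod (f x)"
      using h(2)
    proof eventually_elim
      case (elim x)
      show ?case
      proof (cases "c = 0")
        case False
        have "cmod (g x) = inverse (cmod c) * cmod (h x)" using False by (simp add: g_def norm_mult norm_inverse)
        also have "\<dots> \<le> inverse (cmod c) * (cmod c * cmod (f x))" using elim by (intro mult_left_mono) (auto simp: norm_mult)
        also have "\<dots> = cmod (f x)" using False by simp
        finally show ?thesis .
      qed (simp add: g_def)
    qed
    have g1: "g \<in> L1" by (rule L1_dominated[OF f1 g0 gf])
    have hg: "AE x in M1. h x = c * g x"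
      using h(2) by eventually_elim (auto simp: g_def)
    have "\<rho> (hilbert h) = \<rho> (hilbert (\<lambda>x. c * g x))" by (simp only: hilbert_cong_AE[OF hg])
    also have "\<dots> = \<rho> (\<lambda>x. c * hilbert g x)"
    proof (rule bfs_cong[OF \<rho>])
      show "hilbert (\<lambda>x. c * g x) \<in> L0" using g1 by (intro hilbert_measurable) (simp add: L1_def)
      show "(\<lambda>x. c * hilbert g x) \<in> L0" by (intro L0_intros hilbert_measurable g1)
      show "AE x in M1. cmod (hilbert (\<lambda>x. c * g x) x) = cmod (c * hilbert g x)"
        using AE_M1I[OF hilbert_cmult[OF g1, of c]] by eventually_elim simp
    qed
    also have "\<dots> = ennreal (cmod c) * \<rho> (hilbert g)" by (rule bfs_scale[OF \<rho> hilbert_measurable[OF g1]])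
    also have "\<dots> \<le> ennreal (cmod c) * TX_norm \<rho> f" by (intro mult_left_mono TX_norm_ge[OF f g0 gf]) simp
    finally show ?thesis .
  qed
  have "ennreal (cmod c) * TX_norm \<rho> f < \<infinity>"
    using TX_norm_finite[OF \<rho> f] by (simp add: ennreal_mult_less_top)
  then show T: "(\<lambda>x. c * f x) \<in> TX \<rho>" using le by (rule TX_I[OF cf1])
  show "TX_norm \<rho> (\<lambda>x. c * f x) \<le> ennreal (cmod c) * TX_norm \<rho> f" using T le by (rule TX_norm_le)
qed

text \<open>\<open>TX_norm_cmult_le\<close> for c and for its inverse give the two inequalities; the
  same pair shows that membership is unchanged, which settles infinite norms.\<close>

lemma TX_norm_scale:
  assumes \<rho>: "bfs \<rho>" and f: "f \<in> L0"
  shows "TX_norm \<rho> (\<lambda>x. c * f x) = ennreal (cmod c) * TX_norm \<rho> f"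
proof (cases "c = 0")
  case True
  then show ?thesis using TX_norm_zero_iff[OF \<rho> L0_intros(5)[of 0]] by simp
next
  case c: False
  have inv: "(\<lambda>x. inverse c * (c * f x)) = f" using c by (auto simp: fun_eq_iff)
  show ?thesis
  proof (cases "f \<in> TX \<rho>")
    case True
    note cf = TX_norm_cmult_le[OF \<rho> True, of c]
    have "ennreal (cmod c) * TX_norm \<rho> f \<le> ennreal (cmod c) * (ennreal (cmod (inverse c)) * TX_norm \<rho> (\<lambda>x. c * f x))"
      using TX_norm_cmult_le(2)[OF \<rho> cf(1), of "inverse c"] unfolding inv by (rule mult_left_mono) simp
    also have "\<dots> = ennreal (cmod c * cmod (inverse c)) * TX_norm \<rho> (\<lambda>x. c * f x)"
      by (simp add: ennreal_mult mult.assoc)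
    also have "cmod c * cmod (inverse c) = 1" using c by (simp add: norm_inverse)
    finally show ?thesis using cf(2) by (simp add: antisym)
  next
    case False
    then have "(\<lambda>x. c * f x) \<notin> TX \<rho>" using TX_norm_cmult_le(1)[OF \<rho>, of "\<lambda>x. c * f x" "inverse c"] unfolding inv by blast
    then show ?thesis using False c by (simp add: TX_norm_def ennreal_mult_top)
  qed
qed

text \<open>Bounded norms bound the L^1 norms, so f is integrable by Fatou's lemma. Each h dominated
  by f is an L^1 limit of functions dominated by the F n, and \<open>hilbert_lsc\<close> passes the
  bound on to h.\<close>

lemma TX_norm_fatou:
  assumes \<rho>: "bfs \<rho>" and F: "\<And>n. F n \<in> L0" and f: "f \<in> L0"
    and lim: "AE x in M1. incseq (\<lambda>n. cmod (F n x)) \<and> (\<lambda>n. cmod (F n x)) \<longlonglongrightarrow> cmod (f x)"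
  shows "(\<lambda>n. TX_norm \<rho> (F n)) \<longlonglongrightarrow> TX_norm \<rho> f"
proof -
  define m where "m = (SUP n. TX_norm \<rho> (F n))"
  have inc: "incseq (\<lambda>n. TX_norm \<rho> (F n))"
  proof (rule incseq_SucI, rule TX_norm_ideal[OF F F])
    show "AE x in M1. cmod (F n x) \<le> cmod (F (Suc n) x)" for n
      using lim by eventually_elim (auto simp: incseq_Suc_iff)
  qed
  have Fm: "TX_norm \<rho> (F n) \<le> m" for n unfolding m_def by (rule SUP_upper) simp
  have Ff: "AE x in M1. cmod (F n x) \<le> cmod (f x)" for n
    using lim by eventually_elim (auto intro: incseq_le)
  have "m \<le> TX_norm \<rho> f" unfolding m_def by (intro SUP_least TX_norm_ideal[OF f F] Ff)
  moreover have "TX_norm \<rho> f \<le> m"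
  proof (cases "m < \<infinity>")
    case True
    have FT: "F n \<in> TX \<rho>" for n
      using le_less_trans[OF Fm[of n] True] by (auto simp: TX_norm_def split: if_splits)
    obtain C where C: "0 \<le> C" "\<And>g. g \<in> TX \<rho> \<Longrightarrow> ennreal (LINT x|M1. cmod (g x)) \<le> ennreal C * TX_norm \<rho> g"
      using L1_le_TX_norm[OF \<rho>] by metis
    have [measurable]: "f \<in> borel_measurable M1" "\<And>n. F n \<in> borel_measurable M1" using f F by (auto simp: L0_def)
    have f1: "f \<in> L1"
    proof -
      have "(\<integral>\<^sup>+x. ennreal (cmod (f x)) \<partial>M1) = (\<integral>\<^sup>+x. liminf (\<lambda>n. ennreal (cmod (F n x))) \<partial>M1)"
      proof (rule nn_integral_cong_AE)
        show "AE x in M1. ennreal (cmod (f x)) = liminf (\<lambda>n. ennreal (cmod (F n x)))"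
          using lim
        proof eventually_elim
          case (elim x)
          then have "(\<lambda>n. ennreal (cmod (F n x))) \<longlonglongrightarrow> ennreal (cmod (f x))" by (intro tendsto_ennrealI) auto
          then show ?case by (intro lim_imp_Liminf[symmetric]) auto
        qed
      qed
      also have "\<dots> \<le> liminf (\<lambda>n. \<integral>\<^sup>+x. ennreal (cmod (F n x)) \<partial>M1)"
        by (rule nn_integral_liminf) measurable
      also have "\<dots> \<le> liminf (\<lambda>n. ennreal C * m)"
      proof (rule Liminf_mono, rule always_eventually, rule allI)
        fix n
        have "integrable M1 (\<lambda>x. cmod (F n x))" using TX_subset[OF FT] by (auto simp: L1_def)
        then have "(\<integral>\<^sup>+x. ennreal (cmod (F n x)) \<partial>M1) = ennreal (LINT x|M1. cmod (F n x))"
          by (intro nn_integral_eq_integral) auto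
        also have "\<dots> \<le> ennreal C * TX_norm \<rho> (F n)" by (rule C(2)[OF FT])
        also have "\<dots> \<le> ennreal C * m" by (intro mult_left_mono Fm) simp
        finally show "(\<integral>\<^sup>+x. ennreal (cmod (F n x)) \<partial>M1) \<le> ennreal C * m" .
      qed
      also have "\<dots> = ennreal C * m" by (simp add: Liminf_const)
      also have "\<dots> < \<infinity>" using True by (simp add: ennreal_mult_less_top)
      finally have "(\<integral>\<^sup>+x. ennreal (cmod (f x)) \<partial>M1) < \<infinity>" .
      then show ?thesis using f unfolding L1_def L0_def mem_Collect_eq integrable_iff_bounded by blast
    qed
    have le: "\<rho> (hilbert h) \<le> m" if h: "h \<in> L0" "AE x in M1. cmod (h x) \<le> cmod (f x)" for h
    proof -
      \<comment> \<open>Multiplication by this factor truncates h to a function dominated by F n.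
        Where f vanishes, h vanishes too, whatever the value of the quotient.\<close>
      define w where "w n x = complex_of_real (min 1 (cmod (F n x) / cmod (f x)))" for n x
      define k where "k n x = h x * w n x" for n x
      have h1: "h \<in> L1" by (rule L1_dominated[OF f1 h])
      have w0: "w n \<in> L0" for n
        unfolding w_def[abs_def] L0_def
        by (intro measurable_compose[OF _ borel_measurable_of_real] borel_measurable_min borel_measurable_const
            borel_measurable_divide borel_measurable_norm) measurable
      have k0: "k n \<in> L0" for n unfolding k_def[abs_def] by (intro L0_intros h w0)
      have wn: "cmod (w n x) = min 1 (cmod (F n x) / cmod (f x))" for n x
        unfolding w_def norm_of_real by simp
      have kh: "cmod (k n x) \<le> cmod (h x)" for n x
        unfolding k_def norm_mult wn by (simp add: mult_left_le)
      have kF: "AE x in M1. cmod (k n x) \<le> cmod (F n x)" for n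
        using h(2)
      proof eventually_elim
        case (elim x)
        have "cmod (k n x) \<le> cmod (f x) * (cmod (F n x) / cmod (f x))"
          unfolding k_def norm_mult wn using elim by (intro mult_mono) auto
        also have "\<dots> \<le> cmod (F n x)" by simp
        finally show ?case .
      qed
      have k1: "k n \<in> L1" for n by (rule L1_dominated[OF h1 k0]) (simp add: kh)
      have klim: "AE x in M1. (\<lambda>n. k n x) \<longlonglongrightarrow> h x"
        using lim h(2)
      proof eventually_elim
        case (elim x)
        show ?case
        proof (cases "f x = 0")
          case True
          then show ?thesis using elim by (simp add: k_def)
        next
          case False
          have "(\<lambda>n. cmod (F n x) / cmod (f x)) \<longlonglongrightarrow> cmod (f x) / cmod (f x)"
            using elim False by (intro tendsto_divide tendsto_const) auto
          then have "(\<lambda>n. min 1 (cmod (F n x) / cmod (f x))) \<longlonglongrightarrow> min 1 1"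
            using False by (intro tendsto_min tendsto_const) simp
          then have "(\<lambda>n. h x * w n x) \<longlonglongrightarrow> h x * complex_of_real (min 1 1)"
            unfolding w_def by (intro tendsto_mult tendsto_const tendsto_of_real)
          then show ?thesis by (simp add: k_def)
        qed
      qed
      have "(\<lambda>n. LINT x|M1. norm (k n x - h x)) \<longlonglongrightarrow> (LINT x|M1. norm (h x - h x))"
      proof (rule integral_dominated_convergence[where w="\<lambda>x. 2 * cmod (h x)"])
        show "AE x in M1. (\<lambda>n. norm (k n x - h x)) \<longlonglongrightarrow> norm (h x - h x)"
          using klim by eventually_elim (intro tendsto_intros)
        show "AE x in M1. norm (norm (k n x - h x)) \<le> 2 * cmod (h x)" for n
        proof (rule AE_I2)
          fix x
          show "norm (norm (k n x - h x)) \<le> 2 * cmod (h x)"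
            using norm_triangle_ineq4[of "k n x" "h x"] kh[of n x] by simp
        qed
      qed (use k1 h1 in \<open>auto simp: L1_def\<close>)
      then have "(\<lambda>n. LINT x|M1. norm (k n x - h x)) \<longlonglongrightarrow> 0" by simp
      moreover have "\<rho> (hilbert (k n)) \<le> m" for n
        using TX_norm_ge[OF FT k0 kF] Fm order_trans by blast
      ultimately show ?thesis by (rule hilbert_lsc[OF \<rho> h1 k1])
    qed
    have "f \<in> TX \<rho>" using True le by (rule TX_I[OF f1])
    then show ?thesis using le by (rule TX_norm_le)
  qed (simp add: less_top[symmetric])
  ultimately have "TX_norm \<rho> f = m" by (rule antisym[rotated])
  then show ?thesis using LIMSEQ_SUP[OF inc] by (simp add: m_def)
qed

lemma bfs_space_TX_norm:
  assumes "bfs \<rho>"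
  shows "bfs_space (TX_norm \<rho>) = TX \<rho>"
proof
  show "bfs_space (TX_norm \<rho>) \<subseteq> TX \<rho>"
    by (auto simp: bfs_space_def TX_norm_def split: if_splits)
  show "TX \<rho> \<subseteq> bfs_space (TX_norm \<rho>)"
    using TX_norm_finite[OF assms] TX_subset L1_L0 by (auto simp: bfs_space_def)
qed

text \<open>A Cauchy sequence in [T,X] is Cauchy in L^1, which supplies a limit along an almost
  everywhere convergent subsequence. The Fatou property, applied to the differences with a fixed F
  n, turns this into norm convergence of the whole sequence.\<close>

lemma TX_norm_complete:
  assumes \<rho>: "bfs \<rho>" and F: "\<And>n. F n \<in> TX \<rho>"
    and cauchy: "\<And>e. 0 < e \<Longrightarrow> \<exists>N. \<forall>m\<ge>N. \<forall>n\<ge>N. TX_norm \<rho> (\<lambda>x. F m x - F n x) < ennreal e"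
  shows "\<exists>f\<in>TX \<rho>. (\<lambda>n. TX_norm \<rho> (\<lambda>x. F n x - f x)) \<longlonglongrightarrow> 0"
proof -
  have F1: "F n \<in> L1" and F0: "F n \<in> L0" for n using TX_subset[OF F] L1_L0 by auto
  have diffT: "(\<lambda>x. F m x - F n x) \<in> TX \<rho>" if "TX_norm \<rho> (\<lambda>x. F m x - F n x) < ennreal e" for m n e
    using that by (auto simp: TX_norm_def split: if_splits)
  obtain C where C: "0 \<le> C" "\<And>g. g \<in> TX \<rho> \<Longrightarrow> ennreal (LINT x|M1. cmod (g x)) \<le> ennreal C * TX_norm \<rho> g"
    using L1_le_TX_norm[OF \<rho>] by metis
  have L1_cauchy: "\<exists>N. \<forall>i\<ge>N. \<forall>j\<ge>N. (LINT x|M1. norm (F i x - F j x)) < e" if e: "0 < e" for e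
  proof -
    have "0 < e / (C + 1)" using e C by simp
    from cauchy[OF this] obtain N where N: "\<And>i j. i \<ge> N \<Longrightarrow> j \<ge> N \<Longrightarrow> TX_norm \<rho> (\<lambda>x. F i x - F j x) < ennreal (e / (C + 1))"
      by blast
    have "(LINT x|M1. norm (F i x - F j x)) < e" if "i \<ge> N" "j \<ge> N" for i j
    proof -
      have "ennreal (LINT x|M1. cmod (F i x - F j x)) \<le> ennreal C * TX_norm \<rho> (\<lambda>x. F i x - F j x)"
        by (rule C(2)[OF diffT[OF N[OF that]]])
      also have "\<dots> \<le> ennreal C * ennreal (e / (C + 1))" by (intro mult_left_mono less_imp_le[OF N[OF that]]) simp
      also have "\<dots> = ennreal (C * (e / (C + 1)))" using C e by (intro ennreal_mult[symmetric]) auto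
      finally have "(LINT x|M1. cmod (F i x - F j x)) \<le> C * (e / (C + 1))" using C e by (simp add: ennreal_le_iff)
      also have "\<dots> < e" using C(1) e by (simp add: pos_divide_less_eq)
      finally show ?thesis .
    qed
    then show ?thesis by blast
  qed
  obtain r where r: "strict_mono r" "AE x in M1. Cauchy (\<lambda>i. F (r i) x)"
  proof (rule cauchy_L1_AE_cauchy_subseq[of M1 F])
    show "integrable M1 (F n)" for n using F1 by (simp add: L1_def)
  qed (use L1_cauchy that in blast)+
  define f where "f x = lim (\<lambda>i. F (r i) x)" for x
  have f0: "f \<in> L0"
    using F0 unfolding f_def[abs_def] L0_def by (intro borel_measurable_lim_metric)
  have flim: "AE x in M1. (\<lambda>i. F (r i) x) \<longlonglongrightarrow> f x"
    using r(2) by eventually_elim (simp add: f_def Cauchy_convergent_iff convergent_LIMSEQ_iff)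
  have close: "\<exists>N. \<forall>n\<ge>N. TX_norm \<rho> (\<lambda>x. F n x - f x) \<le> ennreal e" if e: "0 < e" for e
  proof -
    obtain N where N: "\<And>i j. i \<ge> N \<Longrightarrow> j \<ge> N \<Longrightarrow> TX_norm \<rho> (\<lambda>x. F i x - F j x) < ennreal e"
      using cauchy[OF e] by blast
    have "TX_norm \<rho> (\<lambda>x. F n x - f x) \<le> ennreal e" if n: "n \<ge> N" for n
    proof (rule fatou_liminf_le[where \<rho>="TX_norm \<rho>" and F="\<lambda>i x. F n x - F (r (i + N)) x"])
      show "TX_norm \<rho> g \<le> TX_norm \<rho> f" if "f \<in> L0" "g \<in> L0" "AE x in M1. cmod (g x) \<le> cmod (f x)" for f g
        using that by (rule TX_norm_ideal)
      show "(\<lambda>n. TX_norm \<rho> (F n)) \<longlonglongrightarrow> TX_norm \<rho> f" if "\<And>n. F n \<in> L0" "f \<in> L0"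
        "AE x in M1. incseq (\<lambda>n. cmod (F n x)) \<and> (\<lambda>n. cmod (F n x)) \<longlonglongrightarrow> cmod (f x)" for F f
        using that by (rule TX_norm_fatou[OF \<rho>])
      show "(\<lambda>x. F n x - F (r (i + N)) x) \<in> L0" for i by (intro L0_intros F0)
      show "(\<lambda>x. F n x - f x) \<in> L0" by (intro L0_intros F0 f0)
      show "AE x in M1. (\<lambda>i. F n x - F (r (i + N)) x) \<longlonglongrightarrow> F n x - f x"
        using flim
      proof eventually_elim
        case (elim x)
        from LIMSEQ_ignore_initial_segment[OF elim, of N] show ?case by (intro tendsto_intros)
      qed
      show "TX_norm \<rho> (\<lambda>x. F n x - F (r (i + N)) x) \<le> ennreal e" for i
      proof -
        have "N \<le> r (i + N)" using seq_suble[OF r(1), of "i + N"] by simp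
        then show ?thesis by (rule less_imp_le[OF N[OF n]])
      qed
    qed
    then show ?thesis by blast
  qed
  have "f \<in> TX \<rho>"
  proof -
    obtain N where N: "TX_norm \<rho> (\<lambda>x. F N x - f x) \<le> ennreal 1" using close[of 1] by auto
    have "TX_norm \<rho> (\<lambda>x. (-1) * (F N x - f x) + F N x) \<le> TX_norm \<rho> (\<lambda>x. (-1) * (F N x - f x)) + TX_norm \<rho> (F N)"
      by (intro TX_norm_triangle[OF \<rho>] L0_intros F0 f0)
    also have "TX_norm \<rho> (\<lambda>x. (-1) * (F N x - f x)) = TX_norm \<rho> (\<lambda>x. F N x - f x)"
      by (subst TX_norm_scale[OF \<rho> L0_intros(2)[OF F0 f0]]) simp
    also have "TX_norm \<rho> (\<lambda>x. F N x - f x) + TX_norm \<rho> (F N) < \<infinity>"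
      using TX_norm_finite[OF \<rho> F] N by (auto intro: le_less_trans)
    finally have "TX_norm \<rho> f < \<infinity>" by simp
    then show ?thesis using bfs_space_TX_norm[OF \<rho>] f0 by (auto simp: bfs_space_def)
  qed
  moreover have "(\<lambda>n. TX_norm \<rho> (\<lambda>x. F n x - f x)) \<longlonglongrightarrow> 0"
  proof (rule order_tendstoI)
    fix a :: ennreal assume "0 < a"
    then obtain e where e: "0 < e" "ennreal e < a"
      by (metis dense ennreal_cases ennreal_less_zero_iff less_top order_less_le_trans top_greatest infinity_ennreal_def)
    from close[OF e(1)] show "\<forall>\<^sub>F n in sequentially. TX_norm \<rho> (\<lambda>x. F n x - f x) < a"
      using e(2) by (auto simp: eventually_sequentially intro: le_less_trans)
  qed auto
  ultimately show ?thesis by blast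
qed

lemma bfs_TX_norm:
  assumes \<rho>: "bfs \<rho>"
  shows "bfs (TX_norm \<rho>)"
  unfolding bfs_def bfs_space_TX_norm[OF \<rho>]
  using TX_norm_zero_iff[OF \<rho>] TX_norm_triangle[OF \<rho>] TX_norm_scale[OF \<rho>] TX_norm_ideal[where \<rho>=\<rho>]
    TX_norm_fatou[OF \<rho>] TX_norm_complete[OF \<rho>]
  by (intro conjI) blast+

theorem theorem4p6:
  fixes \<rho> :: "(real \<Rightarrow> complex) \<Rightarrow> ennreal"
  assumes "ri_space \<rho>"
    and "0 < boyd_lower \<rho>" and "boyd_lower \<rho> \<le> boyd_upper \<rho>" and "boyd_upper \<rho> < 1"
  shows "bfs (TX_norm \<rho>) \<and> bfs_space (TX_norm \<rho>) = TX \<rho>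
    \<and> (\<exists>C::real. \<forall>f\<in>bfs_space \<rho>. f \<in> TX \<rho> \<and> TX_norm \<rho> f \<le> ennreal C * \<rho> f)
    \<and> (\<exists>C::real. \<forall>f\<in>TX \<rho>. hilbert f \<in> bfs_space \<rho> \<and> \<rho> (hilbert f) \<le> ennreal C * TX_norm \<rho> f)
    \<and> (\<forall>\<sigma>. bfs \<sigma> \<and> bfs_space \<rho> \<subseteq> bfs_space \<sigma> \<and> bfs_space \<sigma> \<subseteq> L1
          \<and> (\<exists>C::real. \<forall>f\<in>bfs_space \<sigma>. hilbert f \<in> bfs_space \<rho> \<and> \<rho> (hilbert f) \<le> ennreal C * \<sigma> f)
          \<longrightarrow> (\<exists>C::real. \<forall>f\<in>bfs_space \<sigma>. f \<in> TX \<rho> \<and> TX_norm \<rho> f \<le> ennreal C * \<sigma> f))"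
proof -
  have \<rho>: "bfs \<rho>" by (rule ri_bfs[OF assms(1)])
  \<comment> \<open>The optimality argument with its constant made explicit. It serves twice: for an
    arbitrary \<sigma>, and for \<sigma> = \<rho>, where it gives the continuous inclusion of
    X.\<close>
  have extension: "\<forall>f\<in>bfs_space \<sigma>. f \<in> TX \<rho> \<and> TX_norm \<rho> f \<le> ennreal C * \<sigma> f"
    if \<sigma>: "bfs \<sigma>" "bfs_space \<sigma> \<subseteq> L1" and bd: "\<forall>f\<in>bfs_space \<sigma>. \<rho> (hilbert f) \<le> ennreal C * \<sigma> f" for \<sigma> C
  proof
    fix f assume f: "f \<in> bfs_space \<sigma>"
    then have f0: "f \<in> L0" and f1: "f \<in> L1" and fin: "\<sigma> f < \<infinity>" using \<sigma>(2) by (auto simp: bfs_space_def)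
    have le: "\<rho> (hilbert h) \<le> ennreal C * \<sigma> f" if h: "h \<in> L0" "AE x in M1. cmod (h x) \<le> cmod (f x)" for h
    proof -
      have hf: "\<sigma> h \<le> \<sigma> f" by (rule bfs_ideal[OF \<sigma>(1) f0 h])
      then have "h \<in> bfs_space \<sigma>" using h(1) fin by (auto simp: bfs_space_def)
      then have "\<rho> (hilbert h) \<le> ennreal C * \<sigma> h" using bd by blast
      also have "\<dots> \<le> ennreal C * \<sigma> f" by (intro mult_left_mono hf) simp
      finally show ?thesis .
    qed
    have "ennreal C * \<sigma> f < \<infinity>" using fin by (simp add: ennreal_mult_less_top)
    then have fT: "f \<in> TX \<rho>" using le by (rule TX_I[OF f1])
    then have "TX_norm \<rho> f \<le> ennreal C * \<sigma> f" using le by (rule TX_norm_le)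
    with fT show "f \<in> TX \<rho> \<and> TX_norm \<rho> f \<le> ennreal C * \<sigma> f" by blast
  qed
  obtain C where C: "\<And>f. f \<in> bfs_space \<rho> \<Longrightarrow> f \<in> L1 \<and> \<rho> (hilbert f) \<le> ennreal C * \<rho> f"
    by (rule hilbert_bounded[OF assms(1,2,4)]) blast
  have "\<forall>f\<in>bfs_space \<rho>. f \<in> TX \<rho> \<and> TX_norm \<rho> f \<le> ennreal C * \<rho> f"
    by (rule extension[OF \<rho>]) (use C in auto)
  moreover have "\<forall>f\<in>TX \<rho>. hilbert f \<in> bfs_space \<rho> \<and> \<rho> (hilbert f) \<le> ennreal 1 * TX_norm \<rho> f"
  proof
    fix f assume f: "f \<in> TX \<rho>"
    have f0: "f \<in> L0" by (rule L1_L0[OF TX_subset[OF f]])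
    have "\<rho> (hilbert f) \<le> TX_norm \<rho> f" by (rule TX_norm_ge[OF f f0]) simp
    moreover have "hilbert f \<in> bfs_space \<rho>" using f f0 by (simp add: TX_def)
    ultimately show "hilbert f \<in> bfs_space \<rho> \<and> \<rho> (hilbert f) \<le> ennreal 1 * TX_norm \<rho> f" by simp
  qed
  ultimately show ?thesis
    using bfs_TX_norm[OF \<rho>] bfs_space_TX_norm[OF \<rho>] extension by meson
qed

end
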